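(* Suppose $\varphi$ is an elliptic automorphism of the open unit disk $D$ of order $3$ and the fixed point of $\varphi$ in $D$ is $a\in D\setminus\{0\}$. Put $$\Delta=\frac{|a|}{1+|a|^2},\qquad L=\frac{3+6\Delta^3\sqrt{3-3\Delta^2}-6\Delta^4-6\Delta^2}{4(1-\Delta^2)(1-4\Delta^2)}.$$ Then, identifying $\mathbb{C}$ with $\mathbb{R}^2$ via $x+iy\leftrightarrow(x,y)$, the numerical range $W(C_\varphi)$ of the composition operator $C_\varphi$ on the Hardy space $H^2(D)$ is the interior of the convex hull of the algebraic curve with equation $$\begin{aligned}&\left(1-\frac{27}{64L^3}\right)(x^2+y^2)^3+\frac{27}{64L^3}(x^3-3xy^2)^2-\frac{9}{4L}(x^2+y^2)(x^3-3xy^2)\\&\quad+\left(\frac{27}{16L^2}-L\right)(x^2+y^2)^2+\left(2-\frac{27}{64L^3}\right)(x^3-3xy^2)-\frac{9}{8L}(x^2+y^2)+\frac{27}{256L^3}=0.\end{aligned}$$ This curve is an algebraic curve of class $3$ and degree $6$, and its real foci are $1$, $e^{2\pi i/3}$ and $e^{4\pi i/3}$.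
   Context: $D$ is the open unit disk in $\mathbb{C}$. $H^2(D)$ is the Hardy space of the disk, a Hilbert space with inner product $\langle f,g\rangle=\lim_{r\to1^-}\int_0^{2\pi} f(re^{i\theta})\overline{g(re^{i\theta})}\frac{d\theta}{2\pi}$. For a holomorphic self-map $\varphi$ of $D$, $C_\varphi$ is the bounded operator $C_\varphi f=f\circ\varphi$ on $H^2(D)$. The numerical range of a bounded operator $T$ on a Hilbert space $\mathscr{H}$ is $W(T)=\{\langle Tf,f\rangle: f\in\mathscr{H},\ \|f\|=1\}$. An elliptic automorphism of $D$ is a holomorphic automorphism of $D$, other than the identity, having a (unique) fixed point in $D$; its order is $p$ if $p$ is the least positive integer such that its $p$-th iterate is the identity. The convex hull of the curve means the convex hull of its set of real points $(x,y)\in\mathbb{R}^2$. For a plane algebraic curve (considered in the projective plane with homogeneous coordinates $(x,y,z)$), the dual curve is the curve in the dual projective plane formed by its tangent lines, where the line $ux+vy+wz=0$ corresponds to the dual point $(u,v,w)$; the class of the curve is the degree of its dual curve. A real focus of the curve is a real point such that the lines joining it to the two circular points $(1,i,0)$ and $(1,-i,0)$ are both tangent to the curve, i.e. both correspond to points of the dual curve. *)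

theory Defs
  imports "HOL-Complex_Analysis.Complex_Analysis"
begin

section \<open>The Hardy space, composition operators, numerical ranges\<close>

abbreviation unit_disc :: "complex set" where
  "unit_disc \<equiv> ball 0 1"

text \<open>Elements of the Hardy space are functions on the disc. They are represented by functions
  on the complex plane whose values off the disc are irrelevant: no definition below inspects
  them.\<close>

definition hardy_space :: "(complex \<Rightarrow> complex) set" where
  "hardy_space = {f. f holomorphic_on unit_disc \<and>
     bdd_above ((\<lambda>r. integral {0..2*pi} (\<lambda>t. (cmod (f (of_real r * cis t)))\<^sup>2) / (2*pi)) ` {0..<1})}"

definition hardy_inner :: "(complex \<Rightarrow> complex) \<Rightarrow> (complex \<Rightarrow> complex) \<Rightarrow> complex" where
  "hardy_inner f g = Lim (at_left 1)
     (\<lambda>r::real. integral {0..2*pi}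
        (\<lambda>t. f (of_real r * cis t) * cnj (g (of_real r * cis t))) / (2 * of_real pi))"

definition comp_op :: "(complex \<Rightarrow> complex) \<Rightarrow> (complex \<Rightarrow> complex) \<Rightarrow> complex \<Rightarrow> complex" where
  "comp_op \<phi> f = f \<circ> \<phi>"

text \<open>Numerical range of an operator \<open>T\<close> on the Hilbert space with carrier \<open>H\<close> and inner
  product \<open>ip\<close> (linear in the first argument).\<close>

definition numerical_range ::
  "'a set \<Rightarrow> ('a \<Rightarrow> 'a \<Rightarrow> complex) \<Rightarrow> ('a \<Rightarrow> 'a) \<Rightarrow> complex set" where
  "numerical_range H ip T = {ip (T f) f | f. f \<in> H \<and> sqrt (Re (ip f f)) = 1}"

section \<open>Elliptic automorphisms of the disc\<close>

definition disc_automorphism :: "(complex \<Rightarrow> complex) \<Rightarrow> bool" where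
  "disc_automorphism \<phi> \<longleftrightarrow>
     \<phi> holomorphic_on unit_disc \<and> \<phi> ` unit_disc \<subseteq> unit_disc \<and>
     (\<exists>\<psi>. \<psi> holomorphic_on unit_disc \<and> \<psi> ` unit_disc \<subseteq> unit_disc \<and>
          (\<forall>z\<in>unit_disc. \<psi> (\<phi> z) = z \<and> \<phi> (\<psi> z) = z))"

definition elliptic_automorphism :: "(complex \<Rightarrow> complex) \<Rightarrow> bool" where
  "elliptic_automorphism \<phi> \<longleftrightarrow>
     disc_automorphism \<phi> \<and> (\<exists>z\<in>unit_disc. \<phi> z \<noteq> z) \<and> (\<exists>z\<in>unit_disc. \<phi> z = z)"

definition has_order :: "(complex \<Rightarrow> complex) \<Rightarrow> nat \<Rightarrow> bool" where
  "has_order \<phi> p \<longleftrightarrow>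
     0 < p \<and> (\<forall>z\<in>unit_disc. (\<phi> ^^ p) z = z) \<and>
     (\<forall>q. 0 < q \<and> q < p \<longrightarrow> \<not> (\<forall>z\<in>unit_disc. (\<phi> ^^ q) z = z))"

section \<open>Plane projective curves\<close>

text \<open>Points of the complex projective plane and of its dual are given by nonzero homogeneous
  coordinate triples; a subset of the plane is given by the set of all nonzero triples
  representing its points. Over the complex numbers a ternary form is determined by the
  polynomial function it induces, so forms are represented by these functions.\<close>

type_synonym triple = "complex \<times> complex \<times> complex"

definition form :: "nat \<Rightarrow> (triple \<Rightarrow> complex) \<Rightarrow> bool" where
  "form d F \<longleftrightarrow> (\<exists>c. \<forall>x y z.
     F (x, y, z) = (\<Sum>i\<le>d. \<Sum>j\<le>d-i. c i j * x^i * y^j * z^(d-i-j)))"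

text \<open>A reduced form is a form without multiple factors. It is automatically nonzero, since the
  zero form is \<open>x\<^sup>2 \<cdot> 0\<close>. All factors of a form are forms, so it suffices to consider these.\<close>

definition reduced_form :: "nat \<Rightarrow> (triple \<Rightarrow> complex) \<Rightarrow> bool" where
  "reduced_form d F \<longleftrightarrow> form d F \<and>
     \<not> (\<exists>e k H K. 0 < e \<and> form e H \<and> form k K \<and> (\<forall>p. F p = (H p)\<^sup>2 * K p))"

definition proj_zeros :: "(triple \<Rightarrow> complex) \<Rightarrow> triple set" where
  "proj_zeros F = {p. p \<noteq> 0 \<and> F p = 0}"

text \<open>The degree of a curve is the degree of its reduced equation.\<close>

definition curve_of_degree :: "nat \<Rightarrow> triple set \<Rightarrow> bool" where
  "curve_of_degree d C \<longleftrightarrow> (\<exists>F. reduced_form d F \<and> C = proj_zeros F)"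

definition incident :: "triple \<Rightarrow> triple \<Rightarrow> bool" where
  "incident = (\<lambda>(u, v, w) (x, y, z). u * x + v * y + w * z = 0)"

definition grad :: "(triple \<Rightarrow> complex) \<Rightarrow> triple \<Rightarrow> triple" where
  "grad F = (\<lambda>(x, y, z).
     (deriv (\<lambda>t. F (t, y, z)) x, deriv (\<lambda>t. F (x, t, z)) y, deriv (\<lambda>t. F (x, y, t)) z))"

definition zariski_closure :: "triple set \<Rightarrow> triple set" where
  "zariski_closure S = {q. q \<noteq> 0 \<and> (\<forall>d G. form d G \<and> (\<forall>s\<in>S. G s = 0) \<longrightarrow> G q = 0)}"

text \<open>For a reduced form \<open>F\<close>, the tangent line of the curve \<open>F = 0\<close> at a smooth point \<open>p\<close> has the
  coordinates \<open>grad F p\<close>. The dual curve consists of these lines together with their limits,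
  which account for the tangents at the singular points.\<close>

definition tangent_lines :: "(triple \<Rightarrow> complex) \<Rightarrow> triple set" where
  "tangent_lines F = {grad F p | p. p \<in> proj_zeros F \<and> grad F p \<noteq> 0}"

definition dual_curve :: "(triple \<Rightarrow> complex) \<Rightarrow> triple set" where
  "dual_curve F = zariski_closure (tangent_lines F)"

definition curve_of_class :: "nat \<Rightarrow> (triple \<Rightarrow> complex) \<Rightarrow> bool" where
  "curve_of_class n F \<longleftrightarrow>
     (\<exists>d. reduced_form d F) \<and> curve_of_degree n (dual_curve F)"

text \<open>The real point with homogeneous coordinates \<open>(x, y, z)\<close>; it may lie at infinity. It is
  never a circular point, so the two joining lines are unique.\<close>

definition real_focus :: "(triple \<Rightarrow> complex) \<Rightarrow> real \<Rightarrow> real \<Rightarrow> real \<Rightarrow> bool" where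
  "real_focus F x y z \<longleftrightarrow> (x, y, z) \<noteq> 0 \<and>
     (\<forall>c\<in>{(1, \<i>, 0), (1, - \<i>, 0)}. \<exists>l\<in>dual_curve F.
        incident l (of_real x, of_real y, of_real z) \<and> incident l c)"

text \<open>\<open>F\<close> is the (unique) homogenization of the polynomial function \<open>P\<close> in two variables, and
  \<open>P\<close> has degree exactly \<open>d\<close>: its leading part \<open>F (x, y, 0)\<close> does not vanish.\<close>

definition homogenization ::
  "nat \<Rightarrow> (complex \<Rightarrow> complex \<Rightarrow> complex) \<Rightarrow> (triple \<Rightarrow> complex) \<Rightarrow> bool" where
  "homogenization d P F \<longleftrightarrow>
     form d F \<and> (\<forall>x y. F (x, y, 1) = P x y) \<and> (\<exists>x y. F (x, y, 0) \<noteq> 0)"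

text \<open>Polymorphic, so that the same equation serves for real and for complex points.\<close>

definition sextic :: "'a::field \<Rightarrow> 'a \<Rightarrow> 'a \<Rightarrow> 'a" where
  "sextic L x y =
     (1 - 27 / (64 * L^3)) * (x^2 + y^2)^3
     + 27 / (64 * L^3) * (x^3 - 3 * x * y^2)^2
     - 9 / (4 * L) * (x^2 + y^2) * (x^3 - 3 * x * y^2)
     + (27 / (16 * L^2) - L) * (x^2 + y^2)^2
     + (2 - 27 / (64 * L^3)) * (x^3 - 3 * x * y^2)
     - 9 / (8 * L) * (x^2 + y^2)
     + 27 / (256 * L^3)"

end

(*
Conjugating phi to the rotation by a primitive cube root of unity l and substituting in the
boundary integrals, <C_phi f, f> becomes a circle mean of the cyclic expression
(sum over k of f_(k+1) * cnj f_k * w_k) / 3, where f_0, f_1, f_2 are the values on a fibre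
{zeta, l zeta, l^2 zeta} of the cubing map and w_k are the values there of the Poisson kernel of a.
So the numerical range is governed by a family of weighted cyclic 3 x 3 matrices. The largest
eigenvalue of the real part of such a matrix rotated by z is the top root of
4 t^3 - S t = Re (z^3), S being the sum of the ratios of consecutive weights. On the circle S is at
most 4 L, with equality at a single value zeta0 of (zeta / u)^3, u = a / |a|; more precisely
4 L - S is at least a multiple of |(zeta / u)^3 - zeta0|^2. Hence the support function is the top root
of 4 t^3 - 4 L t = Re (z^3). It is approached by polynomials peaking at the extremal fibre, and it is
not attained, because the gap forces the boundary values of an extremal f to vanish.
Together with convexity this identifies the numerical range with the interior of a convex body.

In the coordinates u + i v, u - i v, w on the dual plane, the equation 4 t^3 - 4 L t = Re (z^3)
homogenizes to a Hesse cubic A^3 + B^3 + C^3 + 6 m A B C, whose dual is the given sextic. The foci are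
read off from the three points of the cubic on each of the coordinate lines A = 0 and B = 0.
*)

theory Submission
  imports Defs "HOL-Computational_Algebra.Fundamental_Theorem_Algebra"
begin

section \<open>The Hesse cubic and its dual\<close>

text \<open>Origin of L: clearing denominators in 4 L - S on a fibre leaves a trigonometric
  polynomial of degree one in \<tau>^3, namely E - Re (c \<tau>^3) with E = 4 L (1 - 3 \<Delta>^2) -
  3 and c = \<Delta>^3 (8 L - 6 l). It is nonnegative with a zero on the circle exactly when E =
  |c|. Since |8 L - 6 l|^2 = 64 L^2 + 48 L + 36, this is a quadratic equation for L, and the given L
  is its root with E > 0. The bound 3/4 < L acts twice: it makes the dual cubic smooth (1 + 8 m^3
  \<noteq> 0 at m = - 2 L / 3), and it puts the local minimum of 4 t^3 - 4 L t below -1, so that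
  every direction has three distinct real roots. The analytic obstacle is that elements of the Hardy
  space come without boundary values. Integrals over the unit circle are taken only for functions
  continuous on the closed disc; a general f is replaced by f (r z) with r tending to 1. Strictness
  survives this limit because the gap is kept as an explicit lower bound whose limit is
  positive.\<close>

definition hesse :: "complex \<Rightarrow> complex \<Rightarrow> complex \<Rightarrow> complex \<Rightarrow> complex" where
  "hesse m A B C = A^3 + B^3 + C^3 + 6 * m * A * B * C"

text \<open>The classical reciprocal of the Hesse cubic: its points are the lines X A + Y B + Z C =
  0 touching the cubic. The identities below establish this.\<close>

definition hesse_dual :: "complex \<Rightarrow> complex \<Rightarrow> complex \<Rightarrow> complex \<Rightarrow> complex" where
  "hesse_dual m X Y Z = X^6 + Y^6 + Z^6 - 2 * (1 + 16 * m^3) * (Y^3 * Z^3 + Z^3 * X^3 + X^3 * Y^3)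
     - 24 * m^2 * X * Y * Z * (X^3 + Y^3 + Z^3) - (24 * m + 48 * m^4) * X^2 * Y^2 * Z^2"

text \<open>Only the derivative in the first variable is written out; the sextic is symmetric, so
  the other two arise by rotating the arguments.\<close>

definition hesse_dual_partial :: "complex \<Rightarrow> complex \<Rightarrow> complex \<Rightarrow> complex \<Rightarrow> complex" where
  "hesse_dual_partial m X Y Z = 6 * X^5 - 6 * (1 + 16 * m^3) * X^2 * (Y^3 + Z^3)
     - 24 * m^2 * Y * Z * (4 * X^3 + Y^3 + Z^3) - 2 * (24 * m + 48 * m^4) * X * Y^2 * Z^2"

text \<open>The arguments are a third of the gradient of the cubic, so its Gauss map sends the cubic
  into the sextic. With the cofactor written out this is a polynomial identity.\<close>

lemma hesse_dual_gradient:
  "hesse_dual m (A^2 + 2 * m * B * C) (B^2 + 2 * m * C * A) (C^2 + 2 * m * A * B) = hesse m A B C *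
      (A^9 - 96*A^7*B*C*m^4 + 6*A^7*B*C*m - 256*A^6*B^3*m^6 - 64*A^6*B^3*m^3 - A^6*B^3 -
       256*A^6*C^3*m^6 - 64*A^6*C^3*m^3 - A^6*C^3 - 768*A^5*B^2*C^2*m^8 - 1344*A^5*B^2*C^2*m^5
       - 48*A^5*B^2*C^2*m^2 - 1536*A^4*B^4*C*m^7 - 576*A^4*B^4*C*m^4 - 12*A^4*B^4*C*m -
       1536*A^4*B*C^4*m^7 - 576*A^4*B*C^4*m^4 - 12*A^4*B*C^4*m - 256*A^3*B^6*m^6 -
       64*A^3*B^6*m^3 - A^3*B^6 - 512*A^3*B^3*C^3*m^9 - 3840*A^3*B^3*C^3*m^6 -
       288*A^3*B^3*C^3*m^3 + 2*A^3*B^3*C^3 - 256*A^3*C^6*m^6 - 64*A^3*C^6*m^3 - A^3*C^6 -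
       768*A^2*B^5*C^2*m^8 - 1344*A^2*B^5*C^2*m^5 - 48*A^2*B^5*C^2*m^2 - 768*A^2*B^2*C^5*m^8 -
       1344*A^2*B^2*C^5*m^5 - 48*A^2*B^2*C^5*m^2 - 96*A*B^7*C*m^4 + 6*A*B^7*C*m -
       1536*A*B^4*C^4*m^7 - 576*A*B^4*C^4*m^4 - 12*A*B^4*C^4*m - 96*A*B*C^7*m^4 + 6*A*B*C^7*m +
       B^9 - 256*B^6*C^3*m^6 - 64*B^6*C^3*m^3 - B^6*C^3 - 256*B^3*C^6*m^6 - 64*B^3*C^6*m^3 -
       B^3*C^6 + C^9)"
  unfolding hesse_def hesse_dual_def by algebra

text \<open>Biduality: on the cubic, the tangent to the sextic at the image of (A : B : C) is (A : B
  : C) again. For 1 + 8 m^3 \<noteq> 0 the factor vanishes only where A B C = 0, that is at the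
  flexes, which correspond to the cusps of the sextic.\<close>

lemma hesse_dual_partial_gradient:
  "hesse_dual_partial m (A^2 + 2 * m * B * C) (B^2 + 2 * m * C * A) (C^2 + 2 * m * A * B) =
     12 * (1 + 8 * m^3)^3 * (A * B * C)^3 * A + hesse m A B C *
      (6*A^7 - 384*A^5*B*C*m^4 + 24*A^5*B*C*m - 768*A^4*B^3*m^6 - 240*A^4*B^3*m^3 - 6*A^4*B^3 -
       768*A^4*C^3*m^6 - 240*A^4*C^3*m^3 - 6*A^4*C^3 - 1536*A^3*B^2*C^2*m^8 -
       3072*A^3*B^2*C^2*m^5 - 144*A^3*B^2*C^2*m^2 - 768*A^2*B^4*C*m^7 - 864*A^2*B^4*C*m^4 -
       24*A^2*B^4*C*m - 768*A^2*B*C^4*m^7 - 864*A^2*B*C^4*m^4 - 24*A^2*B*C^4*m - 48*A*B^6*m^3 -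
       2304*A*B^3*C^3*m^6 - 384*A*B^3*C^3*m^3 - 48*A*C^6*m^3 - 384*B^5*C^2*m^5 - 48*B^5*C^2*m^2
       - 384*B^2*C^5*m^5 - 48*B^2*C^5*m^2)"
  unfolding hesse_def hesse_dual_partial_def by algebra

text \<open>The opposite direction of the duality: the Gauss map of the sextic lands on the cubic,
  at arbitrary points of the sextic, so that no parametrisation of these is called for.\<close>

lemma hesse_gradient_hesse_dual:
  "hesse m (hesse_dual_partial m A B C) (hesse_dual_partial m B C A) (hesse_dual_partial m C A B) =
     hesse_dual m A B C *
      (216*A^9 + 20736*A^7*B*C*m^5 - 5184*A^7*B*C*m^2 + 69120*A^6*B^3*m^6 + 1728*A^6*B^3*m^3 -
       216*A^6*B^3 + 69120*A^6*C^3*m^6 + 1728*A^6*C^3*m^3 - 216*A^6*C^3 +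
       331776*A^5*B^2*C^2*m^7 + 145152*A^5*B^2*C^2*m^4 + 1296*A^5*B^2*C^2*m +
       165888*A^4*B^4*C*m^8 + 269568*A^4*B^4*C*m^5 + 15552*A^4*B^4*C*m^2 + 165888*A^4*B*C^4*m^8
       + 269568*A^4*B*C^4*m^5 + 15552*A^4*B*C^4*m^2 + 69120*A^3*B^6*m^6 + 1728*A^3*B^6*m^3 -
       216*A^3*B^6 + 110592*A^3*B^3*C^3*m^9 + 746496*A^3*B^3*C^3*m^6 + 134784*A^3*B^3*C^3*m^3 +
       864*A^3*B^3*C^3 + 69120*A^3*C^6*m^6 + 1728*A^3*C^6*m^3 - 216*A^3*C^6 +
       331776*A^2*B^5*C^2*m^7 + 145152*A^2*B^5*C^2*m^4 + 1296*A^2*B^5*C^2*m +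
       331776*A^2*B^2*C^5*m^7 + 145152*A^2*B^2*C^5*m^4 + 1296*A^2*B^2*C^5*m + 20736*A*B^7*C*m^5
       - 5184*A*B^7*C*m^2 + 165888*A*B^4*C^4*m^8 + 269568*A*B^4*C^4*m^5 + 15552*A*B^4*C^4*m^2 +
       20736*A*B*C^7*m^5 - 5184*A*B*C^7*m^2 + 216*B^9 + 69120*B^6*C^3*m^6 + 1728*B^6*C^3*m^3 -
       216*B^6*C^3 + 69120*B^3*C^6*m^6 + 1728*B^3*C^6*m^3 - 216*B^3*C^6 + 216*C^9)"
  unfolding hesse_def hesse_dual_def hesse_dual_partial_def by algebra

text \<open>Substituting C = - (X A + Y B) turns the cubic into the binary form p A^3 + q A^2 B + r
  A B^2 + s B^3, whose discriminant vanishes exactly for a tangent line.\<close>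

lemma hesse_line_discriminant:
  fixes m X Y :: complex
  defines "p \<equiv> 1 - X^3" and "q \<equiv> - 3 * X^2 * Y - 6 * m * X"
    and "r \<equiv> - 3 * X * Y^2 - 6 * m * Y" and "s \<equiv> 1 - Y^3"
  shows "q^2 * r^2 - 4 * p * r^3 - 4 * q^3 * s - 27 * p^2 * s^2 + 18 * p * q * r * s
           = - 27 * hesse_dual m X Y 1"
  unfolding assms hesse_dual_def by (simp only: power_one mult_1_left mult_1_right) algebra

section \<open>Ternary forms, a criterion for reducedness, and density of non-flexes\<close>

lemma form_monomial:
  assumes "i + j \<le> d"
  shows "form d (\<lambda>(x, y, z). k * x^i * y^j * z^(d-i-j))"
proof -
  define c where "c = (\<lambda>i' j'. if i' = i \<and> j' = j then k else 0)"
  have "(\<Sum>i'\<le>d. \<Sum>j'\<le>d-i'. c i' j' * x^i' * y^j' * z^(d-i'-j')) = k * x^i * y^j * z^(d-i-j)"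
    for x y z :: complex
  proof -
    have "(\<Sum>i'\<le>d. \<Sum>j'\<le>d-i'. c i' j' * x^i' * y^j' * z^(d-i'-j'))
        = (\<Sum>i'\<le>d. if i' = i then k * x^i * y^j * z^(d-i-j) else 0)"
    proof (rule sum.cong)
      fix i' assume "i' \<in> {..d}"
      have "(\<Sum>j'\<le>d-i'. c i' j' * x^i' * y^j' * z^(d-i'-j'))
          = (\<Sum>j'\<le>d-i'. if j' = j then (if i' = i then k * x^i * y^j * z^(d-i-j) else 0) else 0)"
        by (intro sum.cong) (auto simp: c_def)
      also have "\<dots> = (if i' = i then k * x^i * y^j * z^(d-i-j) else 0)"
        using assms by (subst sum.delta) auto
      finally show "(\<Sum>j'\<le>d-i'. c i' j' * x^i' * y^j' * z^(d-i'-j'))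
          = (if i' = i then k * x^i * y^j * z^(d-i-j) else 0)" .
    qed simp
    also have "\<dots> = k * x^i * y^j * z^(d-i-j)"
      using assms by (subst sum.delta) auto
    finally show ?thesis .
  qed
  then show ?thesis
    unfolding form_def by (intro exI[of _ c]) simp
qed

lemma form_add:
  assumes "form d F" and "form d G"
  shows "form d (\<lambda>p. F p + G p)"
proof -
  obtain a b where "\<And>x y z. F (x, y, z) = (\<Sum>i\<le>d. \<Sum>j\<le>d-i. a i j * x^i * y^j * z^(d-i-j))"
    and "\<And>x y z. G (x, y, z) = (\<Sum>i\<le>d. \<Sum>j\<le>d-i. b i j * x^i * y^j * z^(d-i-j))"
    using assms unfolding form_def by blast
  then show ?thesis
    unfolding form_def
    by (intro exI[of _ "\<lambda>i j. a i j + b i j"]) (simp add: sum.distrib algebra_simps)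
qed

lemma form_homogeneous:
  assumes "form d F"
  shows "F (k * x, k * y, k * z) = k^d * F (x, y, z)"
proof -
  obtain c where c: "\<And>x y z. F (x, y, z) = (\<Sum>i\<le>d. \<Sum>j\<le>d-i. c i j * x^i * y^j * z^(d-i-j))"
    using assms unfolding form_def by blast
  have "c i j * (k*x)^i * (k*y)^j * (k*z)^(d-i-j) = k^d * (c i j * x^i * y^j * z^(d-i-j))"
    if "i \<le> d" "j \<le> d - i" for i j
  proof -
    have "d = i + j + (d-i-j)" using that by simp
    then have "k^d = k^i * k^j * k^(d-i-j)" by (metis power_add)
    then show ?thesis by (simp add: power_mult_distrib)
  qed
  then show ?thesis
    unfolding c sum_distrib_left by (intro sum.cong refl) auto
qed

lemma form_continuous:
  assumes "form d F"
  shows "continuous_on UNIV F"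
proof -
  obtain c where c: "\<And>x y z. F (x, y, z) = (\<Sum>i\<le>d. \<Sum>j\<le>d-i. c i j * x^i * y^j * z^(d-i-j))"
    using assms unfolding form_def by blast
  have "F = (\<lambda>p. \<Sum>i\<le>d. \<Sum>j\<le>d-i. c i j * fst p^i * fst (snd p)^j * snd (snd p)^(d-i-j))"
    using c by (metis (no_types, lifting) ext prod.collapse)
  then show ?thesis by (auto intro!: continuous_intros)
qed

lemma form_on_line_poly:
  assumes "form d F"
  obtains P where "\<And>t. F (x + t * u, y + t * v, z + t * w) = poly P t"
proof -
  obtain c where c: "\<And>x y z. F (x, y, z) = (\<Sum>i\<le>d. \<Sum>j\<le>d-i. c i j * x^i * y^j * z^(d-i-j))"
    using assms unfolding form_def by blast
  show ?thesis
    by (rule that[of "\<Sum>i\<le>d. \<Sum>j\<le>d-i. smult (c i j) ([:x, u:]^i * [:y, v:]^j * [:z, w:]^(d-i-j))"])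
      (simp add: c poly_sum mult.assoc)
qed

text \<open>The restriction to a line is a binary form of positive degree. If its dehomogenisation
  has no root, it is a constant, the form is that constant times s^e, and s = 0 is the zero.\<close>

lemma form_zero_on_line:
  assumes H: "form e H" and e: "0 < e"
  obtains s t where "(s, t) \<noteq> (0, 0)" "H (s * x + t * u, s * y + t * v, s * z + t * w) = 0"
proof (cases "\<exists>t. H (x + t * u, y + t * v, z + t * w) = 0")
  case True
  then obtain t where "H (x + t * u, y + t * v, z + t * w) = 0" ..
  then show ?thesis using that[of 1 t] by simp
next
  case False
  obtain P where P: "\<And>t. H (x + t * u, y + t * v, z + t * w) = poly P t"
    using form_on_line_poly[OF H, of x u y v z w] by metis
  then obtain k where k: "H (x + t * u, y + t * v, z + t * w) = k" for t
    using False Fundamental_Theorem_Algebra.fundamental_theorem_of_algebra[of P] by (metis constant_def)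
  have *: "H (s * x + u, s * y + v, s * z + w) = s^e * k" if "s \<noteq> 0" for s
    using form_homogeneous[OF H, of s "x + (1/s) * u" "y + (1/s) * v" "z + (1/s) * w"] that
    by (simp only: k) (simp add: algebra_simps)
  \<comment> \<open>Homogeneity gives the value only for s \<noteq> 0; the value at s = 0 is reached
    by continuity.\<close>
  have "continuous_on UNIV (\<lambda>s. H (s * x + u, s * y + v, s * z + w))"
    by (rule continuous_on_compose2[OF form_continuous[OF H]]) (auto intro!: continuous_intros)
  then have "((\<lambda>s. H (s * x + u, s * y + v, s * z + w)) \<longlongrightarrow> H (u, v, w)) (at 0)"
    by (fastforce simp: continuous_on_def dest!: spec[of _ 0])
  then have "((\<lambda>s. s^e * k) \<longlongrightarrow> H (u, v, w)) (at 0)"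
    by (rule Lim_transform_eventually) (auto simp: eventually_at_filter *)
  moreover have "((\<lambda>s. s^e * k) \<longlongrightarrow> 0^e * k) (at 0)"
    by (intro tendsto_intros)
  ultimately have "H (u, v, w) = 0^e * k"
    by (intro tendsto_unique[of "at 0"]) auto
  then show ?thesis using that[of 0 1] e by simp
qed

text \<open>A repeated factor H meets the given line, and at that point both F = H^2 K and its
  derivative vanish. Hence a single line without such a double zero shows that F is reduced.\<close>

lemma reduced_formI:
  assumes F: "form d F"
    and *: "\<And>s t. F (s * x + t * u, s * y + t * v, s * z + t * w) = 0 \<Longrightarrow>
      ((\<lambda>t. F (s * x + t * u, s * y + t * v, s * z + t * w)) has_field_derivative 0) (at t) \<Longrightarrow>
      s = 0 \<and> t = 0"
  shows "reduced_form d F"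
  unfolding reduced_form_def
proof (intro conjI notI F)
  assume "\<exists>e k H K. 0 < e \<and> form e H \<and> form k K \<and> (\<forall>p. F p = (H p)\<^sup>2 * K p)"
  then obtain e k H K where e: "0 < e" and H: "form e H" and K: "form k K"
    and FHK: "\<And>p. F p = (H p)\<^sup>2 * K p" by blast
  obtain s t where st: "(s, t) \<noteq> (0, 0)" and zero: "H (s * x + t * u, s * y + t * v, s * z + t * w) = 0"
    using form_zero_on_line[OF H e] by metis
  obtain P Q where P: "\<And>t. H (s * x + t * u, s * y + t * v, s * z + t * w) = poly P t"
    and Q: "\<And>t. K (s * x + t * u, s * y + t * v, s * z + t * w) = poly Q t"
    using form_on_line_poly[OF H] form_on_line_poly[OF K] by metis
  have "((\<lambda>t. (poly P t)\<^sup>2 * poly Q t) has_field_derivative 0) (at t)"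
    using zero by (auto intro!: derivative_eq_intros simp: P)
  then show False
    using *[of s t] st zero by (auto simp: FHK P Q)
qed

text \<open>If all roots were at distance at least r from a, the factorisation into linear factors
  would make |P a| at least r^n, where n is the degree.\<close>

lemma monic_poly_root_near:
  fixes P :: "complex poly"
  assumes "lead_coeff P = 1" and "cmod (poly P a) < r ^ degree P" and "0 < r"
  obtains z where "poly P z = 0" and "cmod (z - a) < r"
proof -
  obtain root where "smult (lead_coeff P) (\<Prod>i<degree P. [:- root i, 1:]) = P"
    using complex_poly_decompose' by blast
  then have P: "P = (\<Prod>i<degree P. [:- root i, 1:])" using assms by simp
  have eq: "poly P z = (\<Prod>i<degree P. z - root i)" for z
    by (subst P) (simp add: poly_prod)
  have "\<exists>i<degree P. cmod (a - root i) < r"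
  proof (rule ccontr)
    assume "\<not> ?thesis"
    then have "(\<Prod>i<degree P. r) \<le> (\<Prod>i<degree P. cmod (a - root i))"
      using \<open>0 < r\<close> by (intro prod_mono) auto
    then show False using assms by (simp add: eq prod_norm)
  qed
  then obtain i where "i < degree P" "cmod (a - root i) < r" by blast
  moreover from this have "poly P (root i) = 0" by (auto simp: eq intro!: prod_zero)
  ultimately show ?thesis using that[of "root i"] by (simp add: norm_minus_commute)
qed

text \<open>B is kept and C moved from 0 to a small t > 0; the cubic in its first argument is monic
  and small at the old A, so it has a root nearby.\<close>

lemma hesse_approx_flex:
  assumes zero: "hesse m A B 0 = 0" and nz: "(A, B) \<noteq> (0, 0)" and e: "0 < e"
  obtains A' C' where "hesse m A' B C' = 0" "A' * B * C' \<noteq> 0" "cmod (A' - A) < e" "cmod C' < e"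
proof -
  have AB: "A^3 + B^3 = 0" using zero by (simp add: hesse_def)
  then have A: "A \<noteq> 0" and B: "B \<noteq> 0" using nz by auto
  \<comment> \<open>The cap at |A| keeps the perturbed first coordinate different from 0.\<close>
  define r where "r = min e (cmod A)"
  have r: "0 < r" using e A by (simp add: r_def)
  have "((\<lambda>t::real. cmod (hesse m A B (of_real t))) \<longlongrightarrow> cmod (hesse m A B (of_real 0))) (at_right 0)"
    unfolding hesse_def by (intro tendsto_intros)
  then have "\<forall>\<^sub>F t in at_right 0. cmod (hesse m A B (of_real t)) < r^3"
    using zero r by (intro order_tendstoD) auto
  moreover have "\<forall>\<^sub>F t::real in at_right 0. 0 < t \<and> t < e"
    using eventually_at_right_real[OF e] by simp
  ultimately have "\<forall>\<^sub>F t::real in at_right 0. cmod (hesse m A B (of_real t)) < r^3 \<and> 0 < t \<and> t < e"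
    by eventually_elim auto
  then obtain t :: real where t: "cmod (hesse m A B (of_real t)) < r^3" "0 < t" "t < e"
    using eventually_happens'[OF trivial_limit_at_right_real] by blast
  define P where "P = [:B^3 + of_real t^3, 6 * m * B * of_real t, 0, 1:]"
  have P: "poly P z = hesse m z B (of_real t)" for z
    by (simp add: P_def hesse_def algebra_simps power3_eq_cube)
  obtain z where "poly P z = 0" "cmod (z - A) < r"
  proof (rule monic_poly_root_near[of P A r])
    show "lead_coeff P = 1" by (simp add: P_def)
    have "degree P = 3" by (simp add: P_def)
    then show "cmod (poly P A) < r ^ degree P" using t P by simp
  qed (use r in auto)
  moreover from this have "z \<noteq> 0" by (auto simp: r_def)
  ultimately show ?thesis
    using that[of z "of_real t"] t B P by (auto simp: r_def)
qed

text \<open>Density of the points with A B C \<noteq> 0 on the cubic, which carries biduality over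
  to the flexes. The three flex cases differ by a permutation of the coordinates.\<close>

lemma hesse_approx:
  assumes zero: "hesse m A B C = 0" and nz: "(A, B, C) \<noteq> 0" and e: "0 < e"
  obtains A' B' C' where "hesse m A' B' C' = 0" "A' * B' * C' \<noteq> 0"
    "cmod (A' - A) < e" "cmod (B' - B) < e" "cmod (C' - C) < e"
proof -
  consider "A * B * C \<noteq> 0" | "C = 0" | "B = 0" | "A = 0" by auto
  then show ?thesis
  proof cases
    case 1
    then show ?thesis using that zero e by simp
  next
    case 2
    then obtain A' C' where "hesse m A' B C' = 0" "A' * B * C' \<noteq> 0" "cmod (A' - A) < e" "cmod C' < e"
      using hesse_approx_flex[of m A B e] assms by (auto simp: zero_prod_def)
    then show ?thesis using that[of A' B C'] 2 e by simp
  next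
    case 3
    have "hesse m A C 0 = 0" using zero 3 by (simp add: hesse_def)
    then obtain A' C' where "hesse m A' C C' = 0" "A' * C * C' \<noteq> 0" "cmod (A' - A) < e" "cmod C' < e"
      using hesse_approx_flex[of m A C e] nz e 3 by (auto simp: zero_prod_def)
    then show ?thesis using that[of A' C' C] 3 e by (simp add: hesse_def ac_simps)
  next
    case 4
    have "hesse m B C 0 = 0" using zero 4 by (simp add: hesse_def)
    then obtain A' C' where "hesse m A' C C' = 0" "A' * C * C' \<noteq> 0" "cmod (A' - B) < e" "cmod C' < e"
      using hesse_approx_flex[of m B C e] nz e 4 by (auto simp: zero_prod_def)
    then show ?thesis using that[of C' A' C] 4 e by (simp add: hesse_def ac_simps)
  qed
qed

lemma has_field_derivative_hesse_dual:
  assumes [derivative_intros]: "(f has_field_derivative f') (at t)" "(g has_field_derivative g') (at t)"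
    "(h has_field_derivative h') (at t)"
  shows "((\<lambda>t. hesse_dual m (f t) (g t) (h t)) has_field_derivative
    hesse_dual_partial m (f t) (g t) (h t) * f' + hesse_dual_partial m (g t) (h t) (f t) * g'
      + hesse_dual_partial m (h t) (f t) (g t) * h') (at t)"
proof -
  have "(6::nat) - Suc 0 = 5" "(3::nat) - Suc 0 = 2" "(2::nat) - Suc 0 = 1" by simp_all
  note * = this of_nat_numeral power_one_right
  show ?thesis
    unfolding hesse_dual_def hesse_dual_partial_def
    by (rule derivative_eq_intros refl)+ (simp only: *, algebra)
qed

section \<open>The curve in coordinates adapted to the circular points\<close>

definition line_form :: "complex \<Rightarrow> triple \<Rightarrow> complex" where
  "line_form m = (\<lambda>(u, v, w). hesse m ((u + \<i> * v) / 2) ((u - \<i> * v) / 2) w)"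

definition point_form :: "complex \<Rightarrow> complex \<Rightarrow> triple \<Rightarrow> complex" where
  "point_form m k = (\<lambda>(x, y, z). k * hesse_dual m (x - \<i> * y) (x + \<i> * y) z)"

text \<open>The line u x + v y + w z = 0 reads A (x - i y) + B (x + i y) + C z = 0. Thus A = 0 and B
  = 0 describe the lines through (1, i, 0) and (1, -i, 0).\<close>

definition line_of :: "complex \<Rightarrow> complex \<Rightarrow> complex \<Rightarrow> triple" where
  "line_of A B C = (A + B, \<i> * (B - A), C)"

lemma line_form_line_of [simp]: "line_form m (line_of A B C) = hesse m A B C"
proof -
  have "(A + B + \<i> * (\<i> * (B - A))) / 2 = A" "(A + B - \<i> * (\<i> * (B - A))) / 2 = B"
    by (simp_all add: algebra_simps flip: mult.assoc)
  then show ?thesis by (simp add: line_form_def line_of_def)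
qed

lemma line_of_cases:
  obtains A B C where "q = line_of A B C"
proof (cases q)
  case (fields u v w)
  then have "q = line_of ((u + \<i> * v) / 2) ((u - \<i> * v) / 2) w"
    by (simp add: line_of_def field_simps)
  then show ?thesis using that by blast
qed

lemma line_of_eq_0_iff: "line_of A B C = 0 \<longleftrightarrow> (A, B, C) = 0"
  by (auto simp: line_of_def zero_prod_def eq_neg_iff_add_eq_0)

lemma form_line_form: "form 3 (line_form m)"
proof -
  have "line_form m = (\<lambda>p. (\<lambda>(x, y, z). 1/4 * x^3 * y^0 * z^(3-3-0)) p
      + (\<lambda>(x, y, z). (-3/4) * x^1 * y^2 * z^(3-1-2)) p
      + (\<lambda>(x, y, z). (3 * m / 2) * x^2 * y^0 * z^(3-2-0)) p
      + (\<lambda>(x, y, z). (3 * m / 2) * x^0 * y^2 * z^(3-0-2)) p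
      + (\<lambda>(x, y, z). 1 * x^0 * y^0 * z^(3-0-0)) p)"
  proof (rule ext)
    fix p :: triple
    obtain x y z where p: "p = (x, y, z)" by (cases p)
    have i: "\<i>^2 = -1" by simp
    have "hesse m ((x + \<i> * y) / 2) ((x - \<i> * y) / 2) z = 1/4 * x^3 - 3/4 * x * y^2 + 3 * m / 2 * x^2 * z
        + 3 * m / 2 * y^2 * z + z^3"
      unfolding hesse_def by (simp add: field_simps) (use i in algebra)
    then show "line_form m p = (\<lambda>(x, y, z). 1/4 * x^3 * y^0 * z^(3-3-0)) p
      + (\<lambda>(x, y, z). (-3/4) * x^1 * y^2 * z^(3-1-2)) p
      + (\<lambda>(x, y, z). (3 * m / 2) * x^2 * y^0 * z^(3-2-0)) p
      + (\<lambda>(x, y, z). (3 * m / 2) * x^0 * y^2 * z^(3-0-2)) p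
      + (\<lambda>(x, y, z). 1 * x^0 * y^0 * z^(3-0-0)) p"
      by (simp add: line_form_def p)
  qed
  then show ?thesis
    by (simp only:) (intro form_add form_monomial; simp)
qed

lemma form_point_form: "form 6 (point_form m k)"
proof -
  define a where "a = - 2 * k * (1 + 16 * m^3)"
  define b where "b = - 24 * k * m^2"
  define c where "c = - k * (24 * m + 48 * m^4)"
  have "point_form m k = (\<lambda>p.
        (\<lambda>(x, y, z). (2 * k + a) * x^6 * y^0 * z^(6-6-0)) p
      + (\<lambda>(x, y, z). (- 30 * k + 3 * a) * x^4 * y^2 * z^(6-4-2)) p
      + (\<lambda>(x, y, z). (30 * k + 3 * a) * x^2 * y^4 * z^(6-2-4)) p
      + (\<lambda>(x, y, z). (a - 2 * k) * x^0 * y^6 * z^(6-0-6)) p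
      + (\<lambda>(x, y, z). (2 * a) * x^3 * y^0 * z^(6-3-0)) p
      + (\<lambda>(x, y, z). (- 6 * a) * x^1 * y^2 * z^(6-1-2)) p
      + (\<lambda>(x, y, z). (2 * b) * x^5 * y^0 * z^(6-5-0)) p
      + (\<lambda>(x, y, z). (- 4 * b) * x^3 * y^2 * z^(6-3-2)) p
      + (\<lambda>(x, y, z). (- 6 * b) * x^1 * y^4 * z^(6-1-4)) p
      + (\<lambda>(x, y, z). b * x^2 * y^0 * z^(6-2-0)) p
      + (\<lambda>(x, y, z). b * x^0 * y^2 * z^(6-0-2)) p
      + (\<lambda>(x, y, z). c * x^4 * y^0 * z^(6-4-0)) p
      + (\<lambda>(x, y, z). (2 * c) * x^2 * y^2 * z^(6-2-2)) p
      + (\<lambda>(x, y, z). c * x^0 * y^4 * z^(6-0-4)) p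
      + (\<lambda>(x, y, z). k * x^0 * y^0 * z^(6-0-0)) p)" (is "_ = ?F")
  proof (rule ext)
    fix p :: triple
    obtain x y z where p: "p = (x, y, z)" by (cases p)
    have i: "\<i>^2 = -1" by simp
    have "k * hesse_dual m (x - \<i> * y) (x + \<i> * y) z =
        (2 * k + a) * x^6 + (- 30 * k + 3 * a) * x^4 * y^2 + (30 * k + 3 * a) * x^2 * y^4
        + (a - 2 * k) * y^6 + 2 * a * x^3 * z^3 - 6 * a * x * y^2 * z^3 + 2 * b * x^5 * z
        - 4 * b * x^3 * y^2 * z - 6 * b * x * y^4 * z + b * x^2 * z^4 + b * y^2 * z^4
        + c * x^4 * z^2 + 2 * c * x^2 * y^2 * z^2 + c * y^4 * z^2 + k * z^6"
      unfolding hesse_dual_def a_def b_def c_def using i by algebra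
    then show "point_form m k p = ?F p"
      by (simp add: point_form_def p)
  qed
  then show ?thesis
    by (simp only:) (intro form_add form_monomial; simp)
qed

text \<open>The test line joins (1, i, 0) and (0, 0, 1): there A = 0, B = s, C = t, and the form
  becomes s^3 + t^3.\<close>

lemma reduced_line_form: "reduced_form 3 (line_form m)"
proof (rule reduced_formI[OF form_line_form])
  fix s t :: complex
  have *: "line_form m (s * 1 + t * 0, s * \<i> + t * 0, s * 0 + t * 1) = s^3 + t^3" for t
  proof -
    have e: "(s + \<i> * (s * \<i>)) / 2 = 0" "(s - \<i> * (s * \<i>)) / 2 = s"
      by (simp_all add: mult.left_commute[of \<i>])
    have "line_form m (s * 1 + t * 0, s * \<i> + t * 0, s * 0 + t * 1)
        = hesse m ((s + \<i> * (s * \<i>)) / 2) ((s - \<i> * (s * \<i>)) / 2) t"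
      by (simp add: line_form_def)
    also have "\<dots> = s^3 + t^3" unfolding e by (simp add: hesse_def)
    finally show ?thesis .
  qed
  assume "line_form m (s * 1 + t * 0, s * \<i> + t * 0, s * 0 + t * 1) = 0"
  then have zero: "s^3 + t^3 = 0" by (simp only: *)
  assume "((\<lambda>t. line_form m (s * 1 + t * 0, s * \<i> + t * 0, s * 0 + t * 1)) has_field_derivative 0) (at t)"
  then have "((\<lambda>t. s^3 + t^3) has_field_derivative 0) (at t)" by (simp only: *)
  moreover have "((\<lambda>t. s^3 + t^3) has_field_derivative 3 * t^2) (at t)"
    by (auto intro!: derivative_eq_intros)
  ultimately have "3 * t^2 = 0" by (metis DERIV_unique)
  then show "s = 0 \<and> t = 0" using zero by simp
qed

text \<open>On the same test line X = 2 s and Y = 0, and the restriction is a quadratic form in s^3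
  and t^3. It degenerates when c^2 = 1, and c^2 - 1 = 32 m^3 (1 + 8 m^3); hence the two conditions
  on m.\<close>

lemma reduced_point_form:
  assumes m: "m \<noteq> 0" "1 + 8 * m^3 \<noteq> 0" and k: "k \<noteq> 0"
  shows "reduced_form 6 (point_form m k)"
proof (rule reduced_formI[OF form_point_form])
  fix s t :: complex
  define c where "c = 1 + 16 * m^3"
  have c: "c^2 \<noteq> 1"
  proof
    assume "c^2 = 1"
    then have "32 * m^3 * (1 + 8 * m^3) = 0" unfolding c_def by algebra
    then show False using m by simp
  qed
  have *: "point_form m k (s * 1 + t * 0, s * \<i> + t * 0, s * 0 + t * 1)
      = k * (64 * s^6 + t^6 - 16 * c * s^3 * t^3)" for t
  proof -
    have e: "s + \<i> * (s * \<i>) = 0" "s - \<i> * (s * \<i>) = 2 * s"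
      by (simp_all add: mult.left_commute[of \<i>])
    have "point_form m k (s * 1 + t * 0, s * \<i> + t * 0, s * 0 + t * 1)
        = k * hesse_dual m (s - \<i> * (s * \<i>)) (s + \<i> * (s * \<i>)) t"
      by (simp add: point_form_def)
    also have "\<dots> = k * (64 * s^6 + t^6 - 16 * c * s^3 * t^3)"
      unfolding e by (simp add: hesse_dual_def c_def power_mult_distrib)
    finally show ?thesis .
  qed
  assume "point_form m k (s * 1 + t * 0, s * \<i> + t * 0, s * 0 + t * 1) = 0"
  then have zero: "64 * s^6 + t^6 - 16 * c * s^3 * t^3 = 0" using k by (simp only: *) simp
  assume "((\<lambda>t. point_form m k (s * 1 + t * 0, s * \<i> + t * 0, s * 0 + t * 1)) has_field_derivative 0) (at t)"
  then have "((\<lambda>t. k * (64 * s^6 + t^6 - 16 * c * s^3 * t^3)) has_field_derivative 0) (at t)" by (simp only: *)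
  moreover have "((\<lambda>t. k * (64 * s^6 + t^6 - 16 * c * s^3 * t^3)) has_field_derivative
      k * (0 + 6 * (1 * t^(6 - Suc 0)) - (16 * c * s^3) * (3 * (1 * t^(3 - Suc 0))))) (at t)"
    by (intro DERIV_cmult DERIV_diff DERIV_add DERIV_const DERIV_power[where n = 6, simplified of_nat_numeral]
        DERIV_power[where n = 3, simplified of_nat_numeral] DERIV_ident)
  moreover have "k * (0 + 6 * (1 * t^(6 - Suc 0)) - (16 * c * s^3) * (3 * (1 * t^(3 - Suc 0))))
      = k * (6 * t^5 - 48 * c * s^3 * t^2)" by simp
  ultimately have "k * (6 * t^5 - 48 * c * s^3 * t^2) = 0" using DERIV_unique by fastforce
  moreover have "k * (6 * t^5 - 48 * c * s^3 * t^2) = k * (6 * t^2 * (t^3 - 8 * c * s^3))" by algebra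
  ultimately have "6 * t^2 * (t^3 - 8 * c * s^3) = 0" using k by simp
  then consider "t = 0" | "t^3 = 8 * c * s^3" by auto
  then show "s = 0 \<and> t = 0"
  proof cases
    case 1
    then show ?thesis using zero by simp
  next
    case 2
    then have "64 * s^6 * (1 - c^2) = 0" using zero by algebra
    then show ?thesis using c 2 by simp
  qed
qed

lemma grad_point_form:
  "grad (point_form m k) (x, y, z) =
     (let X = x - \<i> * y; Y = x + \<i> * y in
      line_of (k * hesse_dual_partial m X Y z) (k * hesse_dual_partial m Y z X) (k * hesse_dual_partial m z X Y))"
proof -
  let ?X = "x - \<i> * y" and ?Y = "x + \<i> * y"
  have "((\<lambda>t. k * hesse_dual m (t - \<i> * y) (t + \<i> * y) z) has_field_derivative
      k * (hesse_dual_partial m ?X ?Y z * 1 + hesse_dual_partial m ?Y z ?X * 1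
        + hesse_dual_partial m z ?X ?Y * 0)) (at x)"
    by (intro DERIV_cmult has_field_derivative_hesse_dual) (auto intro!: derivative_eq_intros)
  moreover have "((\<lambda>t. k * hesse_dual m (x - \<i> * t) (x + \<i> * t) z) has_field_derivative
      k * (hesse_dual_partial m ?X ?Y z * (- \<i>) + hesse_dual_partial m ?Y z ?X * \<i>
        + hesse_dual_partial m z ?X ?Y * 0)) (at y)"
    by (intro DERIV_cmult has_field_derivative_hesse_dual) (auto intro!: derivative_eq_intros)
  moreover have "((\<lambda>t. k * hesse_dual m ?X ?Y t) has_field_derivative
      k * (hesse_dual_partial m ?X ?Y z * 0 + hesse_dual_partial m ?Y z ?X * 0
        + hesse_dual_partial m z ?X ?Y * 1)) (at z)"
    by (intro DERIV_cmult has_field_derivative_hesse_dual) (auto intro!: derivative_eq_intros)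
  ultimately show ?thesis
    by (auto simp: grad_def point_form_def line_of_def Let_def algebra_simps dest!: DERIV_imp_deriv)
qed

lemma hesse_scale: "hesse m (k * A) (k * B) (k * C) = k^3 * hesse m A B C"
  unfolding hesse_def by algebra

text \<open>Tangents lie on the cubic by \<open>hesse_gradient_hesse_dual\<close>. Conversely, a
  form vanishing on all tangents vanishes at the non-flexes by biduality and homogeneity, and at the
  flexes by continuity. Density in the ordinary topology thus replaces an argument with irreducible
  components.\<close>

lemma dual_curve_point_form:
  assumes m: "1 + 8 * m^3 \<noteq> 0" and k: "k \<noteq> 0"
  shows "dual_curve (point_form m k) = proj_zeros (line_form m)"
proof (intro equalityI subsetI)
  fix q assume q: "q \<in> dual_curve (point_form m k)"
  have "line_form m l = 0" if l: "l \<in> tangent_lines (point_form m k)" for l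
  proof -
    obtain x y z where zero: "point_form m k (x, y, z) = 0" and l: "l = grad (point_form m k) (x, y, z)"
      using l unfolding tangent_lines_def proj_zeros_def by (smt (verit) mem_Collect_eq prod_cases3)
    have "hesse_dual m (x - \<i> * y) (x + \<i> * y) z = 0"
      using zero k by (simp add: point_form_def)
    then show ?thesis
      by (simp add: l grad_point_form Let_def hesse_scale hesse_gradient_hesse_dual)
  qed
  then show "q \<in> proj_zeros (line_form m)"
    using q form_line_form unfolding dual_curve_def zariski_closure_def proj_zeros_def by blast
next
  fix q assume q: "q \<in> proj_zeros (line_form m)"
  obtain A B C where q_eq: "q = line_of A B C" by (rule line_of_cases)
  have hesse: "hesse m A B C = 0" and nz: "(A, B, C) \<noteq> 0"
    using q by (auto simp: q_eq proj_zeros_def line_of_eq_0_iff)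
  have "\<Phi> q = 0" if \<Phi>: "form d \<Phi>" and van: "\<And>l. l \<in> tangent_lines (point_form m k) \<Longrightarrow> \<Phi> l = 0" for d \<Phi>
  proof -
    have non_flex: "\<Phi> (line_of A B C) = 0" if h: "hesse m A B C = 0" and ABC: "A * B * C \<noteq> 0" for A B C
    proof -
      \<comment> \<open>The point of the sextic dual to (A, B, C); x and y invert X = x - i y and Y
        = x + i y.\<close>
      define X Y z where "X = A^2 + 2 * m * B * C" and "Y = B^2 + 2 * m * C * A" and "z = C^2 + 2 * m * A * B"
      define x y where "x = (X + Y) / 2" and "y = \<i> * (X - Y) / 2"
      define c where "c = k * (12 * (1 + 8 * m^3)^3 * (A * B * C)^3)"
      have c: "c \<noteq> 0" using ABC m k by (simp add: c_def)
      have X: "x - \<i> * y = X" and Y: "x + \<i> * y = Y"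
        by (simp_all add: x_def y_def field_simps flip: mult.assoc)
      have rot: "hesse m B C A = 0" "hesse m C A B = 0" "B * C * A = A * B * C" "C * A * B = A * B * C"
        using h by (simp_all add: hesse_def ac_simps)
      have grads: "hesse_dual_partial m X Y z = 12 * (1 + 8 * m^3)^3 * (A * B * C)^3 * A"
        "hesse_dual_partial m Y z X = 12 * (1 + 8 * m^3)^3 * (A * B * C)^3 * B"
        "hesse_dual_partial m z X Y = 12 * (1 + 8 * m^3)^3 * (A * B * C)^3 * C"
        using hesse_dual_partial_gradient[of m A B C, unfolded h mult_zero_left add_0_right]
          hesse_dual_partial_gradient[of m B C A, unfolded rot mult_zero_left add_0_right]
          hesse_dual_partial_gradient[of m C A B, unfolded rot mult_zero_left add_0_right]
        by (simp_all only: X_def Y_def z_def)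
      have gr: "grad (point_form m k) (x, y, z) = line_of (c * A) (c * B) (c * C)"
        unfolding grad_point_form Let_def X Y grads c_def by (simp add: mult_ac)
      have gr_nz: "line_of (c * A) (c * B) (c * C) \<noteq> 0"
        using c ABC unfolding line_of_eq_0_iff by (simp add: zero_prod_def)
      have "point_form m k (x, y, z) = 0"
        using hesse_dual_gradient[of m A B C, unfolded h mult_zero_left]
        by (simp only: point_form_def X Y prod.case X_def Y_def z_def mult_zero_right)
      moreover have "(x, y, z) \<noteq> 0"
      proof
        assume "(x, y, z) = 0"
        then have "X = 0" "Y = 0" "z = 0" using X Y by (auto simp: zero_prod_def)
        then show False using grads(1) ABC m by (simp add: hesse_dual_partial_def)
      qed
      ultimately have "line_of (c * A) (c * B) (c * C) \<in> tangent_lines (point_form m k)"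
        using gr gr_nz by (force simp: tangent_lines_def proj_zeros_def)
      then have "\<Phi> (line_of (c * A) (c * B) (c * C)) = 0" by (rule van)
      then have "c^d * \<Phi> (line_of A B C) = 0"
        using form_homogeneous[OF \<Phi>, of c "A + B" "\<i> * (B - A)" C] by (simp add: line_of_def algebra_simps)
      then show ?thesis using c by simp
    qed
    have cont: "isCont (\<lambda>(A, B, C). \<Phi> (line_of A B C)) (A, B, C)"
    proof -
      have "continuous_on UNIV (\<lambda>p. \<Phi> (line_of (fst p) (fst (snd p)) (snd (snd p))))"
        unfolding line_of_def
        by (rule continuous_on_compose2[OF form_continuous[OF \<Phi>]]) (auto intro!: continuous_intros)
      then show ?thesis by (simp add: continuous_on_eq_continuous_at case_prod_unfold)
    qed
    have "\<Phi> (line_of A B C) = 0"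
    proof (rule ccontr)
      assume "\<Phi> (line_of A B C) \<noteq> 0"
      then obtain e where e: "e > 0" and
        nb: "\<And>p. dist p (A, B, C) < e \<Longrightarrow> (\<lambda>(A, B, C). \<Phi> (line_of A B C)) p \<noteq> 0"
        using continuous_at_avoid[OF cont, of 0] by (auto simp: dist_commute)
      obtain A' B' C' where h': "hesse m A' B' C' = 0" "A' * B' * C' \<noteq> 0"
        and close: "cmod (A' - A) < e/3" "cmod (B' - B) < e/3" "cmod (C' - C) < e/3"
        using hesse_approx[OF hesse nz, of "e/3"] e by auto
      have "dist (A', B', C') (A, B, C) \<le> dist A' A + (dist B' B + dist C' C)"
        unfolding dist_Pair_Pair
        by (intro order_trans[OF sqrt_sum_squares_le_sum] add_left_mono) auto
      also have "\<dots> < e" using close by (simp add: dist_norm)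
      finally show False using nb non_flex[OF h'] by fastforce
    qed
    then show ?thesis by (simp add: q_eq)
  qed
  then show "q \<in> dual_curve (point_form m k)"
    using q unfolding dual_curve_def zariski_closure_def proj_zeros_def by blast
qed

lemma cube_roots_of_unity:
  "z^3 = 1 \<longleftrightarrow> z \<in> {1, exp (2 * of_real pi * \<i> / 3), exp (4 * of_real pi * \<i> / 3)}"
proof -
  have "{z::complex. z^3 = 1} = {exp (2 * of_real pi * \<i> * of_nat j / of_nat 3) | j. j < 3}"
    by (rule complex_roots_unity) simp
  also have "\<dots> = (\<lambda>j. exp (2 * of_real pi * \<i> * of_nat j / of_nat 3)) ` {..<3}" by auto
  also have "{..<3} = {0, 1, 2::nat}" by auto
  finally show ?thesis by (auto simp: mult_ac)
qed

lemma line_of_eq_0: "line_of A B C = 0 \<longleftrightarrow> A = 0 \<and> B = 0 \<and> C = 0"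
  unfolding line_of_eq_0_iff by (simp add: zero_prod_def)

text \<open>A line with A = 0 lies on the cubic when B^3 + C^3 = 0, and passes through the real
  point when B \<zeta> + C z = 0; together \<zeta>^3 = z^3. The other circular point gives the
  conjugate condition, and z = 0 would force all coordinates to vanish.\<close>

lemma real_focus_point_form:
  assumes m: "1 + 8 * m^3 \<noteq> 0" and k: "k \<noteq> 0"
  shows "real_focus (point_form m k) x y z \<longleftrightarrow> z \<noteq> 0 \<and>
    Complex (x / z) (y / z) \<in> {1, exp (2 * of_real pi * \<i> / 3), exp (4 * of_real pi * \<i> / 3)}"
proof -
  define \<zeta> where "\<zeta> = Complex x y"
  have \<zeta>: "\<zeta> = of_real x + \<i> * of_real y" and cnj: "cnj \<zeta> = of_real x - \<i> * of_real y"
    by (auto simp: \<zeta>_def complex_eq_iff)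
  have inc_circ: "incident (line_of A B C) (1, \<i>, 0) \<longleftrightarrow> A = 0"
    "incident (line_of A B C) (1, - \<i>, 0) \<longleftrightarrow> B = 0" for A B C
  proof -
    have "\<i> * w * \<i> = - w" "\<i> * w * (- \<i>) = w" for w :: complex
      by (simp_all add: complex_eq_iff)
    note * = this
    show "incident (line_of A B C) (1, \<i>, 0) \<longleftrightarrow> A = 0"
      "incident (line_of A B C) (1, - \<i>, 0) \<longleftrightarrow> B = 0"
      unfolding incident_def line_of_def prod.case * by simp_all
  qed
  have inc: "incident (line_of A B C) (of_real x, of_real y, of_real z) \<longleftrightarrow>
      A * cnj \<zeta> + B * \<zeta> + C * of_real z = 0" for A B C
  proof -
    have "(A + B) * of_real x + \<i> * (B - A) * of_real y + C * of_real z
        = A * cnj \<zeta> + B * \<zeta> + C * of_real z"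
      unfolding cnj by (simp only: \<zeta>) algebra
    then show ?thesis by (simp add: incident_def line_of_def)
  qed
  have "real_focus (point_form m k) x y z \<longleftrightarrow> z \<noteq> 0 \<and> \<zeta>^3 = of_real z^3"
  proof
    assume foc: "real_focus (point_form m k) x y z"
    then obtain l where l: "l \<in> proj_zeros (line_form m)" "incident l (1, \<i>, 0)"
      "incident l (of_real x, of_real y, of_real z)"
      using dual_curve_point_form[OF m k] by (auto simp: real_focus_def)
    obtain A B C where eq: "l = line_of A B C" by (rule line_of_cases)
    have A: "A = 0" and BC: "B * \<zeta> + C * of_real z = 0" and h: "B^3 + C^3 = 0" and nz: "B \<noteq> 0"
      using l by (auto simp: eq inc inc_circ proj_zeros_def line_of_eq_0 hesse_def)
    have "B^3 * (\<zeta>^3 - of_real z^3) = 0" using BC h by algebra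
    then have cube: "\<zeta>^3 = of_real z^3" using nz by simp
    moreover have "z \<noteq> 0"
    proof
      assume "z = 0"
      then have "\<zeta> = 0" using cube by simp
      then have "x = 0" "y = 0" by (simp_all add: \<zeta>_def complex_eq_iff)
      then show False using foc \<open>z = 0\<close> by (simp add: real_focus_def zero_prod_def)
    qed
    ultimately show "z \<noteq> 0 \<and> \<zeta>^3 = of_real z^3" by simp
  next
    assume asm: "z \<noteq> 0 \<and> \<zeta>^3 = of_real z^3"
    then have "cnj \<zeta>^3 = of_real z^3" by (metis complex_cnj_complex_of_real complex_cnj_power)
    then have "line_of 0 (of_real z) (- \<zeta>) \<in> proj_zeros (line_form m)"
      "line_of (of_real z) 0 (- cnj \<zeta>) \<in> proj_zeros (line_form m)"
      using asm by (auto simp: proj_zeros_def line_of_eq_0 hesse_def)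
    moreover have "incident (line_of 0 (of_real z) (- \<zeta>)) (of_real x, of_real y, of_real z)"
      "incident (line_of (of_real z) 0 (- cnj \<zeta>)) (of_real x, of_real y, of_real z)"
      by (auto simp: inc)
    moreover have "incident (line_of 0 (of_real z) (- \<zeta>)) (1, \<i>, 0)"
      "incident (line_of (of_real z) 0 (- cnj \<zeta>)) (1, - \<i>, 0)"
      by (simp_all add: inc_circ)
    ultimately show "real_focus (point_form m k) x y z"
      using asm unfolding real_focus_def dual_curve_point_form[OF m k] by (auto simp: zero_prod_def)
  qed
  also have "\<dots> \<longleftrightarrow> z \<noteq> 0 \<and> Complex (x / z) (y / z) ^ 3 = 1"
  proof -
    have "Complex (x / z) (y / z) = \<zeta> / of_real z"
      by (auto simp: \<zeta>_def complex_eq_iff)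
    then show ?thesis by (auto simp: power_divide divide_eq_1_iff)
  qed
  finally show ?thesis by (simp only: cube_roots_of_unity)
qed

text \<open>The scalar factor is dictated by the constant term 27 / (256 l^3) of the sextic.\<close>

lemma point_form_eq_sextic:
  fixes l :: complex
  assumes "l \<noteq> 0"
  shows "point_form (- 2 * l / 3) (27 / (256 * l^3)) (x, y, 1) = sextic l x y"
proof -
  define m k where "m = - 2 * l / 3" and "k = 27 / (256 * l^3)"
  have coeffs: "27 / (64 * l^3) = 4 * k"
    "9 / (4 * l) = 48 * k * m^2" "27 / (16 * l^2) - l = - 24 * k * m - 48 * k * m^4"
    "9 / (8 * l) = 24 * k * m^2" "27 / (256 * l^3) = k"
    using assms by (simp_all add: m_def k_def field_simps power_numeral_reduce)
  have i: "\<i>^2 = -1" by simp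
  \<comment> \<open>Needed for the summands 1 and 2 in the coefficients of the sextic, which carry
    no power of l.\<close>
  have one: "- 32 * k * m^3 = 1" using assms by (simp add: m_def k_def field_simps)
  have "point_form m k (x, y, 1) = sextic l x y"
    unfolding sextic_def coeffs point_form_def hesse_dual_def prod.case power_one mult_1_right mult_1_left
    using i one by algebra
  then show ?thesis by (simp add: m_def k_def)
qed

lemma curve_properties:
  fixes L :: real
  assumes L: "L > 3/4"
  obtains F where "homogenization 6 (sextic (of_real L)) F" "curve_of_degree 6 (proj_zeros F)"
    "curve_of_class 3 F"
    "\<And>x y z. real_focus F x y z \<longleftrightarrow> z \<noteq> 0 \<and>
      Complex (x / z) (y / z) \<in> {1, exp (2 * of_real pi * \<i> / 3), exp (4 * of_real pi * \<i> / 3)}"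
proof -
  define l :: complex where "l = of_real L"
  define m k where "m = - 2 * l / 3" and "k = 27 / (256 * l^3)"
  have l: "l \<noteq> 0" using L by (simp add: l_def)
  have m0: "m \<noteq> 0" and k0: "k \<noteq> 0" using l by (simp_all add: m_def k_def)
  \<comment> \<open>Among real L, the value 3/4 is the only one with 1 + 8 m^3 = 0, where the Hesse
    cubic becomes singular.\<close>
  have "(3/4)^3 < L^3" using L by (intro power_strict_mono) auto
  then have "1 + 8 * (- 2 * L / 3)^3 \<noteq> 0" by (simp add: power3_eq_cube)
  then have "of_real (1 + 8 * (- 2 * L / 3)^3) \<noteq> (0::complex)" by (subst of_real_eq_0_iff)
  then have m: "1 + 8 * m^3 \<noteq> 0" by (simp add: m_def l_def)
  have "point_form m k (1, 0, 0) = - 32 * k * m^3" by (simp add: point_form_def hesse_dual_def algebra_simps)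
  then have "point_form m k (1, 0, 0) \<noteq> 0" using m0 k0 by simp
  then have "homogenization 6 (sextic l) (point_form m k)"
    using form_point_form point_form_eq_sextic[OF l] unfolding homogenization_def m_def k_def by blast
  moreover have "curve_of_degree 6 (proj_zeros (point_form m k))"
    using reduced_point_form[OF m0 m k0] by (auto simp: curve_of_degree_def)
  moreover have "curve_of_class 3 (point_form m k)"
    unfolding curve_of_class_def curve_of_degree_def dual_curve_point_form[OF m k0]
    using reduced_point_form[OF m0 m k0] reduced_line_form by blast
  ultimately show ?thesis
    using that real_focus_point_form[OF m k0] unfolding l_def by blast
qed

section \<open>The support function of the sextic\<close>

text \<open>The local minimum at sqrt (L / 3) has the value - (8/3) L sqrt (L / 3), which for L > 0
  is below -1 exactly when L > 3/4. So every level in [-1, 1] is crossed to the right of it.\<close>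

lemma top_root_exists:
  fixes L c :: real
  assumes L: "3/4 < L" and c: "\<bar>c\<bar> \<le> 1"
  obtains t where "0 < t" "L < 3 * t^2" "4 * t^3 - 4 * L * t = c"
proof -
  define r where "r = sqrt (L / 3)"
  have r2: "r^2 = L / 3" using L by (simp add: r_def)
  have r: "1/2 < r" unfolding r_def
    by (rule real_less_rsqrt) (use L in \<open>simp add: power2_eq_square\<close>)
  define f where "f = (\<lambda>t. 4 * t^3 - 4 * L * t)"
  have fr: "f r < -1"
  proof -
    have "f r = - (8/3) * (L * r)" using r2 by (simp add: f_def power3_eq_cube power2_eq_square algebra_simps)
    moreover have "(3/4) * (1/2) < L * r" using L r by (intro mult_strict_mono) auto
    ultimately show ?thesis by simp
  qed
  have rL: "r \<le> L + 1"
  proof (rule power2_le_imp_le)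
    show "r^2 \<le> (L + 1)^2"
      unfolding r2 using L zero_le_square[of L] by (simp add: power2_eq_square algebra_simps)
  qed (use L in auto)
  \<comment> \<open>L + 1 is merely a convenient right end point, where the cubic is already at
    least 1.\<close>
  have f1: "1 \<le> f (L + 1)"
  proof -
    have "f (L + 1) = 4 * (L + 1) * (L * (L + 1) + 1)" by (simp add: f_def power3_eq_cube algebra_simps)
    moreover have "1 * 1 \<le> (4 * (L + 1)) * (L * (L + 1) + 1)" using L by (intro mult_mono) auto
    ultimately show ?thesis by simp
  qed
  have "\<exists>t\<ge>r. t \<le> L + 1 \<and> f t = c"
    using fr f1 c rL by (intro IVT') (auto simp: f_def intro!: continuous_intros)
  then obtain t where t: "r \<le> t" "f t = c" by blast
  moreover have "t \<noteq> r" using fr t c by auto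
  ultimately have "r < t" by simp
  then have "r^2 < t^2" using r by (intro power_strict_mono) auto
  then show ?thesis using that[of t] t r r2 by (auto simp: f_def)
qed

lemma cubic_strict_mono:
  fixes L s t :: real
  assumes "t < s" "0 < t" "L < 3 * t^2"
  shows "4 * t^3 - 4 * L * t < 4 * s^3 - 4 * L * s"
proof -
  have "t * t < s * t" "s * t < s * s" using assms by (auto intro: mult_strict_right_mono)
  then have "0 < s^2 + s * t + t^2 - L" using assms(3) unfolding power2_eq_square by linarith
  then have "0 < 4 * (s - t) * (s^2 + s * t + t^2 - L)" using assms by simp
  also have "\<dots> = 4 * s^3 - 4 * L * s - (4 * t^3 - 4 * L * t)" by algebra
  finally show ?thesis by simp
qed

lemma of_real_sextic: "complex_of_real (sextic L x y) = sextic (of_real L) (of_real x) (of_real y)"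
  by (simp add: sextic_def)

lemma sextic_eq_0_iff_hesse_dual:
  fixes L :: real
  assumes "L \<noteq> 0"
  shows "sextic L (Re p) (Im p) = 0 \<longleftrightarrow> hesse_dual (of_real (- 2 * L / 3)) (cnj p) p 1 = 0"
proof -
  have p: "of_real (Re p) - \<i> * of_real (Im p) = cnj p" "of_real (Re p) + \<i> * of_real (Im p) = p"
    by (simp_all add: complex_eq_iff)
  have "sextic L (Re p) (Im p) = 0 \<longleftrightarrow> complex_of_real (sextic L (Re p) (Im p)) = 0"
    by (simp only: of_real_eq_0_iff)
  also have "\<dots> \<longleftrightarrow> 27 / (256 * complex_of_real L^3)
      * hesse_dual (- 2 * of_real L / 3) (cnj p) p 1 = 0"
    using assms point_form_eq_sextic[of "of_real L" "of_real (Re p)" "of_real (Im p)"]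
    unfolding point_form_def prod.case p by (simp only: of_real_sextic of_real_eq_0_iff not_False_eq_True)
  also have "\<dots> \<longleftrightarrow> hesse_dual (- 2 * of_real L / 3) (cnj p) p 1 = 0" using assms by simp
  finally show ?thesis by simp
qed

lemma hesse_dual_scale: "hesse_dual m (k * X) (k * Y) (k * Z) = k^6 * hesse_dual m X Y Z"
  unfolding hesse_dual_def by algebra

lemma unit_cube_Re: 
  assumes "cmod z = 1"
  shows "z * cnj z = 1" "z^3 + cnj z^3 = 2 * of_real (Re (z^3))"
proof -
  show "z * cnj z = 1" using assms by (simp add: complex_norm_square[symmetric])
  show "z^3 + cnj z^3 = 2 * of_real (Re (z^3))"
    using complex_add_cnj[of "z^3"] by simp
qed

text \<open>The line Re (cnj z p) = t has A = z / 2, B = cnj z / 2, C = - t, and the cubic equation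
  for t says that it lies on the dual curve. Its point of contact is read off the gradient.\<close>

lemma sextic_support_point:
  assumes L: "3/4 < L" and z: "cmod z = 1" and t: "L < 3 * t^2" "4 * t^3 - 4 * L * t = Re (z^3)"
  obtains p where "sextic L (Re p) (Im p) = 0" "Re (cnj z * p) = t"
proof -
  define m A B C where "m = complex_of_real (- 2 * L / 3)" and "A = z / 2" and "B = cnj z / 2"
    and "C = - complex_of_real t"
  \<comment> \<open>The third component of the gradient. It is positive because t lies beyond the
    critical point, so the point of contact is finite.\<close>
  define d where "d = t^2 - L / 3"
  have d: "d \<noteq> 0" using t by (simp add: d_def)
  define p where "p = (cnj z^2 / 4 + of_real (2 * L * t / 3) * z) / of_real d"
  note zz = unit_cube_Re[OF z]
  have Z: "C^2 + 2 * m * A * B = of_real d"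
    using zz(1) by (simp add: A_def B_def C_def m_def d_def mult.assoc)
  have Y: "B^2 + 2 * m * C * A = of_real d * p"
    using d by (simp add: A_def B_def C_def m_def p_def power_divide)
  have X: "A^2 + 2 * m * B * C = of_real d * cnj p"
    using d by (simp add: A_def B_def C_def m_def p_def power_divide)
  have "hesse m A B C = (z^3 + cnj z^3) / 8 - of_real t^3 + of_real (L * t) * (z * cnj z)"
    by (simp add: hesse_def A_def B_def C_def m_def power_divide add_divide_distrib)
  also have "\<dots> = of_real ((Re (z^3) - (4 * t^3 - 4 * L * t)) / 4)"
    unfolding zz by (simp add: field_simps)
  finally have h: "hesse m A B C = 0" using t by simp
  have "of_real d^6 * hesse_dual m (cnj p) p 1 = 0"
    using hesse_dual_gradient[of m A B C] unfolding h mult_zero_left X Y Z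
    using hesse_dual_scale[of m "of_real d" "cnj p" p 1] by simp
  then have "hesse_dual m (cnj p) p 1 = 0" using d by simp
  then have "sextic L (Re p) (Im p) = 0" 
    using sextic_eq_0_iff_hesse_dual[of L p] L by (simp add: m_def)
  moreover have "Re (cnj z * p) = t"
  proof -
    have "cnj z * p = (cnj (z^3) / 4 + of_real (2 * L * t / 3) * (z * cnj z)) / of_real d"
      by (simp add: p_def power2_eq_square power3_eq_cube algebra_simps)
    then have "Re (cnj z * p) = (Re (z^3) / 4 + 2 * L * t / 3) / d"
      unfolding zz by (simp add: Re_divide_of_real flip: complex_cnj_power)
    also have "Re (z^3) / 4 + 2 * L * t / 3 = t * d"
      using t(2) by (simp add: d_def power3_eq_cube power2_eq_square field_simps)
    finally show ?thesis using d by simp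
  qed
  ultimately show ?thesis by (rule that)
qed

text \<open>Vieta expresses q, r, s through p, and the discriminant becomes p^4 times the squared
  product of differences. So p = 0, and three zeros then leave only the zero polynomial.\<close>

lemma cubic_discriminant_nonzero:
  fixes p q r s :: "'a::field"
  assumes "x \<noteq> y" "x \<noteq> z" "y \<noteq> z"
    and zero: "p * x^3 + q * x^2 + r * x + s = 0" "p * y^3 + q * y^2 + r * y + s = 0"
      "p * z^3 + q * z^2 + r * z + s = 0"
    and disc: "q^2 * r^2 - 4 * p * r^3 - 4 * q^3 * s - 27 * p^2 * s^2 + 18 * p * q * r * s = 0"
  shows "p = 0 \<and> q = 0 \<and> r = 0 \<and> s = 0"
proof -
  have "(x - y) * (p * (x^2 + x * y + y^2) + q * (x + y) + r) = 0" using zero by algebra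
  then have xy: "p * (x^2 + x * y + y^2) + q * (x + y) + r = 0" using assms by simp
  have "(x - z) * (p * (x^2 + x * z + z^2) + q * (x + z) + r) = 0" using zero by algebra
  then have xz: "p * (x^2 + x * z + z^2) + q * (x + z) + r = 0" using assms by simp
  have "(y - z) * (p * (x + y + z) + q) = 0" using xy xz by algebra
  then have "p * (x + y + z) + q = 0" using assms by simp
  then have q: "q = - p * (x + y + z)" by algebra
  have r: "r = p * (x * y + x * z + y * z)" using xy q by algebra
  have s: "s = - p * (x * y * z)" using zero(1) q r by algebra
  have "p^4 * ((x - y) * (x - z) * (y - z))^2 = 0"
    using disc unfolding q r s by algebra
  then have "p = 0" using assms by simp
  then show ?thesis using q r s by simp
qed

text \<open>Through a point beyond the support line pass three distinct real tangents, whereas for a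
  point on the curve two of them coincide. The tangents are found as sign changes while the normal
  direction makes a half turn.\<close>

lemma sextic_point_in_halfplane:
  assumes L: "3/4 < L" and z: "cmod z = 1" and t: "0 < t" "L < 3 * t^2" "4 * t^3 - 4 * L * t = Re (z^3)"
    and p: "sextic L (Re p) (Im p) = 0"
  shows "Re (cnj z * p) \<le> t"
proof (rule ccontr)
  assume "\<not> ?thesis"
  then have gt: "t < Re (cnj z * p)" by simp
  define w where "w = (\<lambda>\<psi>. z * cis \<psi>)"
  define s where "s = (\<lambda>\<psi>. Re (cnj (w \<psi>) * p))"
  \<comment> \<open>h vanishes where the line through p with normal \<open>w \<psi>\<close> is a
    tangent.\<close>
  define h where "h = (\<lambda>\<psi>. 4 * s \<psi>^3 - 4 * L * s \<psi> - Re (w \<psi>^3))"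
  have cont_s: "continuous_on S s" and cont_h: "continuous_on S h" for S
    unfolding h_def s_def w_def by (intro continuous_intros)+
  have w1: "cmod (w \<psi>) = 1" for \<psi> using z by (simp add: w_def norm_mult)
  then have wnz: "w \<psi> \<noteq> 0" for \<psi> by (metis norm_zero zero_neq_one)
  have w_pi: "w pi = - z" and w_0: "w 0 = z" by (simp_all add: w_def)
  define r where "r = sqrt (L / 3)"
  have r2: "r^2 = L / 3" using L by (simp add: r_def)
  have r: "1/2 < r" unfolding r_def
    by (rule real_less_rsqrt) (use L in \<open>simp add: power2_eq_square\<close>)
  have crit: "4 * r^3 - 4 * L * r < -1"
  proof -
    have "4 * r^3 - 4 * L * r = - (8/3) * (L * r)" using r2 by (simp add: power3_eq_cube power2_eq_square algebra_simps)
    moreover have "(3/4) * (1/2) < L * r" using L r by (intro mult_strict_mono) auto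
    ultimately show ?thesis by simp
  qed
  have Re_le: "\<bar>Re (w \<psi>^3)\<bar> \<le> 1" for \<psi>
    using abs_Re_le_cmod[of "w \<psi>^3"] by (simp add: norm_power w1)
  have r_t: "r < t"
    using t r2 by (intro power2_less_imp_less[of r t]) auto
  have h0: "0 < h 0"
    using cubic_strict_mono[OF gt t(1,2)] t(3) by (simp add: h_def s_def w_0)
  have "s pi = - s 0" by (simp add: s_def w_0 w_pi)
  moreover have "(- z)^3 = - (z^3)" "(- s 0)^3 = - (s 0^3)" by (simp_all add: power3_eq_cube)
  ultimately have "h pi = - h 0" by (simp add: h_def w_0 w_pi)
  then have hpi: "h pi < 0" using h0 by simp
  have s0: "r < s 0" and spi: "s pi < - r" using gt r_t by (simp_all add: s_def w_0 w_pi)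
  \<comment> \<open>At the critical values s = r and s = - r the cubic is below -1 and above 1, so h
    has the signs +, -, +, - at 0, \<open>\<psi>1\<close>, \<open>\<psi>2\<close>, pi.\<close>
  obtain \<psi>1 where \<psi>1: "0 \<le> \<psi>1" "\<psi>1 \<le> pi" "s \<psi>1 = r"
    using IVT2'[of s pi r 0] s0 spi r cont_s by auto
  obtain \<psi>2 where \<psi>2: "\<psi>1 \<le> \<psi>2" "\<psi>2 \<le> pi" "s \<psi>2 = - r"
    using IVT2'[of s pi "- r" \<psi>1] \<psi>1 spi r cont_s by auto
  have h1: "h \<psi>1 < 0" using \<psi>1 crit Re_le[of \<psi>1] by (simp add: h_def)
  have h2: "0 < h \<psi>2" using \<psi>2 crit Re_le[of \<psi>2] by (simp add: h_def)
  obtain \<eta>1 where \<eta>1: "0 \<le> \<eta>1" "\<eta>1 \<le> \<psi>1" "h \<eta>1 = 0"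
    using IVT2'[of h \<psi>1 0 0] h0 h1 \<psi>1 cont_h by auto
  obtain \<eta>2 where \<eta>2: "\<psi>1 \<le> \<eta>2" "\<eta>2 \<le> \<psi>2" "h \<eta>2 = 0"
    using IVT'[of h \<psi>1 0 \<psi>2] h1 h2 \<psi>2 cont_h by auto
  obtain \<eta>3 where \<eta>3: "\<psi>2 \<le> \<eta>3" "\<eta>3 \<le> pi" "h \<eta>3 = 0"
    using IVT2'[of h pi 0 \<psi>2] h2 hpi \<psi>2 cont_h by auto
  have less: "\<eta>1 < \<eta>2" "\<eta>2 < \<eta>3" "0 \<le> \<eta>1" "\<eta>3 < pi"
  proof -
    have "\<eta>1 \<noteq> \<psi>1" "\<eta>2 \<noteq> \<psi>2" "\<eta>3 \<noteq> pi" using \<eta>1(3) \<eta>2(3) \<eta>3(3) h1 h2 hpi by auto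
    then show "\<eta>1 < \<eta>2" "\<eta>2 < \<eta>3" "0 \<le> \<eta>1" "\<eta>3 < pi" using \<eta>1 \<eta>2 \<eta>3 by auto
  qed
  \<comment> \<open>The unoriented line depends on w only through w^2, and these squares are
    distinct for angles in [0, pi).\<close>
  have neq: "(w \<eta>)^2 \<noteq> (w \<eta>')^2" if "\<eta> < \<eta>'" "0 \<le> \<eta>" "\<eta>' < pi" for \<eta> \<eta>'
  proof
    assume "(w \<eta>)^2 = (w \<eta>')^2"
    moreover have "z \<noteq> 0" using z by auto
    ultimately have "cis (2 * \<eta>) = cis (2 * \<eta>')" by (simp add: w_def power_mult_distrib Complex.DeMoivre)
    then show False
      using that exp_complex_eqI[of "\<i> * of_real (2 * \<eta>)" "\<i> * of_real (2 * \<eta>')"]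
      by (simp add: cis_conv_exp)
  qed
  define m where "m = complex_of_real (- 2 * L / 3)"
  define a b c d where "a = 1 - cnj p^3" and "b = - 3 * cnj p^2 * p - 6 * m * cnj p"
    and "c = - 3 * cnj p * p^2 - 6 * m * p" and "d = 1 - p^3"
  \<comment> \<open>The left side is eight times the Hesse cubic at A = w / 2, B = cnj w / 2, C = -
    s, arranged as a polynomial in w^2.\<close>
  have eval: "cnj (w \<psi>)^3 * (a * (w \<psi>^2)^3 + b * (w \<psi>^2)^2 + c * w \<psi>^2 + d) = of_real (- 2 * h \<psi>)" for \<psi>
  proof -
    note ww = unit_cube_Re[OF w1[of \<psi>]]
    have s2: "w \<psi> * cnj p + cnj (w \<psi>) * p = 2 * of_real (s \<psi>)"
      using complex_add_cnj[of "cnj (w \<psi>) * p"] by (simp add: s_def add.commute)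
    have h2: "of_real (- 2 * h \<psi>) = - 8 * of_real (s \<psi>)^3 + 8 * of_real L * of_real (s \<psi>)
        + 2 * complex_of_real (Re (w \<psi>^3))"
      by (simp add: h_def)
    have mL: "3 * m = - 2 * of_real L" by (simp add: m_def)
    show ?thesis
      unfolding h2 a_def b_def c_def d_def using ww s2 mL by algebra
  qed
  have "a = 0 \<and> b = 0 \<and> c = 0 \<and> d = 0"
  proof (rule cubic_discriminant_nonzero)
    show "w \<eta>1^2 \<noteq> w \<eta>2^2" "w \<eta>1^2 \<noteq> w \<eta>3^2" "w \<eta>2^2 \<noteq> w \<eta>3^2"
      using less neq[of \<eta>1 \<eta>2] neq[of \<eta>1 \<eta>3] neq[of \<eta>2 \<eta>3] by auto
    show "a * (w \<eta>1^2)^3 + b * (w \<eta>1^2)^2 + c * w \<eta>1^2 + d = 0" using eval[of \<eta>1] \<eta>1 wnz[of \<eta>1] by simp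
    show "a * (w \<eta>2^2)^3 + b * (w \<eta>2^2)^2 + c * w \<eta>2^2 + d = 0" using eval[of \<eta>2] \<eta>2 wnz[of \<eta>2] by simp
    show "a * (w \<eta>3^2)^3 + b * (w \<eta>3^2)^2 + c * w \<eta>3^2 + d = 0" using eval[of \<eta>3] \<eta>3 wnz[of \<eta>3] by simp
    show "b^2 * c^2 - 4 * a * c^3 - 4 * b^3 * d - 27 * a^2 * d^2 + 18 * a * b * c * d = 0"
      using sextic_eq_0_iff_hesse_dual[of L p] p L
      unfolding a_def b_def c_def d_def m_def hesse_line_discriminant by simp
  qed
  then have "h 0 = 0" using eval[of 0] z by (auto simp: w_0)
  then show False using h0 by simp
qed

text \<open>Both sets have the support function \<tau>, which Z attains and W does not. Strictness
  keeps W off the supporting hyperplanes of the hull; an interior point outside W could be separated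
  from W and still be pushed further in the separating direction.\<close>

lemma interior_convex_hull_eqI:
  fixes Z W :: "'a::euclidean_space set" and \<tau> :: "'a \<Rightarrow> real"
  assumes upper: "\<And>z p. norm z = 1 \<Longrightarrow> p \<in> Z \<Longrightarrow> z \<bullet> p \<le> \<tau> z"
    and attained: "\<And>z. norm z = 1 \<Longrightarrow> \<exists>p\<in>Z. z \<bullet> p = \<tau> z"
    and pos: "\<And>z. norm z = 1 \<Longrightarrow> 0 < \<tau> z"
    and below: "\<And>z w. norm z = 1 \<Longrightarrow> w \<in> W \<Longrightarrow> z \<bullet> w < \<tau> z"
    and close: "\<And>z s. norm z = 1 \<Longrightarrow> s < \<tau> z \<Longrightarrow> \<exists>w\<in>W. s < z \<bullet> w"
    and convex: "convex W" and W_nonempty: "W \<noteq> {}"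
  shows "W = interior (convex hull Z)"
proof -
  let ?H = "convex hull Z"
  have upper_hull: "z \<bullet> p \<le> \<tau> z" if "norm z = 1" "p \<in> ?H" for z p
  proof -
    have "?H \<subseteq> {p. z \<bullet> p \<le> \<tau> z}"
      using upper[OF that(1)] by (intro hull_minimal) (auto simp: convex_halfspace_le)
    then show ?thesis using that(2) by blast
  qed
  have unit: "norm (inverse (norm b) *\<^sub>R b) = 1" if "b \<noteq> 0" for b :: 'a using that by simp
  have int_nonempty: "interior ?H \<noteq> {}"
  proof
    assume "interior ?H = {}"
    then obtain a b where a: "a \<noteq> 0" "?H \<subseteq> {x. a \<bullet> x = b}"
      using empty_interior_subset_hyperplane[OF convex_convex_hull] by metis
    define z where "z = inverse (norm a) *\<^sub>R a"
    have z: "norm z = 1" "norm (- z) = 1" using unit[OF a(1)] by (simp_all add: z_def)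
    obtain p q where "p \<in> Z" "z \<bullet> p = \<tau> z" "q \<in> Z" "- z \<bullet> q = \<tau> (- z)"
      using attained[OF z(1)] attained[OF z(2)] by blast
    \<comment> \<open>On a set contained in a hyperplane the maxima in the directions z and - z
      would be opposite numbers, but both are positive.\<close>
    moreover from this have "a \<bullet> p = b" "a \<bullet> q = b" using a(2) hull_subset[of Z convex] by blast+
    then have "z \<bullet> p = z \<bullet> q" by (simp add: z_def)
    ultimately show False using pos[OF z(1)] pos[OF z(2)] by simp
  qed
  show ?thesis
  proof (intro equalityI subsetI)
    fix w assume w: "w \<in> W"
    show "w \<in> interior ?H"
    proof (rule ccontr)
      assume "w \<notin> interior ?H"
      then obtain a b where a: "a \<noteq> 0" "\<forall>x\<in>interior ?H. a \<bullet> x \<le> b" "b \<le> a \<bullet> w"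
        using separating_hyperplane_sets[of "interior ?H" "{w}"] int_nonempty
        by (auto simp: convex_convex_hull convex_interior)
      have "closure (interior ?H) \<subseteq> {x. a \<bullet> x \<le> b}"
        using a by (intro closure_minimal closed_halfspace_le) auto
      then have H: "?H \<subseteq> {x. a \<bullet> x \<le> b}"
        using convex_closure_interior[OF convex_convex_hull int_nonempty] closure_subset[of ?H] by auto
      define z where "z = inverse (norm a) *\<^sub>R a"
      have z: "norm z = 1" using unit[OF a(1)] by (simp add: z_def)
      obtain p where p: "p \<in> Z" "z \<bullet> p = \<tau> z" using attained[OF z] by blast
      then have "a \<bullet> p \<le> a \<bullet> w" using H hull_subset[of Z convex] a(3) by fastforce
      then have "z \<bullet> p \<le> z \<bullet> w" by (simp add: z_def mult_left_mono)
      then show False using below[OF z w] p by simp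
    qed
  next
    fix p assume p: "p \<in> interior ?H"
    show "p \<in> W"
    proof (rule ccontr)
      assume "p \<notin> W"
      then obtain a b where a: "a \<noteq> 0" "\<forall>x\<in>W. a \<bullet> x \<le> b" "b \<le> a \<bullet> p"
        using separating_hyperplane_sets[of W "{p}"] convex W_nonempty by auto
      define z where "z = inverse (norm a) *\<^sub>R a"
      have z: "norm z = 1" using unit[OF a(1)] by (simp add: z_def)
      have le: "z \<bullet> w \<le> z \<bullet> p" if "w \<in> W" for w
        using a that by (force simp: z_def intro!: mult_left_mono)
      \<comment> \<open>The ball leaves room e in the direction z, so z \<bullet> p is strictly
        below \<tau> z, a level that W exceeds.\<close>
      obtain e where e: "0 < e" "cball p e \<subseteq> ?H" using p mem_interior_cball by blast
      have "p + e *\<^sub>R z \<in> cball p e" using z e by (simp add: dist_norm)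
      then have "z \<bullet> (p + e *\<^sub>R z) \<le> \<tau> z" using upper_hull[OF z] e by blast
      moreover have "z \<bullet> (p + e *\<^sub>R z) = z \<bullet> p + e"
        using z by (simp add: inner_add_right power2_norm_eq_inner[symmetric])
      ultimately have "z \<bullet> p < \<tau> z" using e by simp
      then show False using close[OF z] le by (meson not_le)
    qed
  qed
qed

section \<open>The Hardy space\<close>

definition taylor_coeff :: "(complex \<Rightarrow> complex) \<Rightarrow> nat \<Rightarrow> complex" where
  "taylor_coeff f n = (deriv ^^ n) f 0 / fact n"

definition circle_inner :: "(complex \<Rightarrow> complex) \<Rightarrow> (complex \<Rightarrow> complex) \<Rightarrow> real \<Rightarrow> complex" where
  "circle_inner f g r =
     integral {0..2*pi} (\<lambda>t. f (of_real r * cis t) * cnj (g (of_real r * cis t))) / (2 * of_real pi)"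

lemma taylor_sums:
  assumes "f holomorphic_on ball 0 1" "cmod z < 1"
  shows "(\<lambda>n. taylor_coeff f n * z^n) sums f z"
  using holomorphic_power_series[OF assms(1), of z] assms(2) by (simp add: taylor_coeff_def)

lemma summable_taylor:
  assumes f: "f holomorphic_on ball 0 1" and r: "0 \<le> r" "r < 1"
  shows "summable (\<lambda>n. cmod (taylor_coeff f n) * r^n)"
proof -
  define s where "s = (r + 1) / 2"
  have s: "r < s" "0 < s" "s < 1" using r by (auto simp: s_def)
  have "summable (\<lambda>n. taylor_coeff f n * of_real s^n)"
    using taylor_sums[OF f, of "of_real s"] s by (auto simp: sums_iff)
  from powser_insidea[OF this, of "of_real r"] show ?thesis
    using r s by (simp add: norm_mult norm_power)
qed

text \<open>Cauchy's formula for the n-th derivative on the circle of radius r, with the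
  parametrisation written out.\<close>

lemma taylor_coeff_integral:
  assumes f: "f holomorphic_on ball 0 1" and r: "0 < r" "r < 1"
  shows "integral {0..2*pi} (\<lambda>t. f (of_real r * cis t) * cnj (cis t)^n) = 2 * of_real pi * taylor_coeff f n * of_real r^n"
proof -
  have sub: "cball 0 r \<subseteq> ball (0::complex) 1" using r by auto
  have "((\<lambda>u. f u / (u - 0) ^ (Suc n)) has_contour_integral ((2 * pi * \<i>) / (fact n) * (deriv ^^ n) f 0))
           (circlepath 0 r)"
    by (rule Cauchy_has_contour_integral_higher_derivative_circlepath)
      (use f sub r in \<open>auto intro!: holomorphic_on_imp_continuous_on elim: holomorphic_on_subset\<close>)
  then have "((\<lambda>t. f (of_real r * cis t) / (of_real r * cis t)^Suc n * of_real r * \<i> * cis t) has_integral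
      (2 * pi * \<i>) * taylor_coeff f n) {0..2*pi}"
    unfolding circlepath_def by (subst (asm) has_contour_integral_part_circlepath_iff) (auto simp: taylor_coeff_def)
  then have "((\<lambda>t. (- \<i> * of_real r^n) * (f (of_real r * cis t) / (of_real r * cis t)^Suc n * of_real r * \<i> * cis t))
     has_integral (- \<i> * of_real r^n) * ((2 * pi * \<i>) * taylor_coeff f n)) {0..2*pi}"
    by (rule has_integral_mult_right)
  also have "(\<lambda>t. (- \<i> * of_real r^n) * (f (of_real r * cis t) / (of_real r * cis t)^Suc n * of_real r * \<i> * cis t))
      = (\<lambda>t. f (of_real r * cis t) * cnj (cis t)^n)"
  proof
    fix t
    have "cis t^n * cnj (cis t)^n = 1"
      by (simp add: cis_cnj cis_mult flip: power_mult_distrib)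
    then show "(- \<i> * of_real r^n) * (f (of_real r * cis t) / (of_real r * cis t)^Suc n * of_real r * \<i> * cis t)
        = f (of_real r * cis t) * cnj (cis t)^n"
      using r by (simp add: field_simps)
  qed
  also have "(- \<i> * of_real r^n) * ((2 * pi * \<i>) * taylor_coeff f n) = 2 * of_real pi * taylor_coeff f n * of_real r^n"
    by (simp add: field_simps)
  finally show ?thesis by (rule integral_unique)
qed

text \<open>Parseval on a circle inside the disc: the Taylor series of f converges uniformly there
  and is integrated term by term against the conjugate of g.\<close>

lemma circle_inner_sums:
  assumes f: "f holomorphic_on ball 0 1" and g: "g holomorphic_on ball 0 1" and r: "0 < r" "r < 1"
  shows "(\<lambda>n. taylor_coeff f n * cnj (taylor_coeff g n) * of_real r^(2*n)) sums circle_inner f g r"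
proof -
  have circ: "of_real r * cis t \<in> ball 0 1" for t using r by (simp add: norm_mult)
  have cont_g: "continuous_on {0..2*pi} (\<lambda>t. g (of_real r * cis t))"
    using circ by (intro continuous_on_compose2[OF holomorphic_on_imp_continuous_on[OF g]])
      (auto intro!: continuous_intros)
  have bound_g: "bounded ((\<lambda>t. g (of_real r * cis t)) ` {0..2*pi})"
    using cont_g by (intro compact_imp_bounded compact_continuous_image) auto
  have "uniform_limit {0..2*pi} (\<lambda>N t. \<Sum>n<N. taylor_coeff f n * (of_real r * cis t)^n)
      (\<lambda>t. \<Sum>n. taylor_coeff f n * (of_real r * cis t)^n) sequentially"
    by (rule Weierstrass_m_test[OF _ summable_taylor[OF f, of r]])
      (use r in \<open>auto simp: norm_mult norm_power\<close>)
  also have "(\<lambda>t. \<Sum>n. taylor_coeff f n * (of_real r * cis t)^n) = (\<lambda>t. f (of_real r * cis t))"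
    using taylor_sums[OF f] circ by (simp add: sums_iff)
  finally have u: "uniform_limit {0..2*pi} (\<lambda>N t. \<Sum>n<N. taylor_coeff f n * (of_real r * cis t)^n)
      (\<lambda>t. f (of_real r * cis t)) sequentially" .
  have "bounded ((\<lambda>t. f (of_real r * cis t)) ` {0..2*pi})"
    using circ by (intro compact_imp_bounded compact_continuous_image
        continuous_on_compose2[OF holomorphic_on_imp_continuous_on[OF f]]) (auto intro!: continuous_intros)
  then have lim: "uniform_limit {0..2*pi}
      (\<lambda>N t. (\<Sum>n<N. taylor_coeff f n * (of_real r * cis t)^n) * cnj (g (of_real r * cis t)))
      (\<lambda>t. f (of_real r * cis t) * cnj (g (of_real r * cis t))) sequentially"
    using u bound_g
    by (intro uniform_lim_mult uniform_limit_const) (auto simp: bounded_iff)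
  have coeff_int: "((\<lambda>t. taylor_coeff f n * (of_real r * cis t)^n * cnj (g (of_real r * cis t))) has_integral
      2 * of_real pi * (taylor_coeff f n * cnj (taylor_coeff g n) * of_real r^(2*n))) {0..2*pi}" for n
  proof -
    have "(\<lambda>t. g (of_real r * cis t) * cnj (cis t)^n) integrable_on {0..2*pi}"
      using cont_g by (intro integrable_continuous_real continuous_intros)
    then have "((\<lambda>t. g (of_real r * cis t) * cnj (cis t)^n) has_integral
        2 * of_real pi * taylor_coeff g n * of_real r^n) {0..2*pi}"
      using taylor_coeff_integral[OF g r, of n] by (simp add: has_integral_integral)
    from has_integral_mult_right[OF has_integral_cnj[THEN iffD2, OF this], of "taylor_coeff f n * of_real r^n"]
    show ?thesis by (simp add: o_def power_mult_distrib mult_ac power_mult power2_eq_square)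
  qed
  obtain I J where I: "\<And>N. ((\<lambda>t. (\<Sum>n<N. taylor_coeff f n * (of_real r * cis t)^n) * cnj (g (of_real r * cis t)))
      has_integral I N) {0..2*pi}"
    and J: "((\<lambda>t. f (of_real r * cis t) * cnj (g (of_real r * cis t))) has_integral J) {0..2*pi}"
    and IJ: "I \<longlonglongrightarrow> J"
    by (rule uniform_limit_integral[OF lim]) (use cont_g in \<open>auto intro!: continuous_intros\<close>)
  have "I N = 2 * of_real pi * (\<Sum>n<N. taylor_coeff f n * cnj (taylor_coeff g n) * of_real r^(2*n))" for N
  proof (rule has_integral_unique[OF I])
    show "((\<lambda>t. (\<Sum>n<N. taylor_coeff f n * (of_real r * cis t)^n) * cnj (g (of_real r * cis t)))
      has_integral 2 * of_real pi * (\<Sum>n<N. taylor_coeff f n * cnj (taylor_coeff g n) * of_real r^(2*n))) {0..2*pi}"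
      unfolding sum_distrib_left sum_distrib_right by (intro has_integral_sum coeff_int) auto
  qed
  then have "(\<lambda>N. (\<Sum>n<N. taylor_coeff f n * cnj (taylor_coeff g n) * of_real r^(2*n))) \<longlonglongrightarrow> J / (2 * of_real pi)"
    using tendsto_divide[OF IJ tendsto_const[of "2 * of_real pi"]] by simp
  then show ?thesis
    using integral_unique[OF J] by (simp add: sums_def circle_inner_def)
qed

text \<open>The square of the Hardy norm on the coefficient side, where linearity, Cauchy-Schwarz
  and the limits in r become statements about series.\<close>

definition sq_norm :: "(complex \<Rightarrow> complex) \<Rightarrow> real" where
  "sq_norm f = (\<Sum>n. (cmod (taylor_coeff f n))^2)"

lemma continuous_on_suminf_dominated:
  fixes u :: "nat \<Rightarrow> 'a::topological_space \<Rightarrow> 'b::banach"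
  assumes "\<And>n. continuous_on A (u n)" and "\<And>n x. x \<in> A \<Longrightarrow> norm (u n x) \<le> M n" and "summable M"
  shows "continuous_on A (\<lambda>x. \<Sum>n. u n x)"
  by (rule uniform_limit_theorem[OF _ Weierstrass_m_test[OF assms(2,3)]])
    (auto intro!: always_eventually continuous_intros assms)

lemma circle_inner_0:
  shows "circle_inner f g 0 = f 0 * cnj (g 0)"
  by (simp add: circle_inner_def scaleR_conv_of_real)

lemma circle_inner_norm:
  "integral {0..2*pi} (\<lambda>t. (cmod (f (of_real r * cis t)))\<^sup>2) / (2*pi) = Re (circle_inner f f r)"
  if "f holomorphic_on ball 0 1" "0 \<le> r" "r < 1"
proof -
  have "continuous_on {0..2*pi} (\<lambda>t. f (of_real r * cis t))"
    using that by (intro continuous_on_compose2[OF holomorphic_on_imp_continuous_on[OF that(1)]])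
      (auto intro!: continuous_intros simp: norm_mult)
  then have "((\<lambda>t. of_real ((cmod (f (of_real r * cis t)))\<^sup>2)) has_integral
      complex_of_real (integral {0..2*pi} (\<lambda>t. (cmod (f (of_real r * cis t)))\<^sup>2))) {0..2*pi}"
    by (intro has_integral_of_real integrable_integral integrable_continuous_real continuous_intros)
  then have "circle_inner f f r = of_real (integral {0..2*pi} (\<lambda>t. (cmod (f (of_real r * cis t)))\<^sup>2) / (2*pi))"
    unfolding circle_inner_def complex_norm_square by (simp add: integral_unique)
  then show ?thesis by (metis Re_complex_of_real)
qed

lemma circle_norm_sums:
  assumes f: "f holomorphic_on ball 0 1" and r: "0 < r" "r < 1"
  shows "(\<lambda>n. (cmod (taylor_coeff f n))^2 * r^(2*n)) sums Re (circle_inner f f r)"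
  using sums_Re[OF circle_inner_sums[OF f f r]]
  by (simp flip: complex_norm_square of_real_power of_real_mult)

lemma hardy_space_holomorphic: "f \<in> hardy_space \<Longrightarrow> f holomorphic_on ball 0 1"
  by (simp add: hardy_space_def)

lemma hardy_spaceI:
  assumes f: "f holomorphic_on ball 0 1" and "\<And>r. 0 \<le> r \<Longrightarrow> r < 1 \<Longrightarrow> Re (circle_inner f f r) \<le> B"
  shows "f \<in> hardy_space"
  using assms by (auto simp: hardy_space_def circle_inner_norm intro!: bdd_aboveI[of _ B])

text \<open>Each partial sum is the limit, as r tends to 1, of partial sums bounded by the circle
  mean of radius r.\<close>

lemma circle_bound_imp_summable:
  assumes f: "f holomorphic_on ball 0 1" and B: "\<And>r. 0 < r \<Longrightarrow> r < 1 \<Longrightarrow> Re (circle_inner f f r) \<le> B"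
  shows "summable (\<lambda>n. (cmod (taylor_coeff f n))^2)" "sq_norm f \<le> B"
proof -
  have partial: "(\<Sum>n<N. (cmod (taylor_coeff f n))^2) \<le> B" for N
  proof -
    have "((\<lambda>r. \<Sum>n<N. (cmod (taylor_coeff f n))^2 * r^(2*n)) \<longlongrightarrow> (\<Sum>n<N. (cmod (taylor_coeff f n))^2 * 1^(2*n))) (at_left 1)"
      by (intro tendsto_intros)
    moreover have "\<forall>\<^sub>F r in at_left 1. (\<Sum>n<N. (cmod (taylor_coeff f n))^2 * r^(2*n)) \<le> B"
      using eventually_at_left_real[OF zero_less_one]
    proof eventually_elim
      case (elim r)
      then have sums: "(\<lambda>n. (cmod (taylor_coeff f n))^2 * r^(2*n)) sums Re (circle_inner f f r)"
        by (intro circle_norm_sums f) auto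
      then have "(\<Sum>n<N. (cmod (taylor_coeff f n))^2 * r^(2*n)) \<le> Re (circle_inner f f r)"
        using sum_le_suminf[OF sums_summable[OF sums], of "{..<N}"] sums_unique[OF sums] elim by auto
      then show ?case using B[of r] elim by auto
    qed
    ultimately show ?thesis by (intro tendsto_upperbound[where F = "at_left (1::real)"]) auto
  qed
  then show summable: "summable (\<lambda>n. (cmod (taylor_coeff f n))^2)"
    by (intro bounded_imp_summable[of _ B]) (auto simp: lessThan_Suc_atMost[symmetric] simp del: sum.lessThan_Suc)
  show "sq_norm f \<le> B"
    unfolding sq_norm_def by (rule suminf_le_const[OF summable partial])
qed

lemma summable_sq_taylor:
  assumes "f \<in> hardy_space"
  shows "summable (\<lambda>n. (cmod (taylor_coeff f n))^2)"
proof -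
  obtain B where "\<And>r. r \<in> {0..<1} \<Longrightarrow> integral {0..2*pi} (\<lambda>t. (cmod (f (of_real r * cis t)))\<^sup>2) / (2*pi) \<le> B"
    using assms unfolding hardy_space_def bdd_above_def by blast
  then show ?thesis
    using hardy_space_holomorphic[OF assms] by (intro circle_bound_imp_summable(1)[of f B]) (auto simp: circle_inner_norm)
qed

lemma circle_norm_le_sq_norm:
  assumes f: "f \<in> hardy_space" and r: "0 < r" "r < 1"
  shows "Re (circle_inner f f r) \<le> sq_norm f"
proof -
  note s = circle_norm_sums[OF hardy_space_holomorphic[OF f] r]
  have "(\<Sum>n. (cmod (taylor_coeff f n))^2 * r^(2*n)) \<le> (\<Sum>n. (cmod (taylor_coeff f n))^2)"
    using s summable_sq_taylor[OF f] r
    by (intro suminf_le) (auto simp: sums_iff power_le_one mult_left_le)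
  then show ?thesis using s by (simp add: sums_iff sq_norm_def)
qed

lemma hardy_spaceI_summable:
  assumes f: "f holomorphic_on ball 0 1" and s: "summable (\<lambda>n. (cmod (taylor_coeff f n))^2)"
  shows "f \<in> hardy_space"
proof (rule hardy_spaceI[OF f])
  fix r :: real assume r: "0 \<le> r" "r < 1"
  show "Re (circle_inner f f r) \<le> sq_norm f"
  proof (cases "r = 0")
    case True
    have "taylor_coeff f 0 = f 0" by (simp add: taylor_coeff_def)
    then have "Re (circle_inner f f 0) = (\<Sum>n<1. (cmod (taylor_coeff f n))^2)"
      by (simp add: circle_inner_0 complex_norm_square[symmetric] del: of_real_power)
    also have "\<dots> \<le> sq_norm f" unfolding sq_norm_def by (intro sum_le_suminf s) auto
    finally show ?thesis using True by simp
  next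
    case False
    have "(\<Sum>n. (cmod (taylor_coeff f n))^2 * r^(2*n)) \<le> (\<Sum>n. (cmod (taylor_coeff f n))^2)"
      using circle_norm_sums[OF f, of r] False s r
      by (intro suminf_le) (auto simp: sums_iff power_le_one mult_left_le)
    then show ?thesis using circle_norm_sums[OF f, of r] False r by (simp add: sums_iff sq_norm_def)
  qed
qed

lemma summable_taylor_mult:
  assumes f: "f \<in> hardy_space" and g: "g \<in> hardy_space"
  shows "summable (\<lambda>n. cmod (taylor_coeff f n) * cmod (taylor_coeff g n))"
proof (rule summable_comparison_test')
  show "summable (\<lambda>n. (cmod (taylor_coeff f n))^2 + (cmod (taylor_coeff g n))^2)"
    by (intro summable_add summable_sq_taylor f g)
  fix n
  show "norm (cmod (taylor_coeff f n) * cmod (taylor_coeff g n)) \<le> (cmod (taylor_coeff f n))^2 + (cmod (taylor_coeff g n))^2"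
  proof -
    have "0 \<le> cmod (taylor_coeff f n) * cmod (taylor_coeff g n)" by simp
    moreover have "2 * (cmod (taylor_coeff f n) * cmod (taylor_coeff g n))
        \<le> (cmod (taylor_coeff f n))^2 + (cmod (taylor_coeff g n))^2"
      using sum_squares_bound[of "cmod (taylor_coeff f n)" "cmod (taylor_coeff g n)"] by (simp only: mult.assoc)
    ultimately show ?thesis unfolding real_norm_def abs_of_nonneg by linarith
  qed
qed

text \<open>The series in r is dominated by the summable products of coefficients, hence continuous
  up to r = 1. This makes the \<open>Lim\<close> in the definition an actual limit.\<close>

lemma hardy_inner_eq_suminf:
  assumes f: "f \<in> hardy_space" and g: "g \<in> hardy_space"
  shows "(circle_inner f g \<longlongrightarrow> hardy_inner f g) (at_left 1)"
    and "hardy_inner f g = (\<Sum>n. taylor_coeff f n * cnj (taylor_coeff g n))"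
proof -
  define S where "S = (\<lambda>r::real. \<Sum>n. taylor_coeff f n * cnj (taylor_coeff g n) * of_real r^(2*n))"
  have "continuous_on {0..1} S"
    unfolding S_def
    by (rule continuous_on_suminf_dominated[OF _ _ summable_taylor_mult[OF f g]])
      (auto intro!: continuous_intros simp: norm_mult norm_power power_le_one mult_left_le)
  then have "(S \<longlongrightarrow> S 1) (at_left 1)"
    using at_within_Icc_at_left[of 0 "1::real"] by (auto simp: continuous_on_def dest: bspec[of _ _ 1])
  moreover have "\<forall>\<^sub>F r in at_left 1. S r = circle_inner f g r"
    using eventually_at_left_real[OF zero_less_one]
  proof eventually_elim
    case (elim r)
    then show ?case
      using circle_inner_sums[of f g r] f g by (simp add: hardy_space_holomorphic S_def sums_iff)
  qed
  ultimately have lim: "(circle_inner f g \<longlongrightarrow> S 1) (at_left 1)"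
    by (rule Lim_transform_eventually)
  then have "Lim (at_left 1) (circle_inner f g) = S 1"
    by (intro tendsto_Lim) auto
  then have "hardy_inner f g = S 1"
    by (simp add: hardy_inner_def circle_inner_def[abs_def])
  then show "(circle_inner f g \<longlongrightarrow> hardy_inner f g) (at_left 1)"
    "hardy_inner f g = (\<Sum>n. taylor_coeff f n * cnj (taylor_coeff g n))"
    using lim by (simp_all add: S_def)
qed

lemma hardy_inner_self:
  assumes f: "f \<in> hardy_space"
  shows "hardy_inner f f = of_real (sq_norm f)"
proof -
  have "(\<lambda>n. taylor_coeff f n * cnj (taylor_coeff f n)) = (\<lambda>n. complex_of_real ((cmod (taylor_coeff f n))^2))"
    by (simp only: complex_norm_square)
  then show ?thesis
    using suminf_of_real[OF summable_sq_taylor[OF f], where 'a = complex] hardy_inner_eq_suminf(2)[OF f f]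
    by (simp add: sq_norm_def)
qed

lemma sq_norm_nonneg: "f \<in> hardy_space \<Longrightarrow> 0 \<le> sq_norm f"
  unfolding sq_norm_def by (intro suminf_nonneg summable_sq_taylor) auto

lemma taylor_coeff_add:
  assumes "f \<in> hardy_space" "g \<in> hardy_space"
  shows "taylor_coeff (\<lambda>z. f z + g z) n = taylor_coeff f n + taylor_coeff g n"
  using higher_deriv_add[of f "ball 0 1" g 0 n] assms
  by (simp add: taylor_coeff_def hardy_space_holomorphic add_divide_distrib)

lemma taylor_coeff_cmult:
  assumes "f \<in> hardy_space"
  shows "taylor_coeff (\<lambda>z. c * f z) n = c * taylor_coeff f n"
  using higher_deriv_cmult[of f "ball 0 1" 0 n c] assms
  by (simp add: taylor_coeff_def hardy_space_holomorphic)

lemma hardy_space_cmult: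
  assumes "f \<in> hardy_space"
  shows "(\<lambda>z. c * f z) \<in> hardy_space"
  using assms summable_mult[OF summable_sq_taylor[OF assms], of "(cmod c)^2"]
  by (intro hardy_spaceI_summable) (auto simp: taylor_coeff_cmult norm_mult power_mult_distrib
      hardy_space_holomorphic intro!: holomorphic_intros)

lemma hardy_space_add:
  assumes f: "f \<in> hardy_space" and g: "g \<in> hardy_space"
  shows "(\<lambda>z. f z + g z) \<in> hardy_space"
proof (rule hardy_spaceI_summable)
  show "(\<lambda>z. f z + g z) holomorphic_on ball 0 1"
    using f[THEN hardy_space_holomorphic] g[THEN hardy_space_holomorphic] by (intro holomorphic_intros)
  show "summable (\<lambda>n. (cmod (taylor_coeff (\<lambda>z. f z + g z) n))^2)"
  proof (rule summable_comparison_test')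
    show "summable (\<lambda>n. 2 * (cmod (taylor_coeff f n))^2 + 2 * (cmod (taylor_coeff g n))^2)"
      by (intro summable_add summable_mult summable_sq_taylor f g)
    fix n
    have "(cmod (taylor_coeff f n + taylor_coeff g n))^2 \<le> (cmod (taylor_coeff f n) + cmod (taylor_coeff g n))^2"
      by (intro power_mono norm_triangle_ineq) auto
    also have "\<dots> \<le> 2 * (cmod (taylor_coeff f n))^2 + 2 * (cmod (taylor_coeff g n))^2"
      using sum_squares_bound[of "cmod (taylor_coeff f n)" "cmod (taylor_coeff g n)"]
      by (simp add: power2_sum)
    finally show "norm ((cmod (taylor_coeff (\<lambda>z. f z + g z) n))^2) \<le>
        2 * (cmod (taylor_coeff f n))^2 + 2 * (cmod (taylor_coeff g n))^2"
      by (simp add: taylor_coeff_add f g)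
  qed
qed

lemma summable_taylor_inner:
  assumes "f \<in> hardy_space" "g \<in> hardy_space"
  shows "summable (\<lambda>n. taylor_coeff f n * cnj (taylor_coeff g n))"
  by (rule summable_norm_cancel) (simp add: norm_mult summable_taylor_mult assms)

lemma hardy_inner_add_left:
  assumes "f \<in> hardy_space" "g \<in> hardy_space" "h \<in> hardy_space"
  shows "hardy_inner (\<lambda>z. f z + g z) h = hardy_inner f h + hardy_inner g h"
  using assms suminf_add[OF summable_taylor_inner summable_taylor_inner]
  by (simp add: hardy_inner_eq_suminf(2) hardy_space_add taylor_coeff_add ring_distribs)

lemma hardy_inner_cmult_left:
  assumes "f \<in> hardy_space" "h \<in> hardy_space"
  shows "hardy_inner (\<lambda>z. c * f z) h = c * hardy_inner f h"
  using assms suminf_mult[OF summable_taylor_inner]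
  by (simp add: hardy_inner_eq_suminf(2) hardy_space_cmult taylor_coeff_cmult mult.assoc)

lemma hardy_inner_commute:
  assumes "f \<in> hardy_space" "g \<in> hardy_space"
  shows "hardy_inner g f = cnj (hardy_inner f g)"
proof -
  have "(\<lambda>n. cnj (taylor_coeff f n * cnj (taylor_coeff g n))) sums cnj (hardy_inner f g)"
    using summable_taylor_inner[OF assms] by (subst sums_cnj) (simp add: hardy_inner_eq_suminf(2) assms summable_sums)
  then show ?thesis by (simp add: hardy_inner_eq_suminf(2)[OF assms(2,1)] sums_iff mult.commute)
qed

lemma hardy_Cauchy_Schwarz:
  assumes f: "f \<in> hardy_space" and g: "g \<in> hardy_space"
  shows "cmod (hardy_inner f g) \<le> sqrt (sq_norm f) * sqrt (sq_norm g)"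
proof -
  have "cmod (hardy_inner f g) \<le> (\<Sum>n. cmod (taylor_coeff f n) * cmod (taylor_coeff g n))"
    using summable_norm[of "\<lambda>n. taylor_coeff f n * cnj (taylor_coeff g n)"] summable_taylor_mult[OF f g]
    by (simp add: hardy_inner_eq_suminf(2)[OF f g] norm_mult)
  also have "\<dots> \<le> sqrt (sq_norm f) * sqrt (sq_norm g)"
  proof (rule suminf_le_const[OF summable_taylor_mult[OF f g]])
    fix N
    have "(\<Sum>n<N. cmod (taylor_coeff f n) * cmod (taylor_coeff g n))
        \<le> L2_set (\<lambda>n. cmod (taylor_coeff f n)) {..<N} * L2_set (\<lambda>n. cmod (taylor_coeff g n)) {..<N}"
      using L2_set_mult_ineq[of "\<lambda>n. cmod (taylor_coeff f n)" "\<lambda>n. cmod (taylor_coeff g n)" "{..<N}"] by simp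
    also have "\<dots> \<le> sqrt (sq_norm f) * sqrt (sq_norm g)"
      unfolding L2_set_def sq_norm_def
      by (intro mult_mono real_sqrt_le_mono sum_le_suminf summable_sq_taylor f g)
        (auto intro!: sum_nonneg suminf_nonneg summable_sq_taylor f g)
    finally show "(\<Sum>n<N. cmod (taylor_coeff f n) * cmod (taylor_coeff g n)) \<le> sqrt (sq_norm f) * sqrt (sq_norm g)" .
  qed
  finally show ?thesis .
qed

text \<open>The n-th coefficient of the difference is (1 - r^n) times that of f, so domination by
  the coefficients of f allows r to tend to 1. The difference is written with a factor - 1 to match
  the closure lemmas for sums and multiples.\<close>

lemma hardy_dilation:
  assumes f: "f \<in> hardy_space"
  shows "((\<lambda>r::real. sq_norm (\<lambda>z. f z + (- 1) * f (of_real r * z))) \<longlongrightarrow> 0) (at_left 1)"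
proof -
  define S where "S = (\<lambda>r::real. \<Sum>n. (cmod (taylor_coeff f n))^2 * (1 - r^n)^2)"
  have "continuous_on {0..1} S"
    unfolding S_def
    by (rule continuous_on_suminf_dominated[OF _ _ summable_sq_taylor[OF f]])
      (auto intro!: continuous_intros mult_left_le power_le_one simp: norm_mult)
  then have "(S \<longlongrightarrow> S 1) (at_left 1)"
    using at_within_Icc_at_left[of 0 "1::real"] by (auto simp: continuous_on_def dest: bspec[of _ _ 1])
  moreover have "\<forall>\<^sub>F r in at_left 1. S r = sq_norm (\<lambda>z. f z + (- 1) * f (of_real r * z))"
    using eventually_at_left_real[OF zero_less_one]
  proof eventually_elim
    case (elim r)
    have hol: "f holomorphic_on ball 0 1" by (rule hardy_space_holomorphic[OF f])
    have lt: "r * cmod x < 1" if "cmod x < 1" for x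
      using mult_right_mono[of r 1 "cmod x"] elim that by auto
    have fr: "(\<lambda>z. f (of_real r * z)) holomorphic_on ball 0 1"
      using elim by (intro holomorphic_on_compose_gen[OF _ hol, unfolded o_def])
        (auto intro!: holomorphic_intros simp: norm_mult lt)
    have "taylor_coeff (\<lambda>z. f z + (- 1) * f (of_real r * z)) n = (1 - of_real r^n) * taylor_coeff f n" for n
    proof -
      have "(deriv ^^ n) (\<lambda>w. f (of_real r * w)) 0 = of_real r^n * (deriv ^^ n) f (of_real r * 0)"
        using elim by (intro higher_deriv_compose_linear[OF hol, of "ball 0 1"])
          (auto simp: norm_mult lt)
      then show ?thesis
        using higher_deriv_diff[OF hol fr, of 0 n] by (simp add: taylor_coeff_def field_simps)
    qed
    moreover have "cmod (1 - of_real r^n) ^ 2 = (1 - r^n)^2" for n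
    proof -
      have "1 - complex_of_real r^n = of_real (1 - r^n)" by simp
      then show ?thesis by (simp only: norm_of_real power2_abs)
    qed
    ultimately show ?case
      by (simp add: S_def sq_norm_def norm_mult power_mult_distrib mult.commute)
  qed
  ultimately have "((\<lambda>r::real. sq_norm (\<lambda>z. f z + (- 1) * f (of_real r * z))) \<longlongrightarrow> S 1) (at_left 1)"
    by (rule Lim_transform_eventually)
  then show ?thesis by (simp add: S_def)
qed

section \<open>Circle means and disc automorphisms\<close>

text \<open>The Hardy functions whose boundary values are used; any other one is reached as the
  limit of its dilations.\<close>

definition disc_algebra :: "(complex \<Rightarrow> complex) set" where
  "disc_algebra = {f. continuous_on (cball 0 1) f \<and> f holomorphic_on ball 0 1}"

definition circle_mean :: "(complex \<Rightarrow> real) \<Rightarrow> real" where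
  "circle_mean h = integral {0..2*pi} (\<lambda>t. h (cis t)) / (2*pi)"

lemma continuous_on_polar:
  assumes "continuous_on (cball 0 1) f"
  shows "continuous_on ({0..1} \<times> cbox 0 (2*pi)) (\<lambda>(r, t). f (of_real r * cis t))"
  unfolding case_prod_unfold
  by (rule continuous_on_compose2[OF assms]) (auto intro!: continuous_intros simp: norm_mult)

lemma continuous_on_circle_inner:
  assumes "f \<in> disc_algebra" "g \<in> disc_algebra"
  shows "continuous_on {0..1} (circle_inner f g)"
proof -
  have "continuous_on ({0..1} \<times> cbox 0 (2*pi)) (\<lambda>p. (\<lambda>(r, t). f (of_real r * cis t)) p * cnj ((\<lambda>(r, t). g (of_real r * cis t)) p))"
    using assms by (intro continuous_intros continuous_on_polar) (auto simp: disc_algebra_def)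
  then have "continuous_on ({0..1} \<times> cbox 0 (2*pi)) (\<lambda>(r, t). f (of_real r * cis t) * cnj (g (of_real r * cis t)))"
    by (simp add: case_prod_unfold)
  from integral_continuous_on_param[OF this]
  have "continuous_on {0..1} (\<lambda>r. integral {0..2*pi} (\<lambda>t. f (of_real r * cis t) * cnj (g (of_real r * cis t))) / (2 * of_real pi))"
    by (intro continuous_intros) auto
  then show ?thesis by (simp add: circle_inner_def[abs_def])
qed

lemma disc_algebra_subset_hardy_space: "disc_algebra \<subseteq> hardy_space"
proof
  fix f assume f: "f \<in> disc_algebra"
  have "bounded (circle_inner f f ` {0..1})"
    by (intro compact_imp_bounded compact_continuous_image continuous_on_circle_inner f) auto
  then obtain B where "\<forall>r\<in>{0..1}. cmod (circle_inner f f r) \<le> B"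
    by (auto simp: bounded_iff)
  then have "Re (circle_inner f f r) \<le> B" if "0 \<le> r" "r < 1" for r
    using that complex_Re_le_cmod[of "circle_inner f f r"] by (metis atLeastAtMost_iff less_imp_le order_trans)
  then show "f \<in> hardy_space"
    using f by (intro hardy_spaceI) (auto simp: disc_algebra_def)
qed

text \<open>The circle means are continuous up to radius 1, so here the limit in the inner product
  is a genuine boundary integral.\<close>

lemma hardy_inner_disc_algebra:
  assumes f: "f \<in> disc_algebra" and g: "g \<in> disc_algebra"
  shows "hardy_inner f g = circle_inner f g 1"
proof (rule tendsto_unique[of "at_left (1::real)"])
  show "(circle_inner f g \<longlongrightarrow> hardy_inner f g) (at_left 1)"
    using f g disc_algebra_subset_hardy_space by (intro hardy_inner_eq_suminf) auto
  have "(circle_inner f g \<longlongrightarrow> circle_inner f g 1) (at 1 within {0..1})"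
    using continuous_on_circle_inner[OF f g] by (auto simp: continuous_on_def)
  then show "(circle_inner f g \<longlongrightarrow> circle_inner f g 1) (at_left 1)"
    using at_within_Icc_at_left[of 0 "1::real"] by simp
qed simp

lemma continuous_on_circle:
  assumes "continuous_on (sphere 0 1) h"
  shows "continuous_on S (\<lambda>t. h (cis t))"
  by (rule continuous_on_compose2[OF assms]) (auto intro!: continuous_intros)

lemma disc_algebra_sphere:
  assumes "f \<in> disc_algebra"
  shows "continuous_on (sphere 0 1) f"
  using assms by (auto simp: disc_algebra_def intro: continuous_on_subset)

lemma Re_hardy_inner:
  assumes f: "f \<in> disc_algebra" and g: "g \<in> disc_algebra"
  shows "Re (c * hardy_inner f g) = circle_mean (\<lambda>\<zeta>. Re (c * (f \<zeta> * cnj (g \<zeta>))))"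
proof -
  have int: "(\<lambda>t. f (cis t) * cnj (g (cis t))) integrable_on {0..2*pi}"
    by (intro integrable_continuous_real continuous_intros continuous_on_circle disc_algebra_sphere f g)
  have "((\<lambda>t. Re (c * (f (cis t) * cnj (g (cis t))))) has_integral
      Re (c * integral {0..2*pi} (\<lambda>t. f (cis t) * cnj (g (cis t))))) {0..2*pi}"
    by (intro has_integral_Re has_integral_mult_right integrable_integral int)
  moreover have "Re (c * hardy_inner f g) = Re (c * integral {0..2*pi} (\<lambda>t. f (cis t) * cnj (g (cis t)))) / (2*pi)"
  proof -
    have "c * hardy_inner f g = (c * integral {0..2*pi} (\<lambda>t. f (cis t) * cnj (g (cis t)))) / of_real (2*pi)"
      by (simp add: hardy_inner_disc_algebra f g circle_inner_def)
    then show ?thesis by (simp only: Re_divide_of_real)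
  qed
  ultimately show ?thesis by (simp add: circle_mean_def integral_unique)
qed

lemma sq_norm_disc_algebra:
  assumes f: "f \<in> disc_algebra"
  shows "sq_norm f = circle_mean (\<lambda>\<zeta>. (cmod (f \<zeta>))^2)"
proof -
  have "Re (1 * hardy_inner f f) = circle_mean (\<lambda>\<zeta>. Re (1 * (f \<zeta> * cnj (f \<zeta>))))"
    by (rule Re_hardy_inner[OF f f])
  then show ?thesis
    using f disc_algebra_subset_hardy_space
    by (auto simp: hardy_inner_self complex_norm_square[symmetric] simp del: of_real_power)
qed

lemma circle_mean_integrable:
  fixes h :: "complex \<Rightarrow> real"
  assumes "continuous_on (sphere 0 1) h"
  shows "(\<lambda>t. h (cis t)) integrable_on {0..2*pi}"
  by (intro integrable_continuous_real continuous_on_circle assms)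

lemma circle_mean_mono:
  assumes "continuous_on (sphere 0 1) h" "continuous_on (sphere 0 1) k"
    and "\<And>\<zeta>. cmod \<zeta> = 1 \<Longrightarrow> h \<zeta> \<le> k \<zeta>"
  shows "circle_mean h \<le> circle_mean k"
  unfolding circle_mean_def
  by (intro divide_right_mono integral_le circle_mean_integrable assms) auto

lemma circle_mean_add:
  assumes "continuous_on (sphere 0 1) h" "continuous_on (sphere 0 1) k"
  shows "circle_mean (\<lambda>\<zeta>. h \<zeta> + k \<zeta>) = circle_mean h + circle_mean k"
  unfolding circle_mean_def
  using integral_add[OF circle_mean_integrable[OF assms(1)] circle_mean_integrable[OF assms(2)]]
  by (simp add: add_divide_distrib)

lemma circle_mean_cmult: "circle_mean (\<lambda>\<zeta>. c * h \<zeta>) = c * circle_mean h"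
  unfolding circle_mean_def by simp

lemma circle_mean_cong: "(\<And>\<zeta>. cmod \<zeta> = 1 \<Longrightarrow> h \<zeta> = k \<zeta>) \<Longrightarrow> circle_mean h = circle_mean k"
  unfolding circle_mean_def by (simp cong: integral_cong)

lemma circle_mean_Re_disc_algebra:
  assumes f: "f \<in> disc_algebra"
  shows "circle_mean (\<lambda>\<zeta>. Re (f \<zeta>)) = Re (f 0)"
proof -
  have one: "(\<lambda>_. 1) \<in> disc_algebra" by (simp add: disc_algebra_def)
  have "circle_inner f (\<lambda>_. 1) r = f 0" if "0 < r" "r < 1" for r
    using taylor_coeff_integral[of f r 0] that f
    by (simp add: circle_inner_def disc_algebra_def taylor_coeff_def)
  then have "\<forall>\<^sub>F r in at_left 1. circle_inner f (\<lambda>_. 1) r = f 0"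
    using eventually_at_left_real[OF zero_less_one] by (auto elim!: eventually_mono)
  then have "(circle_inner f (\<lambda>_. 1) \<longlongrightarrow> f 0) (at_left 1)"
    by (rule tendsto_eventually)
  moreover have "(circle_inner f (\<lambda>_. 1) \<longlongrightarrow> hardy_inner f (\<lambda>_. 1)) (at_left 1)"
    using f one disc_algebra_subset_hardy_space by (intro hardy_inner_eq_suminf) auto
  ultimately have "hardy_inner f (\<lambda>_. 1) = f 0"
    by (intro tendsto_unique[of "at_left (1::real)"]) auto
  then show ?thesis using Re_hardy_inner[OF f one, of 1] by simp
qed

text \<open>An antiderivative G of a periodic H grows by the same constant over every period. Since
  \<tau> may start at any angle, the integral of (G o \<tau>)' is compared with that over [0, 2 pi]
  through this constant.\<close>

lemma integral_periodic_substitution: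
  fixes H \<tau> \<tau>' :: "real \<Rightarrow> real"
  assumes H: "continuous_on UNIV H" and periodic: "\<And>t. H (t + 2*pi) = H t"
    and \<tau>: "\<And>t. t \<in> {0..2*pi} \<Longrightarrow> (\<tau> has_real_derivative \<tau>' t) (at t within {0..2*pi})"
    and turn: "\<tau> (2*pi) = \<tau> 0 + 2*pi"
  shows "integral {0..2*pi} (\<lambda>t. \<tau>' t * H (\<tau> t)) = integral {0..2*pi} H"
proof -
  have "continuous_on {0..2*pi} \<tau>"
    using \<tau> by (meson DERIV_continuous continuous_on_eq_continuous_within)
  then have "bounded (\<tau> ` {0..2*pi})" by (intro compact_imp_bounded compact_continuous_image) auto
  then obtain B where "\<forall>t\<in>{0..2*pi}. \<bar>\<tau> t\<bar> \<le> B" by (auto simp: bounded_iff)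
  then have B: "\<And>t. t \<in> {0..2*pi} \<Longrightarrow> \<bar>\<tau> t\<bar> \<le> B" by blast
  \<comment> \<open>Large enough for the interval to contain the range of \<tau>, its shift by 2 pi,
    and [0, 2 pi].\<close>
  define M where "M = B + 4*pi"
  have "0 \<le> B" using B[of 0] by simp
  then have M: "4*pi \<le> M" by (simp add: M_def)
  obtain G where G: "\<And>x. x \<in> {-M..M} \<Longrightarrow> (G has_vector_derivative H x) (at x within {-M..M})"
    using antiderivative_continuous[of "-M" M H] H continuous_on_subset by blast
  have int_H: "(H has_integral (G y - G x)) {x..y}" if "x \<le> y" "-M \<le> x" "y \<le> M" for x y
    using that by (intro fundamental_theorem_of_calculus)
      (auto intro!: has_vector_derivative_within_subset[OF G])
  have rng: "x \<in> {-M..M}" "x + 2*pi \<in> {-M..M}" if "x \<in> {-B..B}" for x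
    using that pi_gt_zero unfolding M_def atLeastAtMost_iff by linarith+
  have D: "G (x + 2*pi) - G x = G (2*pi) - G 0" if x: "x \<in> {-B..B}" for x
  proof -
    have "((\<lambda>x. G (x + 2*pi) - G x) has_vector_derivative 0) (at x within {-B..B})" if "x \<in> {-B..B}" for x
    proof -
      have "((\<lambda>x. x + 2*pi) has_vector_derivative 1) (at x within {-B..B})"
        by (auto intro!: derivative_eq_intros)
      moreover have "(G has_vector_derivative H (x + 2*pi)) (at (x + 2*pi) within (\<lambda>x. x + 2*pi) ` {-B..B})"
        using that by (intro has_vector_derivative_within_subset[OF G] rng image_subsetI)
      ultimately have "((G \<circ> (\<lambda>x. x + 2*pi)) has_vector_derivative 1 *\<^sub>R H (x + 2*pi)) (at x within {-B..B})"
        by (rule vector_diff_chain_within)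
      moreover have "(G has_vector_derivative H x) (at x within {-B..B})"
        using that by (intro has_vector_derivative_within_subset[OF G] rng subsetI)
      ultimately have "((\<lambda>x. (G \<circ> (\<lambda>x. x + 2*pi)) x - G x) has_vector_derivative 1 *\<^sub>R H (x + 2*pi) - H x) (at x within {-B..B})"
        by (rule has_vector_derivative_diff)
      then show ?thesis by (simp add: o_def periodic)
    qed
    then obtain c where "\<And>x. x \<in> {-B..B} \<Longrightarrow> G (x + 2*pi) - G x = c"
      using has_vector_derivative_zero_constant[of "{-B..B}"] by (metis (no_types, lifting) convex_real_interval(5))
    then show ?thesis using x \<open>0 \<le> B\<close> by (metis add_0 atLeastAtMost_iff neg_le_0_iff_le)
  qed
  have "((\<lambda>t. \<tau>' t *\<^sub>R H (\<tau> t)) has_integral ((G \<circ> \<tau>) (2*pi) - (G \<circ> \<tau>) 0)) {0..2*pi}"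
  proof (rule fundamental_theorem_of_calculus)
    fix t assume t: "t \<in> {0..2*pi}"
    have "\<tau> s \<in> {-B..B}" if "s \<in> {0..2*pi}" for s using B[OF that] by (auto simp: abs_le_iff)
    then have "\<tau> ` {0..2*pi} \<subseteq> {-M..M}" "\<tau> t \<in> {-M..M}" using t rng by blast+
    then have "(G has_vector_derivative H (\<tau> t)) (at (\<tau> t) within \<tau> ` {0..2*pi})"
      using has_vector_derivative_within_subset[OF G] by blast
    then show "((G \<circ> \<tau>) has_vector_derivative \<tau>' t *\<^sub>R H (\<tau> t)) (at t within {0..2*pi})"
      using \<tau>[OF t] by (intro vector_diff_chain_within) (simp_all add: has_real_derivative_iff_has_vector_derivative)
  qed simp
  moreover have "(G \<circ> \<tau>) (2*pi) - (G \<circ> \<tau>) 0 = G (2*pi) - G 0"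
    using D[of "\<tau> 0"] B[of 0] turn by (auto simp: abs_le_iff)
  moreover have "integral {0..2*pi} H = G (2*pi) - G 0"
  proof -
    have "0 \<le> 2*pi" "-M \<le> 0" "2*pi \<le> M" using M pi_gt_zero by linarith+
    then show ?thesis using int_H[of 0 "2*pi"] by (intro integral_unique)
  qed
  ultimately show ?thesis by (simp add: integral_unique)
qed

section \<open>The involution exchanging 0 and a, and the Poisson kernel\<close>

definition mobius :: "complex \<Rightarrow> complex \<Rightarrow> complex" where
  "mobius a z = (a - z) / (1 - cnj a * z)"

text \<open>The Poisson kernel on the unit circle; inside the disc the same expression is the factor
  by which \<open>mobius a\<close> changes 1 - |z|^2.\<close>

definition poisson :: "complex \<Rightarrow> complex \<Rightarrow> real" where
  "poisson a z = (1 - (cmod a)^2) / (cmod (1 - cnj a * z))^2"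

lemma mobius_denom:
  assumes "cmod a < 1" "cmod z \<le> 1"
  shows "1 - cnj a * z \<noteq> 0"
proof
  assume "1 - cnj a * z = 0"
  then have "cmod a * cmod z = 1" by (metis complex_mod_cnj eq_iff_diff_eq_0 norm_mult norm_one)
  moreover have "cmod a * cmod z \<le> cmod a" using assms by (simp add: mult_left_le)
  ultimately show False using assms by simp
qed

lemma mobius_norm:
  assumes "cmod a < 1" "cmod z \<le> 1"
  shows "1 - (cmod (mobius a z))^2 = poisson a z * (1 - (cmod z)^2)"
proof -
  have d: "(cmod (1 - cnj a * z))^2 \<noteq> 0" using mobius_denom[OF assms] by simp
  have "complex_of_real ((cmod (1 - cnj a * z))^2 - (cmod (a - z))^2) = of_real ((1 - (cmod a)^2) * (1 - (cmod z)^2))"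
    unfolding of_real_diff of_real_mult complex_norm_square by (simp add: algebra_simps)
  then have "(cmod (1 - cnj a * z))^2 - (cmod (a - z))^2 = (1 - (cmod a)^2) * (1 - (cmod z)^2)"
    by (simp only: of_real_eq_iff)
  then show ?thesis using d by (simp add: mobius_def poisson_def norm_divide power_divide field_simps)
qed

lemma poisson_pos:
  assumes "cmod a < 1" "cmod z \<le> 1"
  shows "0 < poisson a z"
  using mobius_denom[OF assms] assms(1) by (simp add: poisson_def power_less_one_iff)

lemma mobius_range:
  assumes a: "cmod a < 1"
  shows "cmod z < 1 \<Longrightarrow> cmod (mobius a z) < 1"
    and "cmod z = 1 \<Longrightarrow> cmod (mobius a z) = 1"
    and "cmod z \<le> 1 \<Longrightarrow> cmod (mobius a z) \<le> 1"
proof -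
  show lt: "cmod (mobius a z) < 1" if "cmod z < 1"
  proof -
    have "0 < 1 - (cmod (mobius a z))^2"
      using mobius_norm[OF a, of z] poisson_pos[OF a, of z] that by (simp add: power_less_one_iff)
    then show ?thesis by (simp add: power_less_one_iff)
  qed
  show eq: "cmod (mobius a z) = 1" if "cmod z = 1"
    using mobius_norm[OF a, of z] that by (simp add: power2_eq_1_iff) (smt (verit) norm_ge_zero)
  show "cmod (mobius a z) \<le> 1" if "cmod z \<le> 1"
    using lt eq that by linarith
qed

lemma mobius_involution:
  assumes a: "cmod a < 1" and z: "cmod z \<le> 1"
  shows "mobius a (mobius a z) = z"
proof -
  define d where "d = 1 - cnj a * z"
  have d: "d \<noteq> 0" using mobius_denom[OF a z] by (simp add: d_def)
  have "1 - cnj a * mobius a z \<noteq> 0" by (intro mobius_denom mobius_range a z)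
  moreover have "mobius a z = (a - z) / d" by (simp add: mobius_def d_def)
  moreover have "1 - cnj a * ((a - z) / d) = (1 - cnj a * a) / d" using d by (simp add: d_def field_simps)
  moreover have "a - (a - z) / d = z * (1 - cnj a * a) / d" using d by (simp add: d_def field_simps)
  moreover have "1 - cnj a * a \<noteq> 0" using mobius_denom[OF a, of a] a by simp
  ultimately show ?thesis using d by (simp add: mobius_def[of a "(a - z) / d"])
qed

lemma mobius_disc_algebra:
  assumes "cmod a < 1"
  shows "mobius a \<in> disc_algebra"
  using mobius_denom[OF assms] unfolding disc_algebra_def mobius_def
  by (auto intro!: continuous_intros holomorphic_intros)

lemma disc_algebra_compose:
  assumes "f \<in> disc_algebra" "g \<in> disc_algebra"
    and "\<And>z. cmod z < 1 \<Longrightarrow> cmod (g z) < 1" "\<And>z. cmod z \<le> 1 \<Longrightarrow> cmod (g z) \<le> 1"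
  shows "(\<lambda>z. f (g z)) \<in> disc_algebra"
  using assms unfolding disc_algebra_def
  by (auto intro!: continuous_on_compose2[of "cball 0 1" f] holomorphic_on_compose_gen[of g _ f, unfolded o_def])

lemma continuous_on_poisson:
  assumes "cmod a < 1"
  shows "continuous_on (sphere 0 1) (poisson a)"
  using mobius_denom[OF assms] unfolding poisson_def by (auto intro!: continuous_intros)

text \<open>On the circle the kernel is the real part of (1 + cnj a z) / (1 - cnj a z), and the mean
  value property evaluates this function at 0.\<close>

lemma circle_mean_poisson:
  assumes a: "cmod a < 1"
  shows "circle_mean (poisson a) = 1"
proof -
  define k where "k = (\<lambda>z. (1 + cnj a * z) / (1 - cnj a * z))"
  have "k \<in> disc_algebra"
    using mobius_denom[OF a] unfolding disc_algebra_def k_def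
    by (auto intro!: continuous_intros holomorphic_intros)
  then have "circle_mean (\<lambda>\<zeta>. Re (k \<zeta>)) = 1"
    using circle_mean_Re_disc_algebra[of k] by (simp add: k_def)
  moreover have "Re (k \<zeta>) = poisson a \<zeta>" if "cmod \<zeta> = 1" for \<zeta>
  proof -
    define w where "w = cnj a * \<zeta>"
    have w: "cmod w = cmod a" using that by (simp add: w_def norm_mult)
    have "(1 + w) / (1 - w) = (1 + w) * cnj (1 - w) / of_real ((cmod (1 - w))^2)"
      by (metis complex_div_cnj complex_norm_square of_real_power)
    also have "Re \<dots> = Re ((1 + w) * cnj (1 - w)) / (cmod (1 - w))^2" by (rule Re_divide_of_real)
    also have "Re ((1 + w) * cnj (1 - w)) = 1 - (cmod w)^2"
      unfolding cmod_power2 by (simp add: power2_eq_square algebra_simps)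
    finally show ?thesis by (simp add: k_def poisson_def w w_def[symmetric])
  qed
  ultimately show ?thesis using circle_mean_cong[of "\<lambda>\<zeta>. Re (k \<zeta>)" "poisson a"] by simp
qed

text \<open>The argument of the image point moves with speed \<open>poisson a (cis t)\<close>; hence
  the image of Poisson measure is arc length.\<close>

lemma mobius_deriv_circle:
  assumes a: "cmod a < 1"
  shows "((\<lambda>t. mobius a (cis t)) has_vector_derivative of_real (poisson a (cis t)) * \<i> * mobius a (cis t)) (at t within S)"
proof -
  define z where "z = cis t"
  define d where "d = 1 - cnj a * z"
  have z: "z * cnj z = 1" by (simp add: z_def cis_cnj cis_mult)
  have d: "d \<noteq> 0" using mobius_denom[OF a, of z] by (simp add: d_def z_def)
  have "(mobius a has_field_derivative (- 1 * d - (a - z) * (- cnj a)) / (d * d)) (at z)"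
    unfolding mobius_def d_def using d by (auto intro!: derivative_eq_intros simp: d_def)
  moreover have "(cis has_vector_derivative \<i> * z) (at t within S)"
    unfolding has_vector_derivative_def z_def by (auto intro!: derivative_eq_intros)
  ultimately have "((mobius a \<circ> cis) has_vector_derivative \<i> * z * ((- 1 * d - (a - z) * (- cnj a)) / (d * d))) (at t within S)"
    unfolding z_def by (intro field_vector_diff_chain_within) (auto intro: has_field_derivative_at_within)
  moreover have "\<i> * z * ((- 1 * d - (a - z) * (- cnj a)) / (d * d)) = of_real (poisson a z) * \<i> * mobius a z"
  proof -
    have "of_real (poisson a z) = (1 - a * cnj a) / (d * cnj d)"
      unfolding poisson_def d_def[symmetric] of_real_divide of_real_diff complex_norm_square by simp
    moreover have "cnj d \<noteq> 0" using d by simp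
    moreover have "z * cnj d = z - a" using z by (simp add: d_def algebra_simps)
    moreover have "- 1 * d - (a - z) * (- cnj a) = a * cnj a - 1" by (simp add: d_def algebra_simps)
    ultimately have "of_real (poisson a z) * (d * cnj d) = 1 - a * cnj a" "z * cnj d = z - a"
      "(- 1 * d - (a - z) * (- cnj a)) = a * cnj a - 1"
      using d by simp_all
    then have "z * (- 1 * d - (a - z) * (- cnj a)) = of_real (poisson a z) * ((a - z) * d)" by algebra
    then show ?thesis using d by (simp add: mobius_def d_def[symmetric] divide_simps)
  qed
  ultimately show ?thesis by (simp add: o_def z_def)
qed

lemma circle_mean_mobius:
  assumes a: "cmod a < 1" and h: "continuous_on (sphere 0 1) h"
  shows "circle_mean (\<lambda>\<zeta>. poisson a \<zeta> * h (mobius a \<zeta>)) = circle_mean h"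
proof -
  obtain \<tau>0 where \<tau>0: "mobius a 1 = cis \<tau>0"
    using mobius_range(2)[OF a, of 1] by (metis complex_norm_eq_1_exp cis_conv_exp norm_one)
  \<comment> \<open>A continuous argument of the image point, obtained by integrating its speed.
    Dividing the image by \<open>cis (\<tau> t)\<close> gives a constant, and the total mass 1 of
    the kernel gives exactly one turn.\<close>
  define \<tau> where "\<tau> = (\<lambda>t. \<tau>0 + integral {0..t} (\<lambda>s. poisson a (cis s)))"
  have \<tau>': "(\<tau> has_real_derivative poisson a (cis t)) (at t within {0..2*pi})" if "t \<in> {0..2*pi}" for t
    using integral_has_real_derivative[OF continuous_on_circle[OF continuous_on_poisson[OF a]] that]
    unfolding \<tau>_def by (auto intro!: derivative_eq_intros)
  have turn: "\<tau> (2*pi) = \<tau> 0 + 2*pi"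
    using circle_mean_poisson[OF a] by (simp add: \<tau>_def circle_mean_def)
  have "((\<lambda>t. mobius a (cis t) * cis (- \<tau> t)) has_vector_derivative 0) (at t within {0..2*pi})"
    if t: "t \<in> {0..2*pi}" for t
  proof -
    have "(\<tau> has_vector_derivative poisson a (cis t)) (at t within {0..2*pi})"
      using \<tau>'[OF t] by (simp add: has_real_derivative_iff_has_vector_derivative)
    then have "((\<lambda>t. cis (- \<tau> t)) has_vector_derivative of_real (- poisson a (cis t)) * (\<i> * cis (- \<tau> t))) (at t within {0..2*pi})"
      unfolding has_vector_derivative_def
      by (auto intro!: derivative_eq_intros simp: scaleR_conv_of_real fun_eq_iff)
    from has_vector_derivative_mult[OF mobius_deriv_circle[OF a] this]
    show ?thesis by (simp add: algebra_simps)
  qed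
  then obtain c where c: "\<And>t. t \<in> {0..2*pi} \<Longrightarrow> mobius a (cis t) * cis (- \<tau> t) = c"
    using has_vector_derivative_zero_constant[of "{0..2*pi}"] by (metis (no_types, lifting) convex_real_interval(5))
  have "c = 1" using c[of 0] \<tau>0 by (simp add: \<tau>_def cis_mult)
  have mob: "mobius a (cis t) = cis (\<tau> t)" if "t \<in> {0..2*pi}" for t
  proof -
    have "mobius a (cis t) = mobius a (cis t) * cis (- \<tau> t) * cis (\<tau> t)" by (simp add: mult.assoc cis_mult)
    then show ?thesis using c[OF that] \<open>c = 1\<close> by simp
  qed
  have "integral {0..2*pi} (\<lambda>t. poisson a (cis t) * h (cis (\<tau> t))) = integral {0..2*pi} (\<lambda>t. h (cis t))"
    by (rule integral_periodic_substitution[OF _ _ \<tau>' turn])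
      (auto intro!: continuous_on_circle h simp: cis_mult[symmetric])
  moreover have "integral {0..2*pi} (\<lambda>t. poisson a (cis t) * h (mobius a (cis t)))
      = integral {0..2*pi} (\<lambda>t. poisson a (cis t) * h (cis (\<tau> t)))"
    by (intro integral_cong) (simp add: mob)
  ultimately show ?thesis by (simp add: circle_mean_def)
qed

lemma circle_mean_rotate:
  assumes l: "cmod l = 1" and h: "continuous_on (sphere 0 1) h"
  shows "circle_mean (\<lambda>\<zeta>. h (l * \<zeta>)) = circle_mean h"
proof -
  obtain s where s: "l = cis s" using l by (metis complex_norm_eq_1_exp cis_conv_exp)
  have "integral {0..2*pi} (\<lambda>t. 1 * h (cis (s + t))) = integral {0..2*pi} (\<lambda>t. h (cis t))"
    by (rule integral_periodic_substitution)
      (auto intro!: continuous_on_circle h derivative_eq_intros simp: cis_mult[symmetric])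
  then show ?thesis by (simp add: circle_mean_def s cis_mult)
qed

section \<open>Cyclic forms on the fibres\<close>

lemma Re_of_real_mult: "Re (of_real r * w) = r * Re w"
  by simp

text \<open>Completion of squares for the Hermitian matrix with diagonal p0, p1, p2 and off-diagonal
  entries u, v, z, multiplied by p0 m to clear denominators: m is the leading 2 x 2 minor and
  \<open>dt\<close> the determinant.\<close>

lemma hermitian_form_identity:
  fixes u v z x0 x1 x2 :: complex and p0 p1 p2 :: real
  defines "m \<equiv> p0 * p1 - (cmod u)^2" and "c \<equiv> of_real p0 * v - cnj (u * z)"
    and "dt \<equiv> p0 * p1 * p2 + 2 * Re (u * v * z) - p0 * (cmod v)^2 - p1 * (cmod z)^2 - p2 * (cmod u)^2"
  shows "p0 * m * (p0 * (cmod x0)^2 + p1 * (cmod x1)^2 + p2 * (cmod x2)^2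
      + 2 * Re (u * x1 * cnj x0 + v * x2 * cnj x1 + z * x0 * cnj x2))
    = m * (cmod (of_real p0 * x0 + u * x1 + cnj z * x2))^2
      + (cmod (of_real m * x1 + c * x2))^2 + p0 * dt * (cmod x2)^2"
proof -
  define R where "R = 2 * Re (u * x1 * cnj x0 + v * x2 * cnj x1 + z * x0 * cnj x2)"
  define R' where "R' = 2 * Re (u * v * z)"
  have R: "of_real R = (u * x1 * cnj x0 + v * x2 * cnj x1 + z * x0 * cnj x2)
      + (cnj u * cnj x1 * x0 + cnj v * cnj x2 * x1 + cnj z * cnj x0 * x2)"
    using complex_add_cnj[of "u * x1 * cnj x0 + v * x2 * cnj x1 + z * x0 * cnj x2"] by (simp add: R_def)
  have R': "of_real R' = u * v * z + cnj u * cnj v * cnj z"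
    using complex_add_cnj[of "u * v * z"] by (simp add: R'_def)
  have "complex_of_real (p0 * m * (p0 * (cmod x0)^2 + p1 * (cmod x1)^2 + p2 * (cmod x2)^2 + R))
      = of_real (m * (cmod (of_real p0 * x0 + u * x1 + cnj z * x2))^2
      + (cmod (of_real m * x1 + c * x2))^2 + p0 * dt * (cmod x2)^2)"
    unfolding m_def c_def dt_def R'_def[symmetric]
    unfolding of_real_mult of_real_add of_real_diff complex_norm_square R R'
      complex_cnj_add complex_cnj_diff complex_cnj_mult complex_cnj_cnj complex_cnj_complex_of_real
    by algebra
  then show ?thesis unfolding R_def of_real_eq_iff .
qed

lemma hermitian_form_nonneg:
  fixes u v z x0 x1 x2 :: complex and p0 p1 p2 :: real
  assumes p0: "0 < p0" and minor: "0 < p0 * p1 - (cmod u)^2"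
    and det: "0 \<le> p0 * p1 * p2 + 2 * Re (u * v * z) - p0 * (cmod v)^2 - p1 * (cmod z)^2 - p2 * (cmod u)^2"
  shows "0 \<le> p0 * (cmod x0)^2 + p1 * (cmod x1)^2 + p2 * (cmod x2)^2
    + 2 * Re (u * x1 * cnj x0 + v * x2 * cnj x1 + z * x0 * cnj x2)" (is "0 \<le> ?form")
proof -
  have "0 \<le> (p0 * (p0 * p1 - (cmod u)^2)) * ?form"
    unfolding hermitian_form_identity
    by (intro add_nonneg_nonneg mult_nonneg_nonneg zero_le_power2 det less_imp_le[OF p0] less_imp_le[OF minor])
  moreover have "0 < p0 * (p0 * p1 - (cmod u)^2)" using p0 minor by simp
  ultimately show ?thesis unfolding zero_le_mult_iff[of "p0 * (p0 * p1 - (cmod u)^2)"] by linarith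
qed

lemma hermitian_form_neg:
  fixes u v z :: complex and p0 p1 p2 :: real
  assumes p0: "0 < p0" and minor: "p0 * p1 - (cmod u)^2 \<noteq> 0"
    and det: "p0 * p1 * p2 + 2 * Re (u * v * z) - p0 * (cmod v)^2 - p1 * (cmod z)^2 - p2 * (cmod u)^2 < 0"
  obtains x0 x1 x2 where "p0 * (cmod x0)^2 + p1 * (cmod x1)^2 + p2 * (cmod x2)^2
    + 2 * Re (u * x1 * cnj x0 + v * x2 * cnj x1 + z * x0 * cnj x2) < 0"
proof -
  define m where "m = p0 * p1 - (cmod u)^2"
  define c where "c = of_real p0 * v - cnj (u * z)"
  \<comment> \<open>A negative minor is exhibited with x2 = 0. Otherwise x1 kills the second square
    and only the determinant term is left. In both cases x0 kills the first square.\<close>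
  define x1 x2 where "x1 = (if m < 0 then 1 else - c / of_real m)" and "x2 = (if m < 0 then 0 else 1 :: complex)"
  define x0 where "x0 = - (u * x1 + cnj z * x2) / of_real p0"
  define form where "form = p0 * (cmod x0)^2 + p1 * (cmod x1)^2 + p2 * (cmod x2)^2
    + 2 * Re (u * x1 * cnj x0 + v * x2 * cnj x1 + z * x0 * cnj x2)"
  define dt where "dt = p0 * p1 * p2 + 2 * Re (u * v * z) - p0 * (cmod v)^2 - p1 * (cmod z)^2 - p2 * (cmod u)^2"
  have x0: "of_real p0 * x0 + u * x1 + cnj z * x2 = 0" using p0 by (simp add: x0_def)
  note id = hermitian_form_identity[of p0 p1 u x0 x1 p2 x2 v z, folded m_def c_def form_def dt_def, unfolded x0]
  have "form < 0"
  proof (cases "m < 0")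
    case True
    have "p0 * m * form = m * m" using id True by (simp add: x1_def x2_def power2_eq_square)
    then have "p0 * form = m" using True by simp
    then show ?thesis using True p0 by (metis mult_less_0_iff not_less_iff_gr_or_eq)
  next
    case False
    then have m: "0 < m" using minor by (simp add: m_def)
    then have "m * form = dt" using id p0 False by (simp add: x1_def x2_def)
    then have "m * form < 0" using det by (simp only: dt_def)
    then show ?thesis using m by (simp add: mult_less_0_iff)
  qed
  then show ?thesis using that unfolding form_def by blast
qed

text \<open>An elementary form of eigenvalue interlacing: t past the top root of the 3 x 3 problem
  also exceeds sqrt A / 2, the top root for its 2 x 2 block. By AM-GM B + C \<ge> 2 / sqrt A; with
  \<sigma> = 2 t / sqrt A \<le> 1 the two hypotheses bound b^3 from both sides and leave (2 \<sigma>
  + 1) (\<sigma> - 1) > 0, which is impossible.\<close>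

lemma ratio_lt_of_top_root:
  fixes A B C t :: real
  assumes pos: "0 < A" "0 < B" "0 < C" "0 < t" and ABC: "A * B * C = 1"
    and crit: "A + B + C < 12 * t^2" and above: "-1 < 4 * t^3 - (A + B + C) * t"
  shows "A < 4 * t^2"
proof (rule ccontr)
  assume "\<not> ?thesis"
  then have le: "4 * t^2 \<le> A" by simp
  define b where "b = sqrt A"
  have b: "0 < b" "b^2 = A" using pos by (simp_all add: b_def)
  have BC: "2 / b \<le> B + C"
  proof (rule power2_le_imp_le)
    have "(2 / b)^2 = 4 * (B * C)" using ABC b pos by (simp add: power_divide field_simps)
    also have "\<dots> \<le> (B + C)^2"
      using sum_squares_bound[of B C] by (simp add: power2_sum)
    finally show "(2 / b)^2 \<le> (B + C)^2" .
  qed (use pos in auto)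
  define \<sigma> where "\<sigma> = 2 * t / b"
  have t: "t = \<sigma> * b / 2" using b(1) by (simp add: \<sigma>_def)
  have \<sigma>: "0 < \<sigma>" "\<sigma> \<le> 1"
  proof -
    show "0 < \<sigma>" using b(1) pos by (simp add: \<sigma>_def)
    have "(2 * t)^2 \<le> b^2" unfolding b(2) using le by (simp add: power_mult_distrib)
    then have "2 * t \<le> b" using b(1) by (rule power2_le_imp_le[OF _ less_imp_le])
    then show "\<sigma> \<le> 1" using b(1) by (simp add: \<sigma>_def)
  qed
  have "b^2 + 2 / b < 3 * \<sigma>^2 * b^2"
  proof -
    have "12 * t^2 = 3 * \<sigma>^2 * b^2" by (simp add: t power_mult_distrib power_divide)
    then show ?thesis using crit BC b(2) by linarith
  qed
  then have "b * (b^2 + 2 / b) < b * (3 * \<sigma>^2 * b^2)" using b(1) by (rule mult_strict_left_mono)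
  moreover have "b * (b^2 + 2 / b) = b^3 + 2" "b * (3 * \<sigma>^2 * b^2) = 3 * \<sigma>^2 * b^3"
    using b(1) by (simp_all add: algebra_simps power2_eq_square power3_eq_cube)
  moreover have "b^3 * (3 * \<sigma>^2 - 1) = 3 * \<sigma>^2 * b^3 - b^3" by algebra
  ultimately have i: "2 < b^3 * (3 * \<sigma>^2 - 1)" by linarith
  have "t * (2 / b) \<le> t * (B + C)" using BC pos by (intro mult_left_mono) auto
  moreover have "(A + B + C) * t = t * b^2 + t * (B + C)" by (simp add: b(2) algebra_simps)
  moreover have "t * (2 / b) = \<sigma>" "t * b^2 = \<sigma> * b^3 / 2" "4 * t^3 = \<sigma>^3 * b^3 / 2"
    unfolding t using b(1) by (simp_all add: power2_eq_square power3_eq_cube)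
  moreover have "\<sigma> * b^3 * (1 - \<sigma>^2) = \<sigma> * b^3 - \<sigma>^3 * b^3" by algebra
  ultimately have "\<sigma> * b^3 * (1 - \<sigma>^2) < 2 * (1 - \<sigma>)"
  proof -
    assume *: "t * (2 / b) \<le> t * (B + C)" "(A + B + C) * t = t * b^2 + t * (B + C)"
      "t * (2 / b) = \<sigma>" "t * b^2 = \<sigma> * b^3 / 2" "4 * t^3 = \<sigma>^3 * b^3 / 2"
      "\<sigma> * b^3 * (1 - \<sigma>^2) = \<sigma> * b^3 - \<sigma>^3 * b^3"
    define Y P R where "Y = t * (B + C)" and "P = \<sigma> * b^3" and "R = \<sigma>^3 * b^3"
    have "\<sigma> \<le> Y" "- 1 < R / 2 - (P / 2 + Y)"
      using *(1) above unfolding *(2-5) Y_def P_def R_def by simp_all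
    then show ?thesis unfolding *(6) unfolding P_def[symmetric] R_def[symmetric] by simp
  qed
  moreover have "\<sigma> * b^3 * (1 - \<sigma>^2) = (1 - \<sigma>) * (\<sigma> * b^3 * (1 + \<sigma>))" by algebra
  ultimately have "(1 - \<sigma>) * (\<sigma> * b^3 * (1 + \<sigma>)) < (1 - \<sigma>) * 2" by linarith
  moreover from this have "\<sigma> \<noteq> 1" by auto
  then have lt: "\<sigma> < 1" using \<sigma> by simp
  ultimately have ii: "\<sigma> * b^3 * (1 + \<sigma>) < 2" by (subst (asm) mult_less_cancel_left_pos) simp_all
  have "b^3 * (\<sigma> * (1 + \<sigma>)) < b^3 * (3 * \<sigma>^2 - 1)" using i ii by (simp add: mult_ac)
  then have "\<sigma> * (1 + \<sigma>) < 3 * \<sigma>^2 - 1" using b by simp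
  then have "0 < (2 * \<sigma> + 1) * (\<sigma> - 1)" by (simp add: algebra_simps power2_eq_square)
  then show False using \<sigma> lt by (simp add: zero_less_mult_iff)
qed

text \<open>The source of the cubic: t diag (w) minus the real part of e times the cyclic form is
  Hermitian, its determinant is a positive multiple of 4 t^3 - S t - Re (e^3), and its leading minor
  involves only one ratio of weights.\<close>

lemma cyclic_form_hermitian:
  fixes w0 w1 w2 t :: real and e x0 x1 x2 :: complex
  assumes w: "0 < w0" "0 < w1" "0 < w2" and e: "cmod e = 1"
  defines "u \<equiv> - e * of_real (w0 / 2)" and "v \<equiv> - e * of_real (w1 / 2)" and "z \<equiv> - e * of_real (w2 / 2)"
  shows "(t * w0) * (t * w1) - (cmod u)^2 = w0 * w1 * (4 * t^2 - w0 / w1) / 4"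
    and "(t * w0) * (t * w1) * (t * w2) + 2 * Re (u * v * z)
      - (t * w0) * (cmod v)^2 - (t * w1) * (cmod z)^2 - (t * w2) * (cmod u)^2
      = w0 * w1 * w2 * (4 * t^3 - (w0 / w1 + w1 / w2 + w2 / w0) * t - Re (e^3)) / 4"
    and "t * w0 * (cmod x0)^2 + t * w1 * (cmod x1)^2 + t * w2 * (cmod x2)^2
      + 2 * Re (u * x1 * cnj x0 + v * x2 * cnj x1 + z * x0 * cnj x2)
      = t * (w0 * (cmod x0)^2 + w1 * (cmod x1)^2 + w2 * (cmod x2)^2)
      - Re (e * (of_real w0 * (x1 * cnj x0) + of_real w1 * (x2 * cnj x1) + of_real w2 * (x0 * cnj x2)))"
proof -
  have norms: "(cmod u)^2 = w0^2 / 4" "(cmod v)^2 = w1^2 / 4" "(cmod z)^2 = w2^2 / 4"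
    using e by (simp_all add: u_def v_def z_def norm_mult power_divide)
  show "(t * w0) * (t * w1) - (cmod u)^2 = w0 * w1 * (4 * t^2 - w0 / w1) / 4"
    unfolding norms using w by (simp add: field_simps power2_eq_square)
  have "Re (u * v * z) = - (w0 * w1 * w2) / 8 * Re (e^3)"
  proof -
    have "u * v * z = of_real (- (w0 * w1 * w2) / 8) * e^3"
      by (simp add: u_def v_def z_def power3_eq_cube)
    then show ?thesis by (simp only: Re_of_real_mult)
  qed
  moreover have "w0 * w1 * w2 * (4 * t^3 - (w0 / w1 + w1 / w2 + w2 / w0) * t - Re (e^3)) / 4
      = (t * w0) * (t * w1) * (t * w2) - (w0 * w1 * w2) * Re (e^3) / 4
       - t * w0 * (w1^2 / 4) - t * w1 * (w2^2 / 4) - t * w2 * (w0^2 / 4)"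
    using w by (simp add: field_simps power2_eq_square power3_eq_cube)
  ultimately show "(t * w0) * (t * w1) * (t * w2) + 2 * Re (u * v * z)
      - (t * w0) * (cmod v)^2 - (t * w1) * (cmod z)^2 - (t * w2) * (cmod u)^2
      = w0 * w1 * w2 * (4 * t^3 - (w0 / w1 + w1 / w2 + w2 / w0) * t - Re (e^3)) / 4"
    unfolding norms by (simp add: mult_ac)
  have "u * x1 * cnj x0 + v * x2 * cnj x1 + z * x0 * cnj x2 =
      of_real (- 1 / 2) * (e * (of_real w0 * (x1 * cnj x0) + of_real w1 * (x2 * cnj x1) + of_real w2 * (x0 * cnj x2)))"
    by (simp add: u_def v_def z_def algebra_simps)
  then have "2 * Re (u * x1 * cnj x0 + v * x2 * cnj x1 + z * x0 * cnj x2) = 2 * (- 1 / 2 *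
      Re (e * (of_real w0 * (x1 * cnj x0) + of_real w1 * (x2 * cnj x1) + of_real w2 * (x0 * cnj x2))))"
    by (simp only: Re_of_real_mult)
  then show "t * w0 * (cmod x0)^2 + t * w1 * (cmod x1)^2 + t * w2 * (cmod x2)^2
      + 2 * Re (u * x1 * cnj x0 + v * x2 * cnj x1 + z * x0 * cnj x2)
      = t * (w0 * (cmod x0)^2 + w1 * (cmod x1)^2 + w2 * (cmod x2)^2)
      - Re (e * (of_real w0 * (x1 * cnj x0) + of_real w1 * (x2 * cnj x1) + of_real w2 * (x0 * cnj x2)))"
    by (simp only: distrib_left mult.assoc) 
qed

lemma cyclic_form_le_strict:
  fixes w0 w1 w2 t :: real and e x0 x1 x2 :: complex
  assumes w: "0 < w0" "0 < w1" "0 < w2" and t: "0 < t" and e: "cmod e = 1"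
    and crit: "w0 / w1 + w1 / w2 + w2 / w0 < 12 * t^2"
    and above: "Re (e^3) < 4 * t^3 - (w0 / w1 + w1 / w2 + w2 / w0) * t"
  shows "Re (e * (of_real w0 * (x1 * cnj x0) + of_real w1 * (x2 * cnj x1) + of_real w2 * (x0 * cnj x2)))
    \<le> t * (w0 * (cmod x0)^2 + w1 * (cmod x1)^2 + w2 * (cmod x2)^2)"
proof -
  note herm = cyclic_form_hermitian[OF w e, of t]
  have "\<bar>Re (e^3)\<bar> \<le> 1" using abs_Re_le_cmod[of "e^3"] e by (simp add: norm_power)
  then have "w0 / w1 < 4 * t^2"
    using w t crit above by (intro ratio_lt_of_top_root[of "w0 / w1" "w1 / w2" "w2 / w0"]) auto
  then have "0 < w0 * w1 * (4 * t^2 - w0 / w1) / 4" using w by simp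
  moreover have "0 \<le> w0 * w1 * w2 * (4 * t^3 - (w0 / w1 + w1 / w2 + w2 / w0) * t - Re (e^3)) / 4"
    using w above by simp
  ultimately show ?thesis
    using hermitian_form_nonneg[of "t * w0" "t * w1" "- e * of_real (w0 / 2)" "t * w2" "- e * of_real (w1 / 2)"
        "- e * of_real (w2 / 2)" x0 x1 x2] w t
    unfolding herm by simp
qed

text \<open>Below the cubic level the determinant is negative, which produces a violating vector. At
  4 t^2 = w0 / w1 the leading minor is zero and the square completion degenerates.\<close>

lemma cyclic_form_gt:
  fixes w0 w1 w2 t :: real and e :: complex
  assumes w: "0 < w0" "0 < w1" "0 < w2" and t: "0 < t" "4 * t^2 \<noteq> w0 / w1" and e: "cmod e = 1"
    and below: "4 * t^3 - (w0 / w1 + w1 / w2 + w2 / w0) * t < Re (e^3)"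
  obtains x0 x1 x2 where "t * (w0 * (cmod x0)^2 + w1 * (cmod x1)^2 + w2 * (cmod x2)^2)
    < Re (e * (of_real w0 * (x1 * cnj x0) + of_real w1 * (x2 * cnj x1) + of_real w2 * (x0 * cnj x2)))"
proof -
  note herm = cyclic_form_hermitian[OF w e, of t]
  have "w0 * w1 * (4 * t^2 - w0 / w1) / 4 \<noteq> 0" using w t by simp
  moreover have "w0 * w1 * w2 * (4 * t^3 - (w0 / w1 + w1 / w2 + w2 / w0) * t - Re (e^3)) / 4 < 0"
    using w below by (simp add: mult_less_0_iff)
  moreover have "0 < t * w0" using w t by simp
  ultimately obtain x0 x1 x2 where
    "t * w0 * (cmod x0)^2 + t * w1 * (cmod x1)^2 + t * w2 * (cmod x2)^2
      + 2 * Re (- e * of_real (w0 / 2) * x1 * cnj x0 + - e * of_real (w1 / 2) * x2 * cnj x1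
        + - e * of_real (w2 / 2) * x0 * cnj x2) < 0"
    using hermitian_form_neg[of "t * w0" "t * w1" "- e * of_real (w0 / 2)" "t * w2" "- e * of_real (w1 / 2)"
        "- e * of_real (w2 / 2)"] unfolding herm by metis
  then show ?thesis using that[of x0 x1 x2] unfolding herm by linarith
qed

text \<open>Equality is reached from s > t, where the strict lemma applies, by letting s decrease to
  t.\<close>

lemma cyclic_form_le:
  fixes w0 w1 w2 t :: real and e x0 x1 x2 :: complex
  assumes w: "0 < w0" "0 < w1" "0 < w2" and t: "0 < t" and e: "cmod e = 1"
    and crit: "w0 / w1 + w1 / w2 + w2 / w0 < 12 * t^2"
    and above: "Re (e^3) \<le> 4 * t^3 - (w0 / w1 + w1 / w2 + w2 / w0) * t"
  shows "Re (e * (of_real w0 * (x1 * cnj x0) + of_real w1 * (x2 * cnj x1) + of_real w2 * (x0 * cnj x2)))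
    \<le> t * (w0 * (cmod x0)^2 + w1 * (cmod x1)^2 + w2 * (cmod x2)^2)" (is "?X \<le> t * ?Y")
proof (rule tendsto_lowerbound[where F = "at_right t"])
  show "((\<lambda>s. s * ?Y) \<longlongrightarrow> t * ?Y) (at_right t)" by (intro tendsto_intros)
  show "\<forall>\<^sub>F s in at_right t. ?X \<le> s * ?Y"
    using eventually_at_right_less[of t]
  proof eventually_elim
    case (elim s)
    define S where "S = w0 / w1 + w1 / w2 + w2 / w0"
    have "t^2 < s^2" using elim t by (intro power_strict_mono) auto
    then have "S < 12 * s^2" using crit by (simp add: S_def)
    moreover have "4 * t^3 - S * t < 4 * s^3 - S * s"
      using cubic_strict_mono[of t s "S / 4"] elim t crit[folded S_def] by simp
    then have "Re (e^3) < 4 * s^3 - S * s" using above unfolding S_def by linarith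
    ultimately show ?case
      using elim t unfolding S_def by (intro cyclic_form_le_strict w e) auto
  qed
qed simp

text \<open>A deficit 4 L - S of the ratio sum allows a smaller multiplier than t in the bound of
  the cyclic form; the reduction is the gain.\<close>

lemma cyclic_form_gap:
  fixes w0 w1 w2 t L :: real and e x0 x1 x2 :: complex
  defines "S \<equiv> w0 / w1 + w1 / w2 + w2 / w0"
  assumes w: "0 < w0" "0 < w1" "0 < w2" and t: "0 < t" "L < 3 * t^2" and e: "cmod e = 1"
    and root: "4 * t^3 - 4 * L * t = Re (e^3)" and S: "S \<le> 4 * L"
  shows "(4 * L - S) / (24 * t) * (w0 * (cmod x0)^2 + w1 * (cmod x1)^2 + w2 * (cmod x2)^2)
    \<le> t * (w0 * (cmod x0)^2 + w1 * (cmod x1)^2 + w2 * (cmod x2)^2)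
      - Re (e * (of_real w0 * (x1 * cnj x0) + of_real w1 * (x2 * cnj x1) + of_real w2 * (x0 * cnj x2)))"
proof -
  \<comment> \<open>With 24 t \<epsilon> = 4 L - S, the cubic 4 s^3 - S s at s = t - \<epsilon> is
    still at least Re (e^3), and s still lies beyond its critical point (S < 12 s^2).\<close>
  define \<epsilon> where "\<epsilon> = (4 * L - S) / (24 * t)"
  define s where "s = t - \<epsilon>"
  have \<epsilon>: "0 \<le> \<epsilon>" "24 * t * \<epsilon> = 4 * L - S" using t S by (simp_all add: \<epsilon>_def)
  have S_pos: "0 < S" using w by (simp add: S_def add_pos_pos)
  have st: "24 * t * s = 24 * t^2 - 4 * L + S" using \<epsilon> by (simp add: s_def algebra_simps power2_eq_square)
  moreover have "0 < t^2" using t by simp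
  ultimately have "0 < 24 * t * s" using t(2) S_pos by linarith
  then have s: "0 < s" using t by (simp add: zero_less_mult_iff)
  have "S < 12 * s^2"
  proof -
    have "(12 * t^2 + S)^2 < (24 * t * s)^2"
      unfolding st using t S_pos by (intro power_strict_mono) auto
    moreover have "48 * t^2 * S \<le> (12 * t^2 + S)^2"
      using zero_le_power2[of "12 * t^2 - S"] by (simp add: power2_eq_square algebra_simps)
    moreover have "(24 * t * s)^2 = 48 * t^2 * (12 * s^2)" by (simp add: power_mult_distrib)
    ultimately have "48 * t^2 * S < 48 * t^2 * (12 * s^2)" by linarith
    then show ?thesis using t by simp
  qed
  moreover have "Re (e^3) \<le> 4 * s^3 - S * s"
  proof -
    have "\<epsilon> \<le> t" using s by (simp add: s_def)
    then have "\<epsilon> * (\<epsilon> * \<epsilon>) \<le> t * (\<epsilon> * \<epsilon>)" using \<epsilon> by (intro mult_right_mono) auto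
    moreover have "0 \<le> t * (\<epsilon> * \<epsilon>)" "0 \<le> t * t * \<epsilon>" "0 \<le> S * \<epsilon>" using t \<epsilon> S_pos by auto
    moreover have "4 * s^3 - S * s = Re (e^3) + 12 * (t * t * \<epsilon>) + 12 * (t * (\<epsilon> * \<epsilon>)) - 4 * (\<epsilon> * (\<epsilon> * \<epsilon>)) + S * \<epsilon>"
    proof -
      have S_eq: "S = 4 * L - 24 * t * \<epsilon>" using \<epsilon>(2) by simp
      show ?thesis unfolding s_def root[symmetric] S_eq by algebra
    qed
    ultimately show ?thesis by linarith
  qed
  ultimately have "Re (e * (of_real w0 * (x1 * cnj x0) + of_real w1 * (x2 * cnj x1) + of_real w2 * (x0 * cnj x2)))
    \<le> s * (w0 * (cmod x0)^2 + w1 * (cmod x1)^2 + w2 * (cmod x2)^2)"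
    unfolding S_def by (intro cyclic_form_le w s e)
  then show ?thesis unfolding \<epsilon>_def[symmetric] s_def by (simp add: algebra_simps)
qed

text \<open>The quadratic equation for L, solved: after multiplication by (1 - \<Delta>^2) (1 - 4
  \<Delta>^2) everything is polynomial in \<Delta> and s with s^2 = 3 - 3 \<Delta>^2. The plus sign
  of the square root makes E positive, and E > 0 in turn gives L > 3/4.\<close>

lemma extremal_constant:
  fixes \<Delta> L :: real
  assumes \<Delta>: "0 < \<Delta>" "\<Delta> < 1/2"
    and L: "L = (3 + 6 * \<Delta>^3 * sqrt (3 - 3 * \<Delta>^2) - 6 * \<Delta>^4 - 6 * \<Delta>^2) / (4 * (1 - \<Delta>^2) * (1 - 4 * \<Delta>^2))"
  defines "E \<equiv> 4 * L * (1 - 3 * \<Delta>^2) - 3"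
  shows "0 < E" "3/4 < L" "E^2 = \<Delta>^6 * (64 * L^2 + 48 * L + 36)"
proof -
  define s where "s = sqrt (3 - 3 * \<Delta>^2)"
  have "\<Delta>^2 < (1/2)^2" using \<Delta> by (intro power_strict_mono) auto
  then have \<Delta>2: "\<Delta>^2 < 1/4" by (simp add: power2_eq_square)
  then have s: "s^2 = 3 - 3 * \<Delta>^2" "0 < s" by (simp_all add: s_def)
  define Q where "Q = (1 - \<Delta>^2) * (1 - 4 * \<Delta>^2)"
  have Q: "0 < Q" using \<Delta>2 by (simp add: Q_def)
  have "L = (3 + 6 * \<Delta>^3 * s - 6 * \<Delta>^4 - 6 * \<Delta>^2) / (4 * Q)" unfolding L s_def Q_def by (simp add: mult.assoc)
  then have LQ: "4 * Q * L = 3 + 6 * \<Delta>^3 * s - 6 * \<Delta>^4 - 6 * \<Delta>^2" using Q by simp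
  have "Q * E = 18 * \<Delta>^6 + 6 * \<Delta>^3 * s * (1 - 3 * \<Delta>^2)"
  proof -
    have "Q * E = 4 * Q * L * (1 - 3 * \<Delta>^2) - 3 * Q" unfolding E_def by algebra
    also have "\<dots> = 18 * \<Delta>^6 + 6 * \<Delta>^3 * s * (1 - 3 * \<Delta>^2)" unfolding LQ unfolding Q_def by algebra
    finally show ?thesis .
  qed
  moreover have "0 < 18 * \<Delta>^6 + 6 * \<Delta>^3 * s * (1 - 3 * \<Delta>^2)"
    using \<Delta> \<Delta>2 s by (intro add_pos_pos mult_pos_pos) auto
  ultimately show E: "0 < E" using Q by (metis zero_less_mult_pos)
  then have "3 < 4 * L * (1 - 3 * \<Delta>^2)" by (simp add: E_def)
  moreover have "0 < 1 - 3 * \<Delta>^2" "1 - 3 * \<Delta>^2 \<le> 1" using \<Delta>2 by auto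
  ultimately have "0 < L" by (smt (verit) mult_le_0_iff)
  then have "4 * L * (1 - 3 * \<Delta>^2) \<le> 4 * L * 1" using \<open>1 - 3 * \<Delta>^2 \<le> 1\<close> by (intro mult_left_mono) auto
  then show "3/4 < L" using \<open>3 < 4 * L * (1 - 3 * \<Delta>^2)\<close> by simp
  have "Q^2 * (E^2 - \<Delta>^6 * (64 * L^2 + 48 * L + 36)) = 0"
  proof -
    have "Q^2 * (E^2 - \<Delta>^6 * (64 * L^2 + 48 * L + 36)) =
        ((4 * Q * L) * (1 - 3 * \<Delta>^2) - 3 * Q)^2 - \<Delta>^6 * (4 * (4 * Q * L)^2 + 12 * (4 * Q * L) * Q + 36 * Q^2)"
      unfolding E_def by algebra
    also have "\<dots> = 0" unfolding LQ unfolding Q_def using s(1) by algebra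
    finally show ?thesis .
  qed
  then show "E^2 = \<Delta>^6 * (64 * L^2 + 48 * L + 36)" using Q by simp
qed

text \<open>The weights \<open>d\<^sub>k\<close> are the reciprocals, up to a common factor, of the values of the Poisson
  kernel on a fibre of the cubing map.\<close>

lemma fibre_ratio_sum:
  fixes l \<tau> :: complex and \<Delta> L :: real
  assumes l: "l^3 = 1" "l \<noteq> 1" "cmod l = 1" and \<tau>: "cmod \<tau> = 1"
    and E: "E = 4 * L * (1 - 3 * \<Delta>^2) - 3" "0 < E" "E^2 = \<Delta>^6 * (64 * L^2 + 48 * L + 36)"
    and \<zeta>0: "\<zeta>0 = cnj (of_real (\<Delta>^3) * (8 * of_real L - 6 * l)) / of_real E"
    and d: "d0 = 1 - 2 * \<Delta> * Re \<tau>" "d1 = 1 - 2 * \<Delta> * Re (l * \<tau>)" "d2 = 1 - 2 * \<Delta> * Re (l^2 * \<tau>)"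
  shows "4 * L * (d0 * d1 * d2) - (d1 * d1 * d2 + d2 * d2 * d0 + d0 * d0 * d1) = E / 2 * (cmod (\<tau>^3 - \<zeta>0))^2"
    and "cmod \<zeta>0 = 1"
proof -
  have ll: "1 + l + l^2 = 0"
  proof -
    have "(l - 1) * (1 + l + l^2) = 0" using l(1) by algebra
    then show ?thesis using l(2) by simp
  qed
  have lc: "cnj l = l^2"
  proof -
    have "l * cnj l = 1" using l(3) by (simp add: complex_norm_square[symmetric])
    then have "l^2 * (l * cnj l) = l^2" by simp
    then show ?thesis using l(1) by algebra
  qed
  have tc: "\<tau> * cnj \<tau> = 1" using \<tau> by (simp add: complex_norm_square[symmetric])
  \<comment> \<open>Up to the factor - 1/2 this is the coefficient of \<tau>^3 in the difference to
    be computed; |c| = E is what turns the difference into a multiple of a square.\<close>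
  define c where "c = of_real (\<Delta>^3) * (8 * of_real L - 6 * l)"
  have "c * cnj c = of_real (E^2)"
    unfolding E(3) c_def complex_cnj_mult complex_cnj_diff complex_cnj_complex_of_real lc complex_cnj_numeral
    using ll l(1) by (simp only: of_real_mult of_real_power of_real_add of_real_numeral) algebra
  then have cc: "c * cnj c = of_real E * of_real E" by (simp add: power2_eq_square)
  then have "of_real ((cmod c)^2) = complex_of_real (E^2)" unfolding complex_norm_square cc by (simp add: power2_eq_square)
  then have "(cmod c)^2 = E^2" by (simp only: of_real_eq_iff)
  then have "cmod c = E" using E(2) by (simp add: power2_eq_iff_nonneg)
  moreover have z0: "\<zeta>0 = cnj c / of_real E" unfolding \<zeta>0 c_def ..
  ultimately show "cmod \<zeta>0 = 1" using E(2) by (simp add: norm_divide)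
  have Re: "2 * of_real (Re z) = z + cnj z" for z using complex_add_cnj[of z] by simp
  have d0: "of_real d0 = 1 - of_real \<Delta> * (\<tau> + cnj \<tau>)"
    unfolding d(1) Re[symmetric] by (simp add: mult_ac)
  have d1: "of_real d1 = 1 - of_real \<Delta> * (l * \<tau> + l^2 * cnj \<tau>)"
  proof -
    have "of_real d1 = 1 - of_real \<Delta> * (l * \<tau> + cnj (l * \<tau>))" unfolding d(2) Re[symmetric] by (simp add: mult_ac)
    then show ?thesis by (simp add: lc)
  qed
  have d2: "of_real d2 = 1 - of_real \<Delta> * (l^2 * \<tau> + l * cnj \<tau>)"
  proof -
    have "of_real d2 = 1 - of_real \<Delta> * (l^2 * \<tau> + cnj (l^2 * \<tau>))" unfolding d(3) Re[symmetric] by (simp add: mult_ac)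
    moreover have "cnj (l^2) = l" unfolding complex_cnj_power lc using l(1) by algebra
    ultimately show ?thesis by simp
  qed
  have "of_real (E / 2 * (cmod (\<tau>^3 - \<zeta>0))^2) = of_real E / 2 * ((\<tau>^3 - cnj c / of_real E) * (cnj \<tau>^3 - c / of_real E))"
    by (simp only: of_real_mult complex_norm_square of_real_divide of_real_numeral z0) simp
  also have "\<dots> = (2 * of_real E - c * \<tau>^3 - cnj c * cnj \<tau>^3) / 2"
  proof -
    have "\<tau>^3 * cnj \<tau>^3 = 1" using tc by (simp flip: power_mult_distrib)
    then show ?thesis using E(2) cc by (simp add: field_simps)
  qed
  also have "\<dots> = of_real (4 * L * (d0 * d1 * d2) - (d1 * d1 * d2 + d2 * d2 * d0 + d0 * d0 * d1))"
  proof -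
    have cl: "cnj c = of_real (\<Delta>^3) * (8 * of_real L - 6 * l^2)"
      by (simp add: c_def lc)
    have Ec: "complex_of_real E = 4 * of_real L * (1 - 3 * of_real \<Delta>^2) - 3" by (simp add: E(1))
    have "2 * of_real E - c * \<tau>^3 - cnj c * cnj \<tau>^3
      = 2 * (4 * of_real L * (of_real d0 * of_real d1 * of_real d2) - (of_real d1 * of_real d1 * of_real d2
        + of_real d2 * of_real d2 * of_real d0 + of_real d0 * of_real d0 * of_real d1))"
      unfolding cl unfolding d0 d1 d2 Ec c_def of_real_power using tc ll l(1) by algebra
    then show ?thesis by simp
  qed
  finally show "4 * L * (d0 * d1 * d2) - (d1 * d1 * d2 + d2 * d2 * d0 + d0 * d0 * d1) = E / 2 * (cmod (\<tau>^3 - \<zeta>0))^2"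
    by (simp only: of_real_eq_iff)
qed

section \<open>Rotations of order three\<close>

locale order_three_rotation =
  fixes a l :: complex and \<Delta> L :: real
  assumes a: "cmod a < 1" "a \<noteq> 0"
    and l: "l^3 = 1" "l \<noteq> 1"
    and \<Delta>: "\<Delta> = cmod a / (1 + (cmod a)^2)"
    and L: "L = (3 + 6 * \<Delta>^3 * sqrt (3 - 3 * \<Delta>^2) - 6 * \<Delta>^4 - 6 * \<Delta>^2) / (4 * (1 - \<Delta>^2) * (1 - 4 * \<Delta>^2))"
begin

definition rot :: "complex \<Rightarrow> complex" where
  "rot z = mobius a (l * mobius a z)"

definition E :: real where "E = 4 * L * (1 - 3 * \<Delta>^2) - 3"

definition \<zeta>0 :: complex where
  "\<zeta>0 = cnj (of_real (\<Delta>^3) * (8 * of_real L - 6 * l)) / of_real E"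

definition u :: complex where "u = a / of_real (cmod a)"

definition K :: real where "K = (1 - (cmod a)^2) / (1 + (cmod a)^2)"

definition wt :: "complex \<Rightarrow> real" where "wt \<tau> = 1 - 2 * \<Delta> * Re \<tau>"

lemma l_norm: "cmod l = 1"
proof -
  have "cmod l^3 = 1" using l(1) by (metis norm_one norm_power)
  then show ?thesis using power_eq_imp_eq_base[of "cmod l" 3 1] by simp
qed

lemma u_norm: "cmod u = 1" using a by (simp add: u_def norm_divide)

lemma \<Delta>_bounds: "0 < \<Delta>" "\<Delta> < 1/2"
proof -
  have s: "0 < 1 + (cmod a)^2" by (simp add: add_pos_nonneg)
  show "0 < \<Delta>" using a s by (simp add: \<Delta>)
  have "0 < (1 - cmod a)^2" using a by simp
  then have "2 * cmod a < 1 + (cmod a)^2" by (simp add: power2_diff)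
  then show "\<Delta> < 1/2" using s by (simp add: \<Delta> field_simps)
qed

lemma E_pos: "0 < E" and L_gt: "3/4 < L" and E_sq: "E^2 = \<Delta>^6 * (64 * L^2 + 48 * L + 36)"
  using extremal_constant[OF \<Delta>_bounds L] by (simp_all add: E_def)

lemma K_pos: "0 < K"
  using a by (simp add: K_def power_less_one_iff add_pos_nonneg)

lemma wt_bounds:
  assumes "cmod \<tau> = 1"
  shows "1 - 2 * \<Delta> \<le> wt \<tau>" "wt \<tau> \<le> 2" "0 < wt \<tau>"
proof -
  have "\<bar>Re \<tau>\<bar> \<le> 1" using abs_Re_le_cmod[of \<tau>] assms by simp
  then have "2 * \<Delta> * Re \<tau> \<le> 2 * \<Delta> * 1" "2 * \<Delta> * (- 1) \<le> 2 * \<Delta> * Re \<tau>"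
    using \<Delta>_bounds by (intro mult_left_mono; simp)+
  then show "1 - 2 * \<Delta> \<le> wt \<tau>" "wt \<tau> \<le> 2" "0 < wt \<tau>"
    using \<Delta>_bounds unfolding wt_def by linarith+
qed

text \<open>On the circle |1 - cnj a \<zeta>|^2 = (1 + |a|^2) (1 - 2 \<Delta> Re (cnj u \<zeta>)).
  This is where \<Delta> comes from; the direction u of a only rotates the parameter.\<close>

lemma poisson_eq_wt:
  assumes "cmod \<zeta> = 1"
  shows "poisson a \<zeta> = K / wt (cnj u * \<zeta>)"
proof -
  have s: "0 < 1 + (cmod a)^2" by (simp add: add_pos_nonneg)
  have z: "(Re \<zeta>)^2 + (Im \<zeta>)^2 = 1" using assms by (simp add: cmod_power2[symmetric])
  have "(cmod (1 - cnj a * \<zeta>))^2 = 1 + (cmod a)^2 * ((Re \<zeta>)^2 + (Im \<zeta>)^2) - 2 * Re (cnj a * \<zeta>)"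
    unfolding cmod_power2 by (simp add: power2_eq_square algebra_simps)
  then have den: "(cmod (1 - cnj a * \<zeta>))^2 = 1 + (cmod a)^2 - 2 * Re (cnj a * \<zeta>)" by (simp add: z)
  have "cnj a * \<zeta> = of_real (cmod a) * (cnj u * \<zeta>)" using a by (simp add: u_def)
  then have "Re (cnj a * \<zeta>) = cmod a * Re (cnj u * \<zeta>)" by (simp only: Re_of_real_mult)
  then have "(cmod (1 - cnj a * \<zeta>))^2 = (1 + (cmod a)^2) * wt (cnj u * \<zeta>)"
  proof -
    assume Re: "Re (cnj a * \<zeta>) = cmod a * Re (cnj u * \<zeta>)"
    have "(1 + (cmod a)^2) * \<Delta> = cmod a" unfolding \<Delta> using s by simp
    moreover have "(1 + (cmod a)^2) * (1 - 2 * \<Delta> * Re (cnj u * \<zeta>))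
        = 1 + (cmod a)^2 - 2 * ((1 + (cmod a)^2) * \<Delta>) * Re (cnj u * \<zeta>)"
      by (simp only: ring_distribs mult_ac mult_1_right)
    ultimately show ?thesis unfolding den wt_def Re by (simp only: mult.assoc)
  qed
  then show ?thesis using s by (simp add: poisson_def K_def)
qed

lemma poisson_bounds:
  assumes "cmod \<zeta> = 1"
  shows "K / 2 \<le> poisson a \<zeta>" "poisson a \<zeta> \<le> K / (1 - 2 * \<Delta>)"
proof -
  have "cmod (cnj u * \<zeta>) = 1" using assms u_norm by (simp add: norm_mult)
  note b = wt_bounds[OF this]
  show "K / 2 \<le> poisson a \<zeta>"
    unfolding poisson_eq_wt[OF assms] using b(2,3) K_pos by (intro frac_le) auto
  show "poisson a \<zeta> \<le> K / (1 - 2 * \<Delta>)"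
    unfolding poisson_eq_wt[OF assms] using b(1) K_pos \<Delta>_bounds by (intro frac_le) auto
qed

text \<open>The off-diagonal sum of the fibre form; its maximum over the circle is \<open>4 * L\<close>.\<close>

definition ratio_sum :: "complex \<Rightarrow> real" where
  "ratio_sum \<zeta> = poisson a \<zeta> / poisson a (l * \<zeta>) + poisson a (l * \<zeta>) / poisson a (l^2 * \<zeta>)
     + poisson a (l^2 * \<zeta>) / poisson a \<zeta>"

lemma \<zeta>0_norm: "cmod \<zeta>0 = 1"
  using fibre_ratio_sum(2)[OF l l_norm norm_one E_def E_pos E_sq \<zeta>0_def] by blast

text \<open>The product of the three weights is at most 8, so dividing the square identity by it
  turns E / 2 into E / 16.\<close>

lemma ratio_sum_gap:
  assumes "cmod \<zeta> = 1"
  shows "E / 16 * (cmod ((cnj u * \<zeta>)^3 - \<zeta>0))^2 \<le> 4 * L - ratio_sum \<zeta>"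
    and "(cnj u * \<zeta>)^3 = \<zeta>0 \<Longrightarrow> ratio_sum \<zeta> = 4 * L"
proof -
  define \<tau> where "\<tau> = cnj u * \<zeta>"
  have \<tau>: "cmod \<tau> = 1" using assms u_norm by (simp add: \<tau>_def norm_mult)
  define d0 d1 d2 where "d0 = wt \<tau>" and "d1 = wt (l * \<tau>)" and "d2 = wt (l^2 * \<tau>)"
  have d: "0 < d0" "0 < d1" "0 < d2" "d0 \<le> 2" "d1 \<le> 2" "d2 \<le> 2"
    unfolding d0_def d1_def d2_def using \<tau> l_norm by (auto intro!: wt_bounds simp: norm_mult norm_power)
  have w: "poisson a \<zeta> = K / d0" "poisson a (l * \<zeta>) = K / d1" "poisson a (l^2 * \<zeta>) = K / d2"
    using assms l_norm by (simp_all add: poisson_eq_wt norm_mult norm_power d0_def d1_def d2_def \<tau>_def mult_ac)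
  have "ratio_sum \<zeta> = d1 / d0 + d2 / d1 + d0 / d2"
    using K_pos d by (simp add: ratio_sum_def w)
  then have "(4 * L - ratio_sum \<zeta>) * (d0 * d1 * d2) = 4 * L * (d0 * d1 * d2) - (d1 * d1 * d2 + d2 * d2 * d0 + d0 * d0 * d1)"
    using d by (simp add: field_simps)
  also have "\<dots> = E / 2 * (cmod (\<tau>^3 - \<zeta>0))^2"
    by (rule fibre_ratio_sum(1)[OF l l_norm \<tau> E_def E_pos E_sq \<zeta>0_def]) (simp_all add: d0_def d1_def d2_def wt_def)
  finally have eq: "(4 * L - ratio_sum \<zeta>) * (d0 * d1 * d2) = E / 2 * (cmod (\<tau>^3 - \<zeta>0))^2" .
  have ddd: "0 < d0 * d1 * d2" using d by simp
  have "0 \<le> E / 2 * (cmod (\<tau>^3 - \<zeta>0))^2" using E_pos by simp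
  then have nn: "0 \<le> 4 * L - ratio_sum \<zeta>" unfolding eq[symmetric] using ddd by (simp add: zero_le_mult_iff)
  have "d0 * d1 \<le> 2 * 2" using d by (intro mult_mono) auto
  then have "d0 * d1 * d2 \<le> (2 * 2) * 2" using d by (intro mult_mono) auto
  then have "E / 2 * (cmod (\<tau>^3 - \<zeta>0))^2 \<le> (4 * L - ratio_sum \<zeta>) * 8"
    unfolding eq[symmetric] using nn by (intro mult_left_mono) auto
  then show "E / 16 * (cmod ((cnj u * \<zeta>)^3 - \<zeta>0))^2 \<le> 4 * L - ratio_sum \<zeta>" by (simp add: \<tau>_def)
  show "ratio_sum \<zeta> = 4 * L" if "(cnj u * \<zeta>)^3 = \<zeta>0"
    using eq that ddd by (auto simp: \<tau>_def)
qed

text \<open>The constant is 768 = 16 * 24 * 2: the gap of the ratio sum, the reduction in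
  \<open>cyclic_form_gap\<close>, and the lower bound K / 2 of the Poisson kernel.\<close>

lemma fibre_gap:
  assumes \<zeta>: "cmod \<zeta> = 1" and e: "cmod e = 1" and t: "0 < t" "L < 3 * t^2"
    and root: "4 * t^3 - 4 * L * t = Re (e^3)"
  shows "E * K / (768 * t) * (cmod ((cnj u * \<zeta>)^3 - \<zeta>0))^2 * ((cmod x0)^2 + (cmod x1)^2 + (cmod x2)^2)
    \<le> t * (poisson a \<zeta> * (cmod x0)^2 + poisson a (l * \<zeta>) * (cmod x1)^2 + poisson a (l^2 * \<zeta>) * (cmod x2)^2)
      - Re (e * (of_real (poisson a \<zeta>) * (x1 * cnj x0) + of_real (poisson a (l * \<zeta>)) * (x2 * cnj x1)
        + of_real (poisson a (l^2 * \<zeta>)) * (x0 * cnj x2)))"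
proof -
  define q where "q = (cmod ((cnj u * \<zeta>)^3 - \<zeta>0))^2"
  have norms: "cmod (l * \<zeta>) = 1" "cmod (l^2 * \<zeta>) = 1" using \<zeta> l_norm by (simp_all add: norm_mult norm_power)
  have w: "0 < poisson a \<zeta>" "0 < poisson a (l * \<zeta>)" "0 < poisson a (l^2 * \<zeta>)"
    using \<zeta> norms by (auto intro!: poisson_pos a)
  define Y where "Y = poisson a \<zeta> * (cmod x0)^2 + poisson a (l * \<zeta>) * (cmod x1)^2 + poisson a (l^2 * \<zeta>) * (cmod x2)^2"
  have gap: "E / 16 * q \<le> 4 * L - ratio_sum \<zeta>" using ratio_sum_gap(1)[OF \<zeta>] by (simp add: q_def)
  have Eq: "0 \<le> E / 16 * q" using E_pos by (simp add: q_def)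
  have "K / 2 * (cmod x0)^2 + K / 2 * (cmod x1)^2 + K / 2 * (cmod x2)^2 \<le> Y"
    unfolding Y_def by (intro add_mono mult_right_mono poisson_bounds \<zeta> norms) auto
  then have Y: "K / 2 * ((cmod x0)^2 + (cmod x1)^2 + (cmod x2)^2) \<le> Y" by (simp add: distrib_left)
  have "E * K / (768 * t) * q * ((cmod x0)^2 + (cmod x1)^2 + (cmod x2)^2)
      = (E / 16 * q / (24 * t)) * (K / 2 * ((cmod x0)^2 + (cmod x1)^2 + (cmod x2)^2))"
    by simp
  also have "\<dots> \<le> ((4 * L - ratio_sum \<zeta>) / (24 * t)) * Y"
    using gap Y Eq t K_pos by (intro mult_mono divide_right_mono) auto
  also have "\<dots> \<le> t * Y - Re (e * (of_real (poisson a \<zeta>) * (x1 * cnj x0) + of_real (poisson a (l * \<zeta>)) * (x2 * cnj x1)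
        + of_real (poisson a (l^2 * \<zeta>)) * (x0 * cnj x2)))"
    unfolding Y_def ratio_sum_def
    by (rule cyclic_form_gap[OF w t e root]) (use gap Eq in \<open>simp add: ratio_sum_def\<close>)
  finally show ?thesis unfolding q_def Y_def .
qed

lemma fibre_attained:
  assumes e: "cmod e = 1" and t: "0 < t" "L < 3 * t^2" and root: "4 * t^3 - 4 * L * t = Re (e^3)" and s: "s < t"
    and \<zeta>: "cmod \<zeta> = 1" "(cnj u * \<zeta>)^3 = \<zeta>0"
  obtains x0 x1 x2 where
    "s * (poisson a \<zeta> * (cmod x0)^2 + poisson a (l * \<zeta>) * (cmod x1)^2 + poisson a (l^2 * \<zeta>) * (cmod x2)^2)
      < Re (e * (of_real (poisson a \<zeta>) * (x1 * cnj x0) + of_real (poisson a (l * \<zeta>)) * (x2 * cnj x1)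
        + of_real (poisson a (l^2 * \<zeta>)) * (x0 * cnj x2)))"
proof -
  have w: "0 < poisson a \<zeta>" "0 < poisson a (l * \<zeta>)" "0 < poisson a (l^2 * \<zeta>)"
    using \<zeta> l_norm by (auto intro!: poisson_pos a simp: norm_mult norm_power)
  define A where "A = poisson a \<zeta> / poisson a (l * \<zeta>)"
  \<comment> \<open>To the right of sqrt (L / 3) the cubic increases strictly up to its root
    t.\<close>
  define r where "r = max s (sqrt (L / 3))"
  have rL: "sqrt (L / 3) < t" using t by (intro real_less_lsqrt) auto
  then have r: "r < t" using s by (simp add: r_def)
  obtain r' where r': "r < r'" "r' < t" "4 * r'^2 \<noteq> A"
  proof -
    \<comment> \<open>Two candidates, at least one of which avoids the value where the leading minor
      is zero.\<close>
    define p1 p2 where "p1 = r + (t - r) / 3" and "p2 = r + 2 * (t - r) / 3"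
    have p: "r < p1" "p1 < p2" "p2 < t" using r by (auto simp: p1_def p2_def field_simps)
    have "0 \<le> r" using L_gt by (auto simp: r_def le_max_iff_disj)
    then have "p1^2 < p2^2" using p by (intro power_strict_mono) auto
    then have "4 * p1^2 \<noteq> A \<or> 4 * p2^2 \<noteq> A" by auto
    then show ?thesis using p that[of p1] that[of p2] by auto
  qed
  have "sqrt (L / 3) < r'" using r'(1) by (simp add: r_def)
  moreover have pos: "0 < sqrt (L / 3)" using L_gt by simp
  ultimately have r'0: "0 < r'" by linarith
  have "(sqrt (L / 3))^2 < r'^2"
    using \<open>sqrt (L / 3) < r'\<close> less_imp_le[OF pos] by (rule power_strict_mono) simp
  then have "L < 3 * r'^2" using L_gt by simp
  then have "4 * r'^3 - 4 * L * r' < Re (e^3)"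
    using cubic_strict_mono[OF r'(2) r'0, of L] root by simp
  then have below: "4 * r'^3 - ratio_sum \<zeta> * r' < Re (e^3)"
    using ratio_sum_gap(2)[OF \<zeta>] by simp
  obtain x0 x1 x2 where x: "r' * (poisson a \<zeta> * (cmod x0)^2 + poisson a (l * \<zeta>) * (cmod x1)^2 + poisson a (l^2 * \<zeta>) * (cmod x2)^2)
      < Re (e * (of_real (poisson a \<zeta>) * (x1 * cnj x0) + of_real (poisson a (l * \<zeta>)) * (x2 * cnj x1)
        + of_real (poisson a (l^2 * \<zeta>)) * (x0 * cnj x2)))"
    by (rule cyclic_form_gt[OF w r'0 r'(3)[unfolded A_def] e below[unfolded ratio_sum_def]])
  have "s \<le> r'" using r'(1) by (simp add: r_def)
  then have "s * (poisson a \<zeta> * (cmod x0)^2 + poisson a (l * \<zeta>) * (cmod x1)^2 + poisson a (l^2 * \<zeta>) * (cmod x2)^2)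
      \<le> r' * (poisson a \<zeta> * (cmod x0)^2 + poisson a (l * \<zeta>) * (cmod x1)^2 + poisson a (l^2 * \<zeta>) * (cmod x2)^2)"
    using w by (intro mult_right_mono add_nonneg_nonneg mult_nonneg_nonneg) auto
  from le_less_trans[OF this x] show ?thesis by (rule that)
qed

end

section \<open>Dilations, and the fibre decomposition of the form\<close>

lemma disc_algebra_mult:
  assumes "f \<in> disc_algebra" "g \<in> disc_algebra"
  shows "(\<lambda>z. f z * g z) \<in> disc_algebra"
  using assms by (auto simp: disc_algebra_def intro!: continuous_intros holomorphic_intros)

lemma disc_algebra_dilation:
  assumes f: "f holomorphic_on ball 0 1" and r: "0 \<le> r" "r < 1"
  shows "(\<lambda>z. f (of_real r * z)) \<in> disc_algebra"
proof -
  have lt: "cmod (of_real r * z) < 1" if "cmod z \<le> 1" for z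
    using r that mult_left_mono[of "cmod z" 1 r] by (simp add: norm_mult)
  have "continuous_on (cball 0 1) (\<lambda>z. f (of_real r * z))"
    by (rule continuous_on_compose2[OF holomorphic_on_imp_continuous_on[OF f]])
      (use lt in \<open>auto intro!: continuous_intros\<close>)
  moreover have "(\<lambda>z. f (of_real r * z)) holomorphic_on ball 0 1"
    by (rule holomorphic_on_compose_gen[OF _ f, unfolded o_def])
      (use lt in \<open>auto intro!: holomorphic_intros\<close>)
  ultimately show ?thesis by (simp add: disc_algebra_def)
qed

lemma circle_inner_dilation: "circle_inner (\<lambda>z. f (of_real r * z)) (\<lambda>z. f (of_real r * z)) 1 = circle_inner f f r"
  by (simp add: circle_inner_def)

lemma sq_norm_eq_circle_inner:
  assumes "f \<in> disc_algebra"
  shows "sq_norm f = Re (circle_inner f f 1)"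
  using hardy_inner_disc_algebra[OF assms assms] hardy_inner_self assms disc_algebra_subset_hardy_space
  by (metis Re_complex_of_real subsetD)

lemma sq_norm_dilation:
  assumes f: "f \<in> hardy_space" and r: "0 < r" "r < 1"
  shows "sq_norm (\<lambda>z. f (of_real r * z)) \<le> sq_norm f"
  using sq_norm_eq_circle_inner[OF disc_algebra_dilation[OF hardy_space_holomorphic[OF f], of r]] r
    circle_norm_le_sq_norm[OF f r] by (simp add: circle_inner_dilation)

text \<open>For |z| = s < 1 the point r \<psi> z stays in the open disc for all r in [0, 1], so the
  integrand is jointly continuous up to r = 1. Used for the rotation with q = 1, and for
  \<open>mobius a\<close> with the gap factor as q.\<close>

lemma circle_inner_dilation_tendsto:
  assumes f: "f holomorphic_on ball 0 1" and \<psi>: "continuous_on (cball 0 1) \<psi>" "\<And>z. cmod z < 1 \<Longrightarrow> cmod (\<psi> z) < 1"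
    and q: "continuous_on (cball 0 1) q" and s: "0 < s" "s < 1"
  defines "G \<equiv> \<lambda>r z. q z * f (of_real r * \<psi> z)"
  shows "((\<lambda>r::real. Re (circle_inner (G r) (G r) s)) \<longlongrightarrow> Re (circle_inner (G 1) (G 1) s)) (at_left 1)"
proof -
  have in_cball: "of_real s * cis t \<in> cball 0 1" and in_ball: "cmod (of_real s * cis t) < 1" for t
    using s by (auto simp: norm_mult)
  have lt: "cmod (of_real r * \<psi> (of_real s * cis t)) < 1" if "r \<in> {0..1}" for r t
  proof -
    have "cmod (of_real r * \<psi> (of_real s * cis t)) \<le> cmod (\<psi> (of_real s * cis t))"
      using that by (simp add: norm_mult mult_left_le_one_le)
    then show ?thesis using \<psi>(2)[OF in_ball] by (rule le_less_trans)
  qed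
  have c\<psi>: "continuous_on ({0..1} \<times> cbox 0 (2*pi)) (\<lambda>p::real\<times>real. \<psi> (of_real s * cis (snd p)))"
    by (rule continuous_on_compose2[OF \<psi>(1)]) (use in_cball in \<open>auto intro!: continuous_intros\<close>)
  have "continuous_on ({0..1} \<times> cbox 0 (2*pi)) (\<lambda>p::real\<times>real. f (of_real (fst p) * \<psi> (of_real s * cis (snd p))))"
  proof (rule continuous_on_compose2[OF holomorphic_on_imp_continuous_on[OF f]])
    show "continuous_on ({0..1} \<times> cbox 0 (2*pi)) (\<lambda>p::real\<times>real. of_real (fst p) * \<psi> (of_real s * cis (snd p)))"
      by (intro continuous_intros c\<psi>)
  qed (use lt in auto)
  moreover have "continuous_on ({0..1} \<times> cbox 0 (2*pi)) (\<lambda>p::real\<times>real. q (of_real s * cis (snd p)))"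
    by (rule continuous_on_compose2[OF q]) (use in_cball in \<open>auto intro!: continuous_intros\<close>)
  ultimately have "continuous_on ({0..1} \<times> cbox 0 (2*pi)) (\<lambda>p::real\<times>real.
      G (fst p) (of_real s * cis (snd p)) * cnj (G (fst p) (of_real s * cis (snd p))))"
    unfolding G_def by (intro continuous_intros)
  then have "continuous_on ({0..1} \<times> cbox 0 (2*pi)) (\<lambda>(r, t).
      G r (of_real s * cis t) * cnj (G r (of_real s * cis t)))"
    by (simp add: case_prod_unfold)
  from integral_continuous_on_param[OF this]
  have "continuous_on {0..1} (\<lambda>r. Re (integral {0..2*pi} (\<lambda>t. G r (of_real s * cis t) * cnj (G r (of_real s * cis t))) / (2 * of_real pi)))"
    by (intro continuous_intros) auto
  then have "((\<lambda>r::real. Re (circle_inner (G r) (G r) s)) \<longlongrightarrow> Re (circle_inner (G 1) (G 1) s)) (at 1 within {0..1})"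
    unfolding circle_inner_def by (auto simp: continuous_on_def)
  then show ?thesis using at_within_Icc_at_left[of 0 "1::real"] by simp
qed

lemma sq_norm_eq_0:
  assumes f: "f holomorphic_on ball 0 1" and zero: "\<And>z. cmod z < 1 \<Longrightarrow> f z = 0"
  shows "sq_norm f = 0"
proof -
  have "circle_inner f f r = 0" if "0 < r" "r < 1" for r
    using that zero by (simp add: circle_inner_def norm_mult)
  then have "sq_norm f \<le> 0" "f \<in> hardy_space"
    using zero by (auto intro!: circle_bound_imp_summable(2)[OF f] hardy_spaceI[OF f, of 0] simp: circle_inner_def norm_mult)
  then show ?thesis using sq_norm_nonneg by fastforce
qed

lemma circle_norm_pos:
  assumes f: "f holomorphic_on ball 0 1" and r: "0 < r" "r < 1" and z: "cmod z < 1" "f z \<noteq> 0"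
  shows "0 < Re (circle_inner f f r)"
proof -
  note s = circle_norm_sums[OF f r]
  have "\<exists>n. taylor_coeff f n \<noteq> 0"
  proof (rule ccontr)
    assume "\<not> ?thesis"
    then show False using taylor_sums[OF f z(1)] z(2) by (simp add: sums_iff)
  qed
  then obtain n where "taylor_coeff f n \<noteq> 0" ..
  then have "0 < (\<Sum>n. (cmod (taylor_coeff f n))^2 * r^(2*n))"
    using s r by (intro suminf_pos2[of _ n]) (auto simp: sums_iff)
  then show ?thesis using s by (simp add: sums_iff)
qed

context order_three_rotation
begin

lemma mobius_ball: "cmod z < 1 \<Longrightarrow> cmod (mobius a z) < 1" "cmod z \<le> 1 \<Longrightarrow> cmod (mobius a z) \<le> 1"
  "cmod z = 1 \<Longrightarrow> cmod (mobius a z) = 1"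
  using mobius_range[OF a(1)] by auto

lemma rot_ball: "cmod z < 1 \<Longrightarrow> cmod (rot z) < 1" "cmod z \<le> 1 \<Longrightarrow> cmod (rot z) \<le> 1"
  unfolding rot_def by (auto intro!: mobius_ball simp: norm_mult l_norm)

lemma rot_mobius: "cmod \<zeta> \<le> 1 \<Longrightarrow> rot (mobius a \<zeta>) = mobius a (l * \<zeta>)"
  unfolding rot_def by (simp add: mobius_involution a)

lemma disc_algebra_mobius: "f \<in> disc_algebra \<Longrightarrow> (\<lambda>z. f (mobius a z)) \<in> disc_algebra"
  by (rule disc_algebra_compose[OF _ mobius_disc_algebra[OF a(1)]]) (auto intro: mobius_ball)

lemma disc_algebra_mult_l: "f \<in> disc_algebra \<Longrightarrow> (\<lambda>z. f (l * z)) \<in> disc_algebra"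
  by (rule disc_algebra_compose) (auto simp: disc_algebra_def norm_mult l_norm intro!: continuous_intros holomorphic_intros)

lemma disc_algebra_rot: "f \<in> disc_algebra \<Longrightarrow> (\<lambda>z. f (rot z)) \<in> disc_algebra"
  unfolding rot_def by (rule disc_algebra_mobius[OF disc_algebra_mult_l[OF disc_algebra_mobius]])

lemma rot_disc_algebra: "rot \<in> disc_algebra"
  using disc_algebra_rot[of "\<lambda>z. z"] by (simp add: disc_algebra_def)

lemma continuous_on_mult_l:
  assumes "continuous_on (sphere 0 1) (h :: complex \<Rightarrow> 'a::topological_space)" and "cmod k = 1"
  shows "continuous_on (sphere 0 1) (\<lambda>\<zeta>. h (k * \<zeta>))"
  by (rule continuous_on_compose2[OF assms(1)]) (use assms(2) in \<open>auto intro!: continuous_intros simp: norm_mult\<close>)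

lemma circle_mean_fibre:
  assumes h: "continuous_on (sphere 0 1) h"
  shows "3 * circle_mean h = circle_mean (\<lambda>\<zeta>. h \<zeta> + h (l * \<zeta>) + h (l^2 * \<zeta>))"
proof -
  have l2: "cmod (l^2) = 1" by (simp add: norm_power l_norm)
  note [simp] = circle_mean_rotate[OF l_norm h] circle_mean_rotate[OF l2 h]
  show ?thesis
    by (simp add: circle_mean_add continuous_on_add h continuous_on_mult_l[OF h l_norm] continuous_on_mult_l[OF h l2])
qed

text \<open>After the substitution z = \<open>mobius a \<zeta>\<close> the operator is composition
  with multiplication by l. Adding the three rotated copies of the integrand collects a whole fibre,
  and l^3 = 1 closes the cycle.\<close>

lemma form_as_fibre_mean:
  assumes f: "f \<in> disc_algebra"
  defines "g \<equiv> \<lambda>\<zeta>. f (mobius a \<zeta>)"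
  shows "3 * (t * sq_norm f - Re (e * hardy_inner (\<lambda>z. f (rot z)) f)) = circle_mean (\<lambda>\<zeta>.
      t * (poisson a \<zeta> * (cmod (g \<zeta>))^2 + poisson a (l * \<zeta>) * (cmod (g (l * \<zeta>)))^2
        + poisson a (l^2 * \<zeta>) * (cmod (g (l^2 * \<zeta>)))^2)
      - Re (e * (of_real (poisson a \<zeta>) * (g (l * \<zeta>) * cnj (g \<zeta>))
        + of_real (poisson a (l * \<zeta>)) * (g (l^2 * \<zeta>) * cnj (g (l * \<zeta>)))
        + of_real (poisson a (l^2 * \<zeta>)) * (g \<zeta> * cnj (g (l^2 * \<zeta>))))))"
proof -
  have g: "g \<in> disc_algebra" unfolding g_def by (rule disc_algebra_mobius[OF f])
  have fr: "(\<lambda>z. f (rot z)) \<in> disc_algebra" by (rule disc_algebra_rot[OF f])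
  define h where "h = (\<lambda>z. t * (cmod (f z))^2 + (- 1) * Re (e * (f (rot z) * cnj (f z))))"
  define q where "q = (\<lambda>\<zeta>. poisson a \<zeta> * (t * (cmod (g \<zeta>))^2 - Re (e * (g (l * \<zeta>) * cnj (g \<zeta>)))))"
  have c1: "continuous_on (sphere 0 1) (\<lambda>z. t * (cmod (f z))^2)"
    and c2: "continuous_on (sphere 0 1) (\<lambda>z. Re (e * (f (rot z) * cnj (f z))))"
    by (intro continuous_intros disc_algebra_sphere f fr)+
  have ch: "continuous_on (sphere 0 1) h"
    unfolding h_def by (intro continuous_on_add c1 continuous_on_mult continuous_on_const c2)
  have cg: "continuous_on (sphere 0 1) g" by (rule disc_algebra_sphere[OF g])
  have cq: "continuous_on (sphere 0 1) q" unfolding q_def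
    by (intro continuous_intros continuous_on_poisson a cg continuous_on_mult_l[OF cg l_norm])
  have "t * sq_norm f - Re (e * hardy_inner (\<lambda>z. f (rot z)) f) = circle_mean h"
  proof -
    have "circle_mean h = circle_mean (\<lambda>z. t * (cmod (f z))^2) + circle_mean (\<lambda>z. (- 1) * Re (e * (f (rot z) * cnj (f z))))"
      unfolding h_def by (rule circle_mean_add[OF c1]) (intro continuous_on_mult continuous_on_const c2)
    then show ?thesis
      unfolding Re_hardy_inner[OF fr f] sq_norm_disc_algebra[OF f] circle_mean_cmult by linarith
  qed
  also have "\<dots> = circle_mean (\<lambda>\<zeta>. poisson a \<zeta> * h (mobius a \<zeta>))"
    by (rule circle_mean_mobius[OF a(1) ch, symmetric])
  also have "\<dots> = circle_mean q"
    by (rule circle_mean_cong) (simp add: q_def h_def g_def rot_mobius)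
  finally have "3 * (t * sq_norm f - Re (e * hardy_inner (\<lambda>z. f (rot z)) f))
      = circle_mean (\<lambda>\<zeta>. q \<zeta> + q (l * \<zeta>) + q (l^2 * \<zeta>))"
    using circle_mean_fibre[OF cq] by (simp only:)
  also have "\<dots> = circle_mean (\<lambda>\<zeta>.
      t * (poisson a \<zeta> * (cmod (g \<zeta>))^2 + poisson a (l * \<zeta>) * (cmod (g (l * \<zeta>)))^2
        + poisson a (l^2 * \<zeta>) * (cmod (g (l^2 * \<zeta>)))^2)
      - Re (e * (of_real (poisson a \<zeta>) * (g (l * \<zeta>) * cnj (g \<zeta>))
        + of_real (poisson a (l * \<zeta>)) * (g (l^2 * \<zeta>) * cnj (g (l * \<zeta>)))
        + of_real (poisson a (l^2 * \<zeta>)) * (g \<zeta> * cnj (g (l^2 * \<zeta>))))))"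
  proof (rule circle_mean_cong)
    fix \<zeta> :: complex
    have ll: "l * (l * \<zeta>) = l^2 * \<zeta>" "l * (l^2 * \<zeta>) = \<zeta>"
    proof -
      have "l * (l^2 * \<zeta>) = l^3 * \<zeta>" by (simp only: power2_eq_square power3_eq_cube mult.assoc)
      then show "l * (l * \<zeta>) = l^2 * \<zeta>" "l * (l^2 * \<zeta>) = \<zeta>" by (simp_all add: l(1) power2_eq_square)
    qed
    have Re_split: "Re (e * (of_real p * x + of_real p' * y + of_real p'' * z)) = p * Re (e * x) + p' * Re (e * y) + p'' * Re (e * z)"
      for p p' p'' x y z
    proof -
      have "e * (of_real p * x + of_real p' * y + of_real p'' * z)
          = of_real p * (e * x) + of_real p' * (e * y) + of_real p'' * (e * z)" by (simp only: distrib_left mult.left_commute)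
      then show ?thesis by (simp only: plus_complex.sel Re_of_real_mult)
    qed
    have lin: "p * (t * A - B) + p' * (t * A' - B') + p'' * (t * A'' - B'')
        = t * (p * A + p' * A' + p'' * A'') - (p * B + p' * B' + p'' * B'')" for p p' p'' A A' A'' B B' B'' :: real
      by (simp add: algebra_simps)
    show "q \<zeta> + q (l * \<zeta>) + q (l^2 * \<zeta>) =
      t * (poisson a \<zeta> * (cmod (g \<zeta>))^2 + poisson a (l * \<zeta>) * (cmod (g (l * \<zeta>)))^2
        + poisson a (l^2 * \<zeta>) * (cmod (g (l^2 * \<zeta>)))^2)
      - Re (e * (of_real (poisson a \<zeta>) * (g (l * \<zeta>) * cnj (g \<zeta>))
        + of_real (poisson a (l * \<zeta>)) * (g (l^2 * \<zeta>) * cnj (g (l * \<zeta>)))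
        + of_real (poisson a (l^2 * \<zeta>)) * (g \<zeta> * cnj (g (l^2 * \<zeta>)))))"
      unfolding Re_split unfolding q_def ll by (rule lin)
  qed
  finally show ?thesis .
qed

lemma gap_factor_disc_algebra: "(\<lambda>\<zeta>. (cnj u * \<zeta>)^3 - \<zeta>0) \<in> disc_algebra"
  by (auto simp: disc_algebra_def intro!: continuous_intros holomorphic_intros)

text \<open>\<open>fibre_gap\<close> integrated over the circle. The factor (cnj u \<zeta>)^3 -
  \<open>\<zeta>0\<close> is constant on fibres, so the left side is again a sum of three rotations
  of one function.\<close>

lemma form_gap_disc_algebra:
  assumes f: "f \<in> disc_algebra" and e: "cmod e = 1" and t: "0 < t" "L < 3 * t^2"
    and root: "4 * t^3 - 4 * L * t = Re (e^3)"
  shows "E * K / (768 * t) * sq_norm (\<lambda>\<zeta>. ((cnj u * \<zeta>)^3 - \<zeta>0) * f (mobius a \<zeta>))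
    \<le> t * sq_norm f - Re (e * hardy_inner (\<lambda>z. f (rot z)) f)"
proof -
  define g where "g = (\<lambda>\<zeta>. f (mobius a \<zeta>))"
  define k where "k = (\<lambda>\<zeta>. E * K / (768 * t) * (cmod (((cnj u * \<zeta>)^3 - \<zeta>0) * g \<zeta>))^2)"
  have g: "g \<in> disc_algebra" unfolding g_def by (rule disc_algebra_mobius[OF f])
  have g_eq: "f (mobius a z) = g z" for z by (simp add: g_def)
  note qg = disc_algebra_mult[OF gap_factor_disc_algebra g]
  have ck: "continuous_on (sphere 0 1) k"
    unfolding k_def by (intro continuous_intros disc_algebra_sphere g)
  have l2: "cmod (l^2) = 1" by (simp add: norm_power l_norm)
  have "3 * (E * K / (768 * t) * sq_norm (\<lambda>\<zeta>. ((cnj u * \<zeta>)^3 - \<zeta>0) * g \<zeta>)) = 3 * circle_mean k"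
    unfolding k_def sq_norm_disc_algebra[OF qg] circle_mean_cmult ..
  also have "\<dots> = circle_mean (\<lambda>\<zeta>. k \<zeta> + k (l * \<zeta>) + k (l^2 * \<zeta>))" by (rule circle_mean_fibre[OF ck])
  also have "\<dots> \<le> 3 * (t * sq_norm f - Re (e * hardy_inner (\<lambda>z. f (rot z)) f))"
    unfolding form_as_fibre_mean[OF f] g_eq
  proof (rule circle_mean_mono)
    show "continuous_on (sphere 0 1) (\<lambda>\<zeta>. k \<zeta> + k (l * \<zeta>) + k (l^2 * \<zeta>))"
      by (intro continuous_on_add ck continuous_on_mult_l[OF ck l_norm] continuous_on_mult_l[OF ck l2])
    note cp = continuous_on_poisson[OF a(1)] disc_algebra_sphere[OF g]
    show "continuous_on (sphere 0 1) (\<lambda>\<zeta>. t * (poisson a \<zeta> * (cmod (g \<zeta>))^2 + poisson a (l * \<zeta>) * (cmod (g (l * \<zeta>)))^2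
        + poisson a (l^2 * \<zeta>) * (cmod (g (l^2 * \<zeta>)))^2)
      - Re (e * (of_real (poisson a \<zeta>) * (g (l * \<zeta>) * cnj (g \<zeta>))
        + of_real (poisson a (l * \<zeta>)) * (g (l^2 * \<zeta>) * cnj (g (l * \<zeta>)))
        + of_real (poisson a (l^2 * \<zeta>)) * (g \<zeta> * cnj (g (l^2 * \<zeta>))))))"
      by (intro continuous_intros cp cp[THEN continuous_on_mult_l, OF l_norm] cp[THEN continuous_on_mult_l, OF l2])
    fix \<zeta> :: complex assume \<zeta>: "cmod \<zeta> = 1"
    have cubes: "(cnj u * (l * \<zeta>))^3 = (cnj u * \<zeta>)^3" "(cnj u * (l^2 * \<zeta>))^3 = (cnj u * \<zeta>)^3"
    proof -
      have "(l^2)^3 = (l^3)^2" by (simp flip: power_mult)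
      then show "(cnj u * (l * \<zeta>))^3 = (cnj u * \<zeta>)^3" "(cnj u * (l^2 * \<zeta>))^3 = (cnj u * \<zeta>)^3"
        unfolding power_mult_distrib l(1) by simp_all
    qed
    have "k \<zeta> + k (l * \<zeta>) + k (l^2 * \<zeta>) = E * K / (768 * t) * (cmod ((cnj u * \<zeta>)^3 - \<zeta>0))^2 *
        ((cmod (g \<zeta>))^2 + (cmod (g (l * \<zeta>)))^2 + (cmod (g (l^2 * \<zeta>)))^2)"
      unfolding k_def cubes unfolding norm_mult power_mult_distrib by (simp only: ring_distribs mult.assoc)
    also note fibre_gap[OF \<zeta> e t root]
    finally show "k \<zeta> + k (l * \<zeta>) + k (l^2 * \<zeta>) \<le> t * (poisson a \<zeta> * (cmod (g \<zeta>))^2 + poisson a (l * \<zeta>) * (cmod (g (l * \<zeta>)))^2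
        + poisson a (l^2 * \<zeta>) * (cmod (g (l^2 * \<zeta>)))^2)
      - Re (e * (of_real (poisson a \<zeta>) * (g (l * \<zeta>) * cnj (g \<zeta>))
        + of_real (poisson a (l * \<zeta>)) * (g (l^2 * \<zeta>) * cnj (g (l * \<zeta>)))
        + of_real (poisson a (l^2 * \<zeta>)) * (g \<zeta> * cnj (g (l^2 * \<zeta>)))))" .
  qed
  finally show ?thesis unfolding g_def by (rule mult_left_le_imp_le) simp
qed

end

text \<open>On a short arc at \<open>\<zeta>1\<close> the power k^N is at least q'^N, and where h
  \<le> 0 it is at most q^N with q < q'. For large N the gain on the arc outweighs every
  loss.\<close>

lemma circle_mean_peak:
  fixes h k :: "complex \<Rightarrow> real"
  assumes h: "continuous_on (sphere 0 1) h" and k: "continuous_on (sphere 0 1) k"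
    and k01: "\<And>\<zeta>. cmod \<zeta> = 1 \<Longrightarrow> 0 \<le> k \<zeta>" "\<And>\<zeta>. cmod \<zeta> = 1 \<Longrightarrow> k \<zeta> \<le> 1"
    and \<zeta>1: "cmod \<zeta>1 = 1" "k \<zeta>1 = 1"
    and peak: "\<And>\<zeta>. cmod \<zeta> = 1 \<Longrightarrow> k \<zeta> = 1 \<Longrightarrow> 0 < h \<zeta>"
  obtains N where "0 < circle_mean (\<lambda>\<zeta>. k \<zeta>^N * h \<zeta>)"
proof -
  define C where "C = sphere 0 1 \<inter> h -` {..0}"
  have "closed C" unfolding C_def by (intro continuous_closed_preimage h) auto
  then have "compact (sphere 0 1 \<inter> C)" by (intro compact_Int_closed) auto
  moreover have "sphere 0 1 \<inter> C = C" by (auto simp: C_def)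
  ultimately have C: "compact C" by simp
  obtain q where q: "0 \<le> q" "q < 1" "\<And>\<zeta>. \<zeta> \<in> C \<Longrightarrow> k \<zeta> \<le> q"
  proof (cases "C = {}")
    case True
    then show ?thesis using that[of 0] by auto
  next
    case False
    have "continuous_on C k" by (rule continuous_on_subset[OF k]) (auto simp: C_def)
    then obtain c where c: "c \<in> C" "\<forall>\<zeta>\<in>C. k \<zeta> \<le> k c" using continuous_attains_sup[OF C False] by blast
    then have c1: "cmod c = 1" "\<not> 0 < h c" by (auto simp: C_def)
    then have "k c \<noteq> 1" using peak by blast
    then show ?thesis using that[of "k c"] c k01[OF c1(1)] by force
  qed
  have "bounded (h ` sphere 0 1)" by (intro compact_imp_bounded compact_continuous_image h) simp
  then obtain B where "0 < B" and B': "\<forall>x\<in>h ` sphere 0 1. norm x \<le> B" using bounded_pos by blast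
  then have B: "\<bar>h \<zeta>\<bar> \<le> B" if "cmod \<zeta> = 1" for \<zeta> using that by auto
  define q' \<eta> where "q' = (1 + q) / 2" and "\<eta> = h \<zeta>1 / 2"
  have q': "q < q'" "q' < 1" "0 < q'" and \<eta>: "0 < \<eta>" "\<eta> < h \<zeta>1"
    using q peak[OF \<zeta>1] by (auto simp: q'_def \<eta>_def)
  obtain t1 where t1: "\<zeta>1 = cis t1" "0 \<le> t1" "t1 < 2*pi"
  proof -
    have "\<zeta>1 = of_real 1 * exp (\<i> * of_real (Arg2pi \<zeta>1))" using Arg2pi_eq[of \<zeta>1] unfolding \<zeta>1(1) .
    also have "\<dots> = cis (Arg2pi \<zeta>1)" by (simp add: cis_conv_exp)
    finally show ?thesis using that Arg2pi_ge_0 Arg2pi_lt_2pi by blast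
  qed
  have ck: "continuous_on UNIV (\<lambda>t. k (cis t))" and ch: "continuous_on UNIV (\<lambda>t. h (cis t))"
    by (rule continuous_on_circle[OF k] continuous_on_circle[OF h])+
  have "((\<lambda>t. k (cis t)) \<longlongrightarrow> 1) (at t1)" "((\<lambda>t. h (cis t)) \<longlongrightarrow> h \<zeta>1) (at t1)"
  proof -
    have "isCont (\<lambda>t. k (cis t)) t1" "isCont (\<lambda>t. h (cis t)) t1"
      using ck ch by (simp_all add: continuous_on_eq_continuous_at)
    then show "((\<lambda>t. k (cis t)) \<longlongrightarrow> 1) (at t1)" "((\<lambda>t. h (cis t)) \<longlongrightarrow> h \<zeta>1) (at t1)"
      unfolding isCont_def t1(1)[symmetric] \<zeta>1(2) by simp_all
  qed
  then have "\<forall>\<^sub>F t in at t1. q' < k (cis t)" "\<forall>\<^sub>F t in at t1. \<eta> < h (cis t)"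
    using q' \<eta> by (auto dest: order_tendstoD(1))
  then have "\<forall>\<^sub>F t in at t1. q' < k (cis t) \<and> \<eta> < h (cis t)" by (rule eventually_conj)
  then obtain \<delta> where \<delta>: "0 < \<delta>" "\<And>t. t \<noteq> t1 \<Longrightarrow> dist t t1 < \<delta> \<Longrightarrow> q' < k (cis t) \<and> \<eta> < h (cis t)"
    by (auto simp: eventually_at)
  \<comment> \<open>The arc is taken to the right of t1 < 2 pi and cut off at 2 pi, so that it lies
    in the interval of integration.\<close>
  define \<beta> where "\<beta> = min (t1 + \<delta> / 2) (2*pi)"
  have \<beta>: "t1 < \<beta>" "\<beta> \<le> 2*pi" using \<delta>(1) t1 by (auto simp: \<beta>_def)
  have near: "q' \<le> k (cis t)" "\<eta> \<le> h (cis t)" if "t \<in> {t1..\<beta>}" for t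
  proof -
    have "t = t1 \<or> q' < k (cis t) \<and> \<eta> < h (cis t)"
    proof (cases "t = t1")
      case False
      moreover have "dist t t1 < \<delta>" using that \<delta>(1) by (auto simp: \<beta>_def dist_real_def)
      ultimately show ?thesis using \<delta>(2) by blast
    qed simp
    then show "q' \<le> k (cis t)" "\<eta> \<le> h (cis t)" using t1(1) \<zeta>1(2) q' \<eta> by auto
  qed
  have "0 < (\<beta> - t1) * \<eta> / (2*pi*B)" using \<beta> \<eta> \<open>0 < B\<close> by simp
  moreover have "q / q' < 1" using q' by simp
  ultimately obtain N where N: "(q / q')^N < (\<beta> - t1) * \<eta> / (2*pi*B)" using real_arch_pow_inv by blast
  then have N: "q^N * (2*pi*B) < q'^N * ((\<beta> - t1) * \<eta>)"
    using q' \<open>0 < B\<close> by (simp add: power_divide field_simps)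
  \<comment> \<open>Adding B q^N makes the integrand nonnegative, so its integral can be restricted
    to the arc.\<close>
  define F where "F = (\<lambda>t. k (cis t)^N * h (cis t) + B * q^N)"
  have F_int: "F integrable_on {x..y}" for x y
    unfolding F_def by (intro integrable_continuous_real continuous_intros continuous_on_circle h k)
  have F_nonneg: "0 \<le> F t" for t
  proof (cases "0 < h (cis t)")
    case True
    then show ?thesis using k01(1)[of "cis t"] q \<open>0 < B\<close> by (auto simp: F_def intro!: add_nonneg_nonneg)
  next
    case False
    then have "k (cis t) \<le> q" by (intro q) (auto simp: C_def)
    then have "k (cis t)^N \<le> q^N" using k01(1)[of "cis t"] by (intro power_mono) auto
    then have "k (cis t)^N * (- h (cis t)) \<le> q^N * B"
      using B[of "cis t"] False q by (intro mult_mono) auto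
    then show ?thesis by (simp add: F_def mult.commute)
  qed
  have "(\<beta> - t1) * (q'^N * \<eta>) = integral {t1..\<beta>} (\<lambda>_. q'^N * \<eta>)" using \<beta> by simp
  also have "\<dots> \<le> integral {t1..\<beta>} F"
  proof (rule integral_le)
    fix t assume t: "t \<in> {t1..\<beta>}"
    have "q'^N * \<eta> \<le> k (cis t)^N * h (cis t)"
      using near[OF t] q' \<eta> by (intro mult_mono power_mono) auto
    then show "q'^N * \<eta> \<le> F t" using q \<open>0 < B\<close> by (simp add: F_def add_increasing2)
  qed (auto intro: F_int)
  also have "\<dots> \<le> integral {0..2*pi} F"
    using \<beta> t1 F_nonneg by (intro integral_subset_le F_int) auto
  also have "\<dots> = integral {0..2*pi} (\<lambda>t. k (cis t)^N * h (cis t)) + 2*pi * (B * q^N)"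
    unfolding F_def
    by (subst integral_add) (auto intro!: integrable_continuous_real continuous_intros continuous_on_circle h k)
  finally have "(\<beta> - t1) * (q'^N * \<eta>) - 2*pi * (B * q^N) \<le> integral {0..2*pi} (\<lambda>t. k (cis t)^N * h (cis t))" by simp
  moreover have "0 < (\<beta> - t1) * (q'^N * \<eta>) - 2*pi * (B * q^N)" using N by (simp add: mult_ac)
  ultimately have "0 < integral {0..2*pi} (\<lambda>t. k (cis t)^N * h (cis t))" by linarith
  then show ?thesis using that[of N] by (simp add: circle_mean_def)
qed

section \<open>Passage from the disc algebra to the whole Hardy space\<close>

lemma hardy_inner_add_right:
  assumes f: "f \<in> hardy_space" and g: "g \<in> hardy_space" and h: "h \<in> hardy_space"
  shows "hardy_inner f (\<lambda>z. g z + h z) = hardy_inner f g + hardy_inner f h"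
  unfolding hardy_inner_commute[OF hardy_space_add[OF g h] f] hardy_inner_add_left[OF g h f]
    complex_cnj_add hardy_inner_commute[OF g f, symmetric] hardy_inner_commute[OF h f, symmetric] ..

lemma hardy_inner_cmult_right:
  assumes f: "f \<in> hardy_space" and g: "g \<in> hardy_space"
  shows "hardy_inner f (\<lambda>z. c * g z) = cnj c * hardy_inner f g"
  unfolding hardy_inner_commute[OF hardy_space_cmult[OF g] f] hardy_inner_cmult_left[OF g f]
    complex_cnj_mult hardy_inner_commute[OF g f, symmetric] ..

context order_three_rotation
begin

text \<open>The quotient of the bounds K / (1 - 2 \<Delta>) and K / 2 of the Poisson kernel; it
  bounds the square of the operator norm.\<close>

definition M :: real where "M = 2 / (1 - 2 * \<Delta>)"

lemma M_pos: "0 < M" using \<Delta>_bounds by (simp add: M_def)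

lemma sq_norm_rot_disc_algebra:
  assumes f: "f \<in> disc_algebra"
  shows "sq_norm (\<lambda>z. f (rot z)) \<le> M * sq_norm f"
proof -
  define G where "G = (\<lambda>\<zeta>. (cmod (f (mobius a \<zeta>)))^2)"
  have cG: "continuous_on (sphere 0 1) G"
    unfolding G_def by (intro continuous_intros disc_algebra_sphere disc_algebra_mobius f)
  have cP: "continuous_on (sphere 0 1) (poisson a)" by (rule continuous_on_poisson[OF a(1)])
  note cGl = continuous_on_mult_l[OF cG l_norm]
  have c1: "continuous_on (sphere 0 1) (\<lambda>z. (cmod (f (rot z)))^2)" and c2: "continuous_on (sphere 0 1) (\<lambda>z. (cmod (f z))^2)"
    by (intro continuous_intros disc_algebra_sphere disc_algebra_rot f)+
  have Gnn: "0 \<le> G \<zeta>" for \<zeta> by (simp add: G_def)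
  have "sq_norm (\<lambda>z. f (rot z)) = circle_mean (\<lambda>\<zeta>. poisson a \<zeta> * (cmod (f (rot (mobius a \<zeta>))))^2)"
    unfolding sq_norm_disc_algebra[OF disc_algebra_rot[OF f]] by (rule circle_mean_mobius[OF a(1) c1, symmetric])
  also have "\<dots> = circle_mean (\<lambda>\<zeta>. poisson a \<zeta> * G (l * \<zeta>))"
    by (rule circle_mean_cong) (simp add: G_def rot_mobius)
  also have "\<dots> \<le> circle_mean (\<lambda>\<zeta>. K / (1 - 2 * \<Delta>) * G (l * \<zeta>))"
  proof (rule circle_mean_mono)
    show "continuous_on (sphere 0 1) (\<lambda>\<zeta>. poisson a \<zeta> * G (l * \<zeta>))"
      "continuous_on (sphere 0 1) (\<lambda>\<zeta>. K / (1 - 2 * \<Delta>) * G (l * \<zeta>))"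
      by (intro continuous_on_mult cP cGl continuous_on_const)+
    show "poisson a \<zeta> * G (l * \<zeta>) \<le> K / (1 - 2 * \<Delta>) * G (l * \<zeta>)" if "cmod \<zeta> = 1" for \<zeta>
      by (intro mult_right_mono poisson_bounds Gnn that)
  qed
  also have "\<dots> = K / (1 - 2 * \<Delta>) * circle_mean G"
    unfolding circle_mean_cmult circle_mean_rotate[OF l_norm cG] ..
  also have "\<dots> = M * (K / 2 * circle_mean G)"
    using \<Delta>_bounds by (simp add: M_def field_simps)
  also have "K / 2 * circle_mean G = circle_mean (\<lambda>\<zeta>. K / 2 * G \<zeta>)" by (simp only: circle_mean_cmult)
  also have "M * \<dots> \<le> M * circle_mean (\<lambda>\<zeta>. poisson a \<zeta> * G \<zeta>)"
  proof (intro mult_left_mono circle_mean_mono)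
    show "continuous_on (sphere 0 1) (\<lambda>\<zeta>. K / 2 * G \<zeta>)" "continuous_on (sphere 0 1) (\<lambda>\<zeta>. poisson a \<zeta> * G \<zeta>)"
      by (intro continuous_on_mult cP cG continuous_on_const)+
    show "K / 2 * G \<zeta> \<le> poisson a \<zeta> * G \<zeta>" if "cmod \<zeta> = 1" for \<zeta>
      by (intro mult_right_mono poisson_bounds Gnn that)
  qed (use M_pos in simp)
  also have "circle_mean (\<lambda>\<zeta>. poisson a \<zeta> * G \<zeta>) = sq_norm f"
    unfolding G_def sq_norm_disc_algebra[OF f] by (rule circle_mean_mobius[OF a(1) c2])
  finally show ?thesis .
qed

lemma rot_holomorphic: "rot holomorphic_on ball 0 1"
  using rot_disc_algebra by (simp add: disc_algebra_def)

text \<open>The bound for the disc algebra applies to the dilations of f, uniformly in r; on each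
  inner circle r may then tend to 1.\<close>

lemma hardy_space_rot:
  assumes f: "f \<in> hardy_space"
  shows "(\<lambda>z. f (rot z)) \<in> hardy_space" "sq_norm (\<lambda>z. f (rot z)) \<le> M * sq_norm f"
proof -
  note hol = hardy_space_holomorphic[OF f]
  have fr: "(\<lambda>z. f (rot z)) holomorphic_on ball 0 1"
    by (rule holomorphic_on_compose_gen[OF rot_holomorphic hol, unfolded o_def]) (use rot_ball in auto)
  have bound: "Re (circle_inner (\<lambda>z. f (rot z)) (\<lambda>z. f (rot z)) s) \<le> M * sq_norm f" if s: "0 < s" "s < 1" for s
  proof (rule tendsto_upperbound)
    have "continuous_on (cball 0 1) rot" using rot_disc_algebra by (simp add: disc_algebra_def)
    from circle_inner_dilation_tendsto[OF hol this rot_ball(1) continuous_on_const[of _ 1] s]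
    show "((\<lambda>r::real. Re (circle_inner (\<lambda>z. f (of_real r * rot z)) (\<lambda>z. f (of_real r * rot z)) s)) \<longlongrightarrow>
      Re (circle_inner (\<lambda>z. f (rot z)) (\<lambda>z. f (rot z)) s)) (at_left 1)" by simp
    show "\<forall>\<^sub>F r::real in at_left 1. Re (circle_inner (\<lambda>z. f (of_real r * rot z)) (\<lambda>z. f (of_real r * rot z)) s) \<le> M * sq_norm f"
      using eventually_at_left_real[OF zero_less_one]
    proof eventually_elim
      case (elim r)
      then have r: "0 < r" "r < 1" by auto
      have d: "(\<lambda>z. f (of_real r * z)) \<in> disc_algebra" using disc_algebra_dilation[OF hol] r by simp
      have "Re (circle_inner (\<lambda>z. f (of_real r * rot z)) (\<lambda>z. f (of_real r * rot z)) s)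
          \<le> sq_norm (\<lambda>z. f (of_real r * rot z))"
        using disc_algebra_rot[OF d] disc_algebra_subset_hardy_space by (intro circle_norm_le_sq_norm s) auto
      also have "\<dots> \<le> M * sq_norm (\<lambda>z. f (of_real r * z))" by (rule sq_norm_rot_disc_algebra[OF d])
      also have "\<dots> \<le> M * sq_norm f" using sq_norm_dilation[OF f r] M_pos by simp
      finally show ?case .
    qed
  qed simp
  show "(\<lambda>z. f (rot z)) \<in> hardy_space" "sq_norm (\<lambda>z. f (rot z)) \<le> M * sq_norm f"
    using circle_bound_imp_summable[OF fr bound] hardy_spaceI_summable[OF fr] by blast+
qed

lemma hardy_inner_rot_bound:
  assumes f: "f \<in> hardy_space" and g: "g \<in> hardy_space"
  shows "cmod (hardy_inner (\<lambda>z. f (rot z)) g) \<le> sqrt (M * sq_norm f) * sqrt (sq_norm g)"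
proof -
  have "cmod (hardy_inner (\<lambda>z. f (rot z)) g) \<le> sqrt (sq_norm (\<lambda>z. f (rot z))) * sqrt (sq_norm g)"
    by (rule hardy_Cauchy_Schwarz[OF hardy_space_rot(1)[OF f] g])
  also have "\<dots> \<le> sqrt (M * sq_norm f) * sqrt (sq_norm g)"
    using hardy_space_rot(2)[OF f] sq_norm_nonneg[OF g] by (intro mult_right_mono) auto
  finally show ?thesis .
qed

text \<open>The difference of the two values splits into two terms, each with f minus its dilation
  in one slot. Boundedness of the rotation and \<open>hardy_dilation\<close> make both
  small.\<close>

lemma form_dilation_tendsto:
  assumes f: "f \<in> hardy_space"
  shows "((\<lambda>r::real. hardy_inner (\<lambda>z. f (of_real r * rot z)) (\<lambda>z. f (of_real r * z)))
    \<longlongrightarrow> hardy_inner (\<lambda>z. f (rot z)) f) (at_left 1)"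
proof (rule LIM_zero_cancel, rule Lim_null_comparison)
  define D where "D = (\<lambda>r::real. sq_norm (\<lambda>z. f z + (- 1) * f (of_real r * z)))"
  have "((\<lambda>r. 2 * (sqrt (M * sq_norm f) * sqrt (D r))) \<longlongrightarrow> 2 * (sqrt (M * sq_norm f) * sqrt 0)) (at_left 1)"
    using hardy_dilation[OF f] unfolding D_def by (intro tendsto_intros)
  then show "((\<lambda>r. 2 * (sqrt (M * sq_norm f) * sqrt (D r))) \<longlongrightarrow> 0) (at_left 1)" by simp
  show "\<forall>\<^sub>F r::real in at_left 1. norm (hardy_inner (\<lambda>z. f (of_real r * rot z)) (\<lambda>z. f (of_real r * z))
      - hardy_inner (\<lambda>z. f (rot z)) f) \<le> 2 * (sqrt (M * sq_norm f) * sqrt (D r))"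
    using eventually_at_left_real[OF zero_less_one]
  proof eventually_elim
    case (elim r)
    then have r: "0 < r" "r < 1" by auto
    define g where "g = (\<lambda>z. f (of_real r * z))"
    define d where "d = (\<lambda>z. f z + (- 1) * g z)"
    have g: "g \<in> hardy_space"
      using disc_algebra_dilation[OF hardy_space_holomorphic[OF f], of r] r disc_algebra_subset_hardy_space
      by (auto simp: g_def)
    have d: "d \<in> hardy_space" unfolding d_def by (intro hardy_space_add hardy_space_cmult f g)
    have Dr: "D r = sq_norm d" by (simp add: D_def d_def g_def)
    have split: "f = (\<lambda>z. d z + g z)" "(\<lambda>z. f (rot z)) = (\<lambda>z. d (rot z) + g (rot z))" by (auto simp: d_def)
    have "hardy_inner (\<lambda>z. f (rot z)) f = hardy_inner (\<lambda>z. d (rot z)) f + hardy_inner (\<lambda>z. g (rot z)) f"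
      unfolding split(2) by (intro hardy_inner_add_left hardy_space_rot(1) d g f)
    also have "hardy_inner (\<lambda>z. g (rot z)) f = hardy_inner (\<lambda>z. g (rot z)) d + hardy_inner (\<lambda>z. g (rot z)) g"
      by (subst split(1)) (intro hardy_inner_add_right hardy_space_rot(1) d g)
    finally have "hardy_inner (\<lambda>z. g (rot z)) g - hardy_inner (\<lambda>z. f (rot z)) f
        = - (hardy_inner (\<lambda>z. d (rot z)) f + hardy_inner (\<lambda>z. g (rot z)) d)" by simp
    then have "cmod (hardy_inner (\<lambda>z. g (rot z)) g - hardy_inner (\<lambda>z. f (rot z)) f)
        \<le> cmod (hardy_inner (\<lambda>z. d (rot z)) f) + cmod (hardy_inner (\<lambda>z. g (rot z)) d)"
      by (metis norm_minus_cancel norm_triangle_ineq)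
    also have "\<dots> \<le> sqrt (M * sq_norm d) * sqrt (sq_norm f) + sqrt (M * sq_norm g) * sqrt (sq_norm d)"
      by (intro add_mono hardy_inner_rot_bound d f g)
    also have "\<dots> \<le> 2 * (sqrt (M * sq_norm f) * sqrt (sq_norm d))"
    proof -
      have "sqrt (M * sq_norm g) * sqrt (sq_norm d) \<le> sqrt (M * sq_norm f) * sqrt (sq_norm d)"
        using sq_norm_dilation[OF f r] M_pos sq_norm_nonneg[OF d] by (intro mult_right_mono) (auto simp: g_def)
      moreover have "sqrt (M * sq_norm d) * sqrt (sq_norm f) = sqrt (M * sq_norm f) * sqrt (sq_norm d)"
        by (simp only: real_sqrt_mult mult_ac)
      ultimately show ?thesis by linarith
    qed
    finally show ?case by (simp only: g_def Dr)
  qed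
qed

text \<open>The gap inequality for the dilations is weakened to a mean over the circle of radius
  1/2, where r may tend to 1 without boundary values. The limit is positive: f is not zero, and the
  gap factor has no zeros inside the disc because |\<open>\<zeta>0\<close>| = 1.\<close>

lemma form_strict:
  assumes f: "f \<in> hardy_space" "0 < sq_norm f" and e: "cmod e = 1" and t: "0 < t" "L < 3 * t^2"
    and root: "4 * t^3 - 4 * L * t = Re (e^3)"
  shows "Re (e * hardy_inner (\<lambda>z. f (rot z)) f) < t * sq_norm f"
proof -
  note hol = hardy_space_holomorphic[OF f(1)]
  define q where "q = (\<lambda>\<zeta>. (cnj u * \<zeta>)^3 - \<zeta>0)"
  define G where "G = (\<lambda>r::real. \<lambda>\<zeta>. q \<zeta> * f (of_real r * mobius a \<zeta>))"
  define c where "c = E * K / (768 * t)"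
  have c: "0 < c" using E_pos K_pos t by (simp add: c_def)
  have m: "mobius a \<in> disc_algebra" by (rule mobius_disc_algebra[OF a(1)])
  have q: "q \<in> disc_algebra" unfolding q_def by (rule gap_factor_disc_algebra)
  have "\<exists>z. cmod z < 1 \<and> f z \<noteq> 0" using sq_norm_eq_0[OF hol] f(2) by (metis less_irrefl)
  then obtain z where z: "cmod z < 1" "f z \<noteq> 0" by blast
  have "G 1 (mobius a z) \<noteq> 0"
  proof -
    have "cmod ((cnj u * mobius a z)^3) < 1"
      using mobius_ball(1)[OF z(1)] u_norm by (simp add: norm_mult norm_power power_less_one_iff)
    then have "q (mobius a z) \<noteq> 0" using \<zeta>0_norm by (auto simp: q_def)
    then show ?thesis using z mobius_involution[OF a(1), of z] by (simp add: G_def)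
  qed
  moreover have "G 1 holomorphic_on ball 0 1"
  proof -
    have "(\<lambda>\<zeta>. f (mobius a \<zeta>)) holomorphic_on ball 0 1"
      by (rule holomorphic_on_compose_gen[OF _ hol, unfolded o_def])
        (use m mobius_ball in \<open>auto simp: disc_algebra_def\<close>)
    then show ?thesis using q by (auto simp: G_def disc_algebra_def intro!: holomorphic_intros)
  qed
  ultimately have pos: "0 < Re (circle_inner (G 1) (G 1) (1/2))"
    using mobius_ball(1)[OF z(1)] by (intro circle_norm_pos) auto
  have lim1: "((\<lambda>r. c * Re (circle_inner (G r) (G r) (1/2))) \<longlongrightarrow> c * Re (circle_inner (G 1) (G 1) (1/2))) (at_left 1)"
    unfolding G_def using m q mobius_ball
    by (intro tendsto_intros circle_inner_dilation_tendsto[OF hol]) (auto simp: disc_algebra_def)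
  have lim2: "((\<lambda>r. t * Re (circle_inner f f r) - Re (e * hardy_inner (\<lambda>z. f (of_real r * rot z)) (\<lambda>z. f (of_real r * z))))
      \<longlongrightarrow> t * Re (hardy_inner f f) - Re (e * hardy_inner (\<lambda>z. f (rot z)) f)) (at_left 1)"
    by (intro tendsto_intros hardy_inner_eq_suminf(1) form_dilation_tendsto f)
  have "c * Re (circle_inner (G 1) (G 1) (1/2)) \<le> t * Re (hardy_inner f f) - Re (e * hardy_inner (\<lambda>z. f (rot z)) f)"
  proof (rule tendsto_le[OF _ lim2 lim1])
    show "\<forall>\<^sub>F r in at_left 1. c * Re (circle_inner (G r) (G r) (1/2))
        \<le> t * Re (circle_inner f f r) - Re (e * hardy_inner (\<lambda>z. f (of_real r * rot z)) (\<lambda>z. f (of_real r * z)))"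
      using eventually_at_left_real[OF zero_less_one]
    proof eventually_elim
      case (elim r)
      then have r: "0 < r" "r < 1" by auto
      have d: "(\<lambda>z. f (of_real r * z)) \<in> disc_algebra" using disc_algebra_dilation[OF hol] r by simp
      have "G r \<in> disc_algebra"
        unfolding G_def by (rule disc_algebra_mult[OF q disc_algebra_mobius[OF d]])
      then have "Re (circle_inner (G r) (G r) (1/2)) \<le> sq_norm (G r)"
        using disc_algebra_subset_hardy_space by (intro circle_norm_le_sq_norm) auto
      then have "c * Re (circle_inner (G r) (G r) (1/2)) \<le> c * sq_norm (G r)" using c by simp
      also have "\<dots> \<le> t * sq_norm (\<lambda>z. f (of_real r * z))
          - Re (e * hardy_inner (\<lambda>z. f (of_real r * rot z)) (\<lambda>z. f (of_real r * z)))"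
        using form_gap_disc_algebra[OF d e t root] by (simp only: c_def G_def q_def)
      finally show ?case by (simp only: sq_norm_eq_circle_inner[OF d] circle_inner_dilation)
    qed
  qed simp
  moreover have "0 < c * Re (circle_inner (G 1) (G 1) (1/2))" using c pos by simp
  moreover have "Re (hardy_inner f f) = sq_norm f" by (simp add: hardy_inner_self f)
  ultimately show ?thesis by simp
qed

end

section \<open>Functions approaching the bound\<close>

lemma cis_cube_root:
  assumes "cmod z = 1"
  obtains c where "cmod c = 1" "c^3 = z"
proof -
  have "z = of_real 1 * exp (\<i> * of_real (Arg2pi z))" using Arg2pi_eq[of z] unfolding assms .
  also have "\<dots> = cis (Arg2pi z)" by (simp add: cis_conv_exp)
  also have "\<dots> = cis (Arg2pi z / 3)^3" by (simp add: Complex.DeMoivre)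
  finally show ?thesis using that[of "cis (Arg2pi z / 3)"] by simp
qed

context order_three_rotation
begin

lemma one_l_l2: "1 + l + l^2 = 0"
proof -
  have "(l - 1) * (1 + l + l^2) = 0" using l(1) by algebra
  then show ?thesis using l(2) by simp
qed

text \<open>An inverse discrete Fourier transform on the cube roots of unity, scaled to the fibre of
  \<open>\<zeta>1\<close>.\<close>

lemma interpolation:
  assumes "\<zeta>1 \<noteq> 0"
  obtains p where "continuous_on UNIV p" "p holomorphic_on UNIV" "p \<zeta>1 = x0" "p (l * \<zeta>1) = x1" "p (l^2 * \<zeta>1) = x2"
proof -
  define P where "P = (\<lambda>y. (x0 * (1 + y + y^2) + x1 * (1 + l^2 * y + l * y^2) + x2 * (1 + l * y + l^2 * y^2)) / 3)"
  have "3 * P 1 = 3 * x0" unfolding P_def using one_l_l2 l(1) by simp algebra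
  moreover have "3 * P l = 3 * x1" unfolding P_def using one_l_l2 l(1) by simp algebra
  moreover have "3 * P (l^2) = 3 * x2" unfolding P_def using one_l_l2 l(1) by simp algebra
  ultimately have P: "P 1 = x0" "P l = x1" "P (l^2) = x2" by simp_all
  show ?thesis
  proof (rule that[of "\<lambda>\<zeta>. P (\<zeta> / \<zeta>1)"])
    show "continuous_on UNIV (\<lambda>\<zeta>. P (\<zeta> / \<zeta>1))" "(\<lambda>\<zeta>. P (\<zeta> / \<zeta>1)) holomorphic_on UNIV"
      unfolding P_def using assms by (auto intro!: continuous_intros holomorphic_intros)
  qed (use P assms in simp_all)
qed

text \<open>The peaking factor is a polynomial in \<zeta>^3 and hence constant on fibres: it
  multiplies the fibre form of p by the scalar k^N and leaves the vector interpolated by p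
  intact.\<close>

lemma form_close:
  assumes e: "cmod e = 1" and t: "0 < t" "L < 3 * t^2" and root: "4 * t^3 - 4 * L * t = Re (e^3)" and s: "s < t"
  obtains f where "f \<in> hardy_space" "s * sq_norm f < Re (e * hardy_inner (\<lambda>z. f (rot z)) f)"
proof -
  obtain c where c: "cmod c = 1" "c^3 = \<zeta>0" by (rule cis_cube_root[OF \<zeta>0_norm])
  have uu: "cnj u * u = 1" using u_norm by (simp add: complex_norm_square[symmetric] mult.commute)
  define \<zeta>1 where "\<zeta>1 = u * c"
  have "cnj u * \<zeta>1 = c" using uu by (simp only: \<zeta>1_def mult.assoc[symmetric] mult_1_left)
  then have "(cnj u * \<zeta>1)^3 = \<zeta>0" by (simp only: c(2))
  then have \<zeta>1: "cmod \<zeta>1 = 1" "(cnj u * \<zeta>1)^3 = \<zeta>0" "\<zeta>1 \<noteq> 0"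
    using c(1) u_norm by (auto simp: \<zeta>1_def norm_mult)
  obtain x0 x1 x2 where x: "s * (poisson a \<zeta>1 * (cmod x0)^2 + poisson a (l * \<zeta>1) * (cmod x1)^2 + poisson a (l^2 * \<zeta>1) * (cmod x2)^2)
      < Re (e * (of_real (poisson a \<zeta>1) * (x1 * cnj x0) + of_real (poisson a (l * \<zeta>1)) * (x2 * cnj x1)
        + of_real (poisson a (l^2 * \<zeta>1)) * (x0 * cnj x2)))"
    by (rule fibre_attained[OF e t root s \<zeta>1(1,2)])
  obtain p where p: "continuous_on UNIV p" "p holomorphic_on UNIV" and px: "p \<zeta>1 = x0" "p (l * \<zeta>1) = x1" "p (l^2 * \<zeta>1) = x2"
    by (rule interpolation[OF \<zeta>1(3)])
  \<comment> \<open>On the circle |\<kappa>| \<le> 1, with equality exactly where (cnj u \<zeta>)^3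
    = \<open>\<zeta>0\<close>.\<close>
  define \<kappa> where "\<kappa> = (\<lambda>\<zeta>. (1 + cnj \<zeta>0 * (cnj u * \<zeta>)^3) / 2)"
  define k where "k = (\<lambda>\<zeta>. (cmod (\<kappa> \<zeta>))^2)"
  define h where "h = (\<lambda>\<zeta>. Re (e * (of_real (poisson a \<zeta>) * (p (l * \<zeta>) * cnj (p \<zeta>))
        + of_real (poisson a (l * \<zeta>)) * (p (l^2 * \<zeta>) * cnj (p (l * \<zeta>)))
        + of_real (poisson a (l^2 * \<zeta>)) * (p \<zeta> * cnj (p (l^2 * \<zeta>)))))
      - s * (poisson a \<zeta> * (cmod (p \<zeta>))^2 + poisson a (l * \<zeta>) * (cmod (p (l * \<zeta>)))^2
        + poisson a (l^2 * \<zeta>) * (cmod (p (l^2 * \<zeta>)))^2))"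
  have l2: "cmod (l^2) = 1" by (simp add: norm_power l_norm)
  have ll: "l * (l * \<zeta>) = l^2 * \<zeta>" "l^2 * (l * \<zeta>) = \<zeta>" "l * (l^2 * \<zeta>) = \<zeta>" "l^2 * (l^2 * \<zeta>) = l * \<zeta>" for \<zeta>
  proof -
    have "l^2 * (l * \<zeta>) = l^3 * \<zeta>" "l * (l^2 * \<zeta>) = l^3 * \<zeta>" "l^2 * (l^2 * \<zeta>) = l^3 * (l * \<zeta>)"
      by (simp_all only: power2_eq_square power3_eq_cube mult.assoc)
    then show "l * (l * \<zeta>) = l^2 * \<zeta>" "l^2 * (l * \<zeta>) = \<zeta>" "l * (l^2 * \<zeta>) = \<zeta>" "l^2 * (l^2 * \<zeta>) = l * \<zeta>"
      by (simp_all add: l(1) power2_eq_square)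
  qed
  have cubes: "(cnj u * (l * \<zeta>))^3 = (cnj u * \<zeta>)^3" "(cnj u * (l^2 * \<zeta>))^3 = (cnj u * \<zeta>)^3" for \<zeta>
  proof -
    have "(l^2)^3 = (l^3)^2" by (simp flip: power_mult)
    then show "(cnj u * (l * \<zeta>))^3 = (cnj u * \<zeta>)^3" "(cnj u * (l^2 * \<zeta>))^3 = (cnj u * \<zeta>)^3"
      unfolding power_mult_distrib l(1) by simp_all
  qed
  \<comment> \<open>The peak occurs at all three points of the fibre, so positivity of h at
    \<open>\<zeta>1\<close> must be carried to the other two.\<close>
  have cyclic: "h (l * \<zeta>) = h \<zeta>" for \<zeta>
  proof -
    have cyc: "Re (e * (x + y + z)) - s * (x' + y' + z') = Re (e * (z + x + y)) - s * (z' + x' + y')"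
      for x y z :: complex and x' y' z' :: real by (simp only: add.commute add.left_commute)
    show ?thesis unfolding h_def ll by (rule cyc)
  qed
  have h1: "0 < h \<zeta>1" using x by (simp only: h_def px diff_gt_0_iff_gt)
  have kle: "cmod (\<kappa> \<zeta>) \<le> 1" if "cmod \<zeta> = 1" for \<zeta>
  proof -
    have "cmod (1 + cnj \<zeta>0 * (cnj u * \<zeta>)^3) \<le> 1 + 1"
      using that u_norm \<zeta>0_norm norm_triangle_ineq[of 1 "cnj \<zeta>0 * (cnj u * \<zeta>)^3"] by (simp add: norm_mult norm_power)
    then show ?thesis by (simp add: \<kappa>_def norm_divide)
  qed
  have zz: "cnj \<zeta>0 * \<zeta>0 = 1" using \<zeta>0_norm by (simp add: complex_norm_square[symmetric] mult.commute)
  have peak: "0 < h \<zeta>" if \<zeta>: "cmod \<zeta> = 1" "k \<zeta> = 1" for \<zeta>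
  proof -
    define w where "w = cnj \<zeta>0 * (cnj u * \<zeta>)^3"
    have w: "cmod w = 1" using \<zeta>(1) u_norm \<zeta>0_norm by (simp add: w_def norm_mult norm_power)
    have "(cmod (1 + w))^2 = 4" using \<zeta>(2) by (simp add: k_def \<kappa>_def w_def norm_divide power_divide)
    moreover have "(cmod (1 + w))^2 = 1 + 2 * Re w + (cmod w)^2"
      unfolding cmod_power2 by (simp add: power2_eq_square algebra_simps)
    ultimately have "Re w = 1" using w by simp
    moreover have "(Re w)^2 + (Im w)^2 = 1" using w by (simp add: cmod_power2[symmetric])
    ultimately have "w = 1" by (simp add: complex_eq_iff)
    then have "cnj \<zeta>0 * (cnj u * \<zeta>)^3 = cnj \<zeta>0 * \<zeta>0" by (simp add: w_def zz)
    moreover have "cnj \<zeta>0 \<noteq> 0" using \<zeta>0_norm by auto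
    ultimately have "(cnj u * \<zeta>)^3 = (cnj u * \<zeta>1)^3" unfolding \<zeta>1(2) mult_cancel_left by blast
    moreover have "cnj u^3 \<noteq> 0" using u_norm by auto
    ultimately have "\<zeta>^3 - \<zeta>1^3 = 0" unfolding power_mult_distrib mult_cancel_left by simp
    moreover have "(\<zeta> - \<zeta>1) * (\<zeta> - l * \<zeta>1) * (\<zeta> - l^2 * \<zeta>1)
        = \<zeta>^3 - (1 + l + l^2) * \<zeta>1 * \<zeta>^2 + l * (1 + l + l^2) * \<zeta>1^2 * \<zeta> - l^3 * \<zeta>1^3" by algebra
    ultimately have "(\<zeta> - \<zeta>1) * (\<zeta> - l * \<zeta>1) * (\<zeta> - l^2 * \<zeta>1) = 0"
      unfolding one_l_l2 l(1) by simp
    then consider "\<zeta> = \<zeta>1" | "\<zeta> = l * \<zeta>1" | "\<zeta> = l^2 * \<zeta>1" by auto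
    then show ?thesis using h1 cyclic[of \<zeta>1] cyclic[of "l * \<zeta>1"] unfolding ll by cases auto
  qed
  have cp: "continuous_on (sphere 0 1) p" using p(1) by (rule continuous_on_subset) simp
  note cP = continuous_on_poisson[OF a(1)]
  have ch: "continuous_on (sphere 0 1) h"
    unfolding h_def
    by (intro continuous_intros cP cp continuous_on_mult_l[OF cP l_norm] continuous_on_mult_l[OF cP l2]
        continuous_on_mult_l[OF cp l_norm] continuous_on_mult_l[OF cp l2])
  have ck: "continuous_on (sphere 0 1) k" unfolding k_def \<kappa>_def by (intro continuous_intros) auto
  obtain N where N: "0 < circle_mean (\<lambda>\<zeta>. k \<zeta>^N * h \<zeta>)"
  proof (rule circle_mean_peak[OF ch ck _ _ \<zeta>1(1) _ peak])
    show "0 \<le> k \<zeta>" for \<zeta> by (simp add: k_def)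
    show "k \<zeta> \<le> 1" if "cmod \<zeta> = 1" for \<zeta> using kle[OF that] by (simp add: k_def power_le_one)
    show "k \<zeta>1 = 1" by (simp add: k_def \<kappa>_def \<zeta>1(2) zz)
  qed
  define G where "G = (\<lambda>\<zeta>. \<kappa> \<zeta>^N * p \<zeta>)"
  have "G \<in> disc_algebra"
    unfolding G_def \<kappa>_def disc_algebra_def using p
    by (auto intro!: continuous_intros holomorphic_intros elim: continuous_on_subset holomorphic_on_subset)
  then have f: "(\<lambda>z. G (mobius a z)) \<in> disc_algebra" by (rule disc_algebra_mobius)
  have G_l: "G (l * \<zeta>) = \<kappa> \<zeta>^N * p (l * \<zeta>)" "G (l^2 * \<zeta>) = \<kappa> \<zeta>^N * p (l^2 * \<zeta>)" for \<zeta>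
    unfolding G_def \<kappa>_def cubes by simp_all
  have inv: "mobius a (mobius a \<zeta>) = \<zeta>" "mobius a (mobius a (l * \<zeta>)) = l * \<zeta>" "mobius a (mobius a (l^2 * \<zeta>)) = l^2 * \<zeta>"
    if "cmod \<zeta> = 1" for \<zeta>
    using that l_norm l2 by (simp_all add: mobius_involution a norm_mult)
  have "3 * (s * sq_norm (\<lambda>z. G (mobius a z)) - Re (e * hardy_inner (\<lambda>z. G (mobius a (rot z))) (\<lambda>z. G (mobius a z))))
      = circle_mean (\<lambda>\<zeta>. (- 1) * (k \<zeta>^N * h \<zeta>))"
    unfolding form_as_fibre_mean[OF f]
  proof (rule circle_mean_cong)
    fix \<zeta> :: complex assume \<zeta>: "cmod \<zeta> = 1"
    have sq: "(cmod (\<kappa> \<zeta>^N * y))^2 = k \<zeta>^N * (cmod y)^2" for y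
      by (simp add: k_def norm_mult norm_power power_mult_distrib flip: power_mult) (simp add: mult.commute)
    have prod: "\<kappa> \<zeta>^N * y * cnj (\<kappa> \<zeta>^N * y') = of_real (k \<zeta>^N) * (y * cnj y')" for y y'
    proof -
      have "\<kappa> \<zeta>^N * cnj (\<kappa> \<zeta>)^N = of_real (k \<zeta>^N)"
        by (simp only: power_mult_distrib[symmetric] complex_norm_square[symmetric] k_def of_real_power)
      then show ?thesis by (simp only: complex_cnj_mult complex_cnj_power mult_ac)
    qed
    have Re_k: "Re (e * (of_real p0 * (of_real K' * y0) + of_real p1 * (of_real K' * y1) + of_real p2 * (of_real K' * y2)))
        = K' * Re (e * (of_real p0 * y0 + of_real p1 * y1 + of_real p2 * y2))" for K' p0 p1 p2 y0 y1 y2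
    proof -
      have "e * (of_real p0 * (of_real K' * y0) + of_real p1 * (of_real K' * y1) + of_real p2 * (of_real K' * y2))
          = of_real K' * (e * (of_real p0 * y0 + of_real p1 * y1 + of_real p2 * y2))"
        by (simp only: distrib_left mult.left_commute)
      then show ?thesis by (simp only: Re_of_real_mult)
    qed
    have lin: "s * (p0 * (K' * A0) + p1 * (K' * A1) + p2 * (K' * A2)) - K' * R
        = (- 1) * (K' * (R - s * (p0 * A0 + p1 * A1 + p2 * A2)))" for p0 p1 p2 A0 A1 A2 K' R :: real
      by (simp add: algebra_simps)
    show "s * (poisson a \<zeta> * (cmod (G (mobius a (mobius a \<zeta>))))^2 + poisson a (l * \<zeta>) * (cmod (G (mobius a (mobius a (l * \<zeta>)))))^2
        + poisson a (l^2 * \<zeta>) * (cmod (G (mobius a (mobius a (l^2 * \<zeta>)))))^2)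
      - Re (e * (of_real (poisson a \<zeta>) * (G (mobius a (mobius a (l * \<zeta>))) * cnj (G (mobius a (mobius a \<zeta>))))
        + of_real (poisson a (l * \<zeta>)) * (G (mobius a (mobius a (l^2 * \<zeta>))) * cnj (G (mobius a (mobius a (l * \<zeta>)))))
        + of_real (poisson a (l^2 * \<zeta>)) * (G (mobius a (mobius a \<zeta>)) * cnj (G (mobius a (mobius a (l^2 * \<zeta>)))))))
      = (- 1) * (k \<zeta>^N * h \<zeta>)"
      unfolding inv[OF \<zeta>] G_l unfolding G_def sq prod Re_k h_def by (rule lin)
  qed
  also have "\<dots> < 0" unfolding circle_mean_cmult using N by linarith
  finally have neg: "3 * (s * sq_norm (\<lambda>z. G (mobius a z))
      - Re (e * hardy_inner (\<lambda>z. G (mobius a (rot z))) (\<lambda>z. G (mobius a z)))) < 0" .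
  have "A < R" if "3 * (A - R) < 0" for A R :: real using that by (simp add: mult_less_0_iff)
  from this[OF neg]
  have "s * sq_norm (\<lambda>z. G (mobius a z)) < Re (e * hardy_inner (\<lambda>z. G (mobius a (rot z))) (\<lambda>z. G (mobius a z)))" .
  then show ?thesis using that[OF subsetD[OF disc_algebra_subset_hardy_space f]] by blast
qed

section \<open>The numerical range and its convexity\<close>

definition range_set :: "complex set" where
  "range_set = {hardy_inner (\<lambda>z. f (rot z)) f | f. f \<in> hardy_space \<and> sq_norm f = 1}"

lemma normalise_in_range_set:
  assumes f: "f \<in> hardy_space" and pos: "0 < sq_norm f"
  shows "hardy_inner (\<lambda>z. f (rot z)) f / of_real (sq_norm f) \<in> range_set"
proof -
  define n where "n = complex_of_real (1 / sqrt (sq_norm f))"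
  have nn: "n * cnj n = of_real (1 / sq_norm f)" using pos by (simp add: n_def flip: of_real_mult)
  have g: "(\<lambda>z. n * f z) \<in> hardy_space" by (rule hardy_space_cmult[OF f])
  have scale: "hardy_inner (\<lambda>z. n * h z) (\<lambda>z. n * f z) = of_real (1 / sq_norm f) * hardy_inner h f" if "h \<in> hardy_space" for h
    unfolding hardy_inner_cmult_left[OF that g] hardy_inner_cmult_right[OF that f] nn[symmetric] by (simp only: mult.assoc)
  have "of_real (sq_norm (\<lambda>z. n * f z)) = of_real (1 / sq_norm f) * complex_of_real (sq_norm f)"
    using scale[OF f] by (simp only: hardy_inner_self[OF g] hardy_inner_self[OF f])
  then have "complex_of_real (sq_norm (\<lambda>z. n * f z)) = of_real 1" using pos by simp
  then have "sq_norm (\<lambda>z. n * f z) = 1" by (simp only: of_real_eq_iff)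
  moreover have "hardy_inner (\<lambda>z. n * f (rot z)) (\<lambda>z. n * f z) = hardy_inner (\<lambda>z. f (rot z)) f / of_real (sq_norm f)"
    using scale[OF hardy_space_rot(1)[OF f]] by simp
  ultimately show ?thesis
    using g unfolding range_set_def by (intro CollectI exI[of _ "\<lambda>z. n * f z"] conjI) simp_all
qed

end

context order_three_rotation
begin

text \<open>A function of square norm 0 is not literally the zero function, since its values off the
  disc are arbitrary; Cauchy-Schwarz makes it negligible in every slot.\<close>

lemma form_null:
  assumes h: "h \<in> hardy_space" "sq_norm h = 0" and k: "k \<in> hardy_space"
  shows "hardy_inner h k = 0" "hardy_inner k h = 0" "hardy_inner (\<lambda>z. h (rot z)) k = 0" "hardy_inner (\<lambda>z. k (rot z)) h = 0"
  using hardy_Cauchy_Schwarz[OF h(1) k] hardy_Cauchy_Schwarz[OF k h(1)]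
    hardy_inner_rot_bound[OF h(1) k] hardy_inner_rot_bound[OF k h(1)] h(2) by simp_all

lemma form_expand:
  assumes f: "f \<in> hardy_space" and g: "g \<in> hardy_space" and f': "f' \<in> hardy_space" and g': "g' \<in> hardy_space"
  shows "hardy_inner (\<lambda>z. \<alpha> * f' z + \<beta> * g' z) (\<lambda>z. \<alpha> * f z + \<beta> * g z)
    = \<alpha> * cnj \<alpha> * hardy_inner f' f + \<alpha> * cnj \<beta> * hardy_inner f' g
      + \<beta> * cnj \<alpha> * hardy_inner g' f + \<beta> * cnj \<beta> * hardy_inner g' g"
proof -
  note cm = hardy_space_cmult
  show ?thesis
    unfolding hardy_inner_add_left[OF cm[OF f'] cm[OF g'] hardy_space_add[OF cm[OF f] cm[OF g]]]
      hardy_inner_cmult_left[OF f' hardy_space_add[OF cm[OF f] cm[OF g]]]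
      hardy_inner_cmult_left[OF g' hardy_space_add[OF cm[OF f] cm[OF g]]]
      hardy_inner_add_right[OF f' cm[OF f] cm[OF g]] hardy_inner_add_right[OF g' cm[OF f] cm[OF g]]
      hardy_inner_cmult_right[OF f' f] hardy_inner_cmult_right[OF f' g]
      hardy_inner_cmult_right[OF g' f] hardy_inner_cmult_right[OF g' g]
    by (simp only: distrib_left mult.assoc add.assoc)
qed

text \<open>The Toeplitz--Hausdorff argument, carried out directly on pairs of functions.\<close>

lemma convex_range_set: "convex range_set"
  unfolding convex_alt
proof (intro ballI allI impI)
  fix w1 w2 :: complex and \<mu> :: real
  assume "w1 \<in> range_set" "w2 \<in> range_set" and \<mu>: "0 \<le> \<mu> \<and> \<mu> \<le> 1"
  then obtain f g where f: "f \<in> hardy_space" "sq_norm f = 1" "w1 = hardy_inner (\<lambda>z. f (rot z)) f"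
    and g: "g \<in> hardy_space" "sq_norm g = 1" "w2 = hardy_inner (\<lambda>z. g (rot z)) g"
    by (auto simp: range_set_def)
  show "(1 - \<mu>) *\<^sub>R w1 + \<mu> *\<^sub>R w2 \<in> range_set"
  proof (cases "w1 = w2")
    case True
    then show ?thesis using \<open>w1 \<in> range_set\<close> by (simp flip: scaleR_left_distrib)
  next
    case False
    then have w: "w2 - w1 \<noteq> 0" by simp
    \<comment> \<open>The affine normalisation sending w1 to 0 and w2 to 1, applied to the whole
      sesquilinear form.\<close>
    define A where "A = (\<lambda>x y. (hardy_inner (\<lambda>z. x (rot z)) y - w1 * hardy_inner x y) / (w2 - w1))"
    have Aff: "A f f = 0" and Agg: "A g g = 1"
      using w f g by (simp_all add: A_def hardy_inner_self)
    define \<delta> where "\<delta> = A f g - cnj (A g f)"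
    \<comment> \<open>A phase that makes the sum of the two mixed terms real, so that A takes real
      values along the path H.\<close>
    define \<gamma> where "\<gamma> = (if \<delta> = 0 then 1 else cnj \<delta> / of_real (cmod \<delta>))"
    have "cmod \<gamma> = 1" by (simp add: \<gamma>_def norm_divide)
    then have \<gamma>: "\<gamma> * cnj \<gamma> = 1" by (simp add: complex_norm_square[symmetric])
    have "Im (\<gamma> * \<delta>) = 0"
    proof -
      have "cnj \<delta> * \<delta> = of_real ((cmod \<delta>)^2)" unfolding complex_norm_square by (rule mult.commute)
      then have "\<gamma> * \<delta> = of_real (cmod \<delta>)" by (simp add: \<gamma>_def power2_eq_square)
      then show ?thesis by simp
    qed
    then have Im0: "Im (\<gamma> * A f g + cnj \<gamma> * A g f) = 0" by (simp add: \<delta>_def algebra_simps)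
    define \<rho> where "\<rho> = Re (\<gamma> * A f g + cnj \<gamma> * A g f)"
    have \<rho>: "\<gamma> * A f g + cnj \<gamma> * A g f = of_real \<rho>" using Im0 by (simp add: \<rho>_def complex_eq_iff)
    define H where "H = (\<lambda>s::real. \<lambda>z. (of_real (1 - s) * \<gamma>) * f z + of_real s * g z)"
    define \<nu> where "\<nu> = (\<lambda>s. sq_norm (H s))"
    have H: "H s \<in> hardy_space" for s unfolding H_def by (intro hardy_space_add hardy_space_cmult f g)
    have \<alpha>: "of_real (1 - s) * \<gamma> * cnj (of_real (1 - s) * \<gamma>) = of_real ((1 - s)^2)"
      and \<alpha>\<beta>: "of_real (1 - s) * \<gamma> * cnj (of_real s) = of_real (s * (1 - s)) * \<gamma>"
      and \<beta>\<alpha>: "of_real s * cnj (of_real (1 - s) * \<gamma>) = of_real (s * (1 - s)) * cnj \<gamma>"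
      and \<beta>: "of_real s * cnj (of_real s) = complex_of_real (s^2)" for s
    proof -
      have "of_real (1 - s) * \<gamma> * cnj (of_real (1 - s) * \<gamma>) = of_real ((1 - s)^2) * (\<gamma> * cnj \<gamma>)"
        by (simp add: power2_eq_square mult_ac)
      then show "of_real (1 - s) * \<gamma> * cnj (of_real (1 - s) * \<gamma>) = of_real ((1 - s)^2)" by (simp only: \<gamma> mult_1_right)
    qed (simp_all add: power2_eq_square mult_ac)
    note expand = form_expand[OF f(1) g(1) hardy_space_rot(1)[OF f(1)] hardy_space_rot(1)[OF g(1)]]
    note expand' = form_expand[OF f(1) g(1) f(1) g(1)]
    have lin2: "((p * b1 + q * b2) - w1 * (p * i1 + q * i2)) / D = p * ((b1 - w1 * i1) / D) + q * ((b2 - w1 * i2) / D)"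
      for p q b1 b2 i1 i2 D :: complex
      by (simp add: diff_divide_distrib add_divide_distrib algebra_simps)
    have lin4: "((p * b1 + q * b2 + r * b3 + t * b4) - w1 * (p * i1 + q * i2 + r * i3 + t * i4)) / D
        = p * ((b1 - w1 * i1) / D) + q * ((b2 - w1 * i2) / D) + r * ((b3 - w1 * i3) / D) + t * ((b4 - w1 * i4) / D)"
      for p q r t b1 b2 b3 b4 i1 i2 i3 i4 D :: complex
      by (simp add: diff_divide_distrib add_divide_distrib algebra_simps)
    have AH: "A (H s) (H s) = of_real (s^2 + s * (1 - s) * \<rho>)" for s
    proof -
      have "A (H s) (H s) = of_real ((1 - s)^2) * A f f + of_real (s * (1 - s)) * \<gamma> * A f g
          + of_real (s * (1 - s)) * cnj \<gamma> * A g f + of_real (s^2) * A g g"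
        unfolding A_def H_def expand expand' \<alpha> \<alpha>\<beta> \<beta>\<alpha> \<beta> by (rule lin4)
      also have "\<dots> = of_real ((1 - s)^2) * A f f + of_real (s * (1 - s)) * (\<gamma> * A f g + cnj \<gamma> * A g f)
          + of_real (s^2) * A g g"
        by (simp only: distrib_left mult.assoc add.assoc)
      finally have "A (H s) (H s) = \<dots>" .
      then show ?thesis unfolding \<rho> Aff Agg by simp
    qed
    have \<nu>_eq: "\<nu> s = (1 - s)^2 + s * (1 - s) * Re (\<gamma> * hardy_inner f g + cnj \<gamma> * hardy_inner g f) + s^2" for s
    proof -
      have "hardy_inner (H s) (H s) = of_real ((1 - s)^2) + of_real (s * (1 - s)) * (\<gamma> * hardy_inner f g + cnj \<gamma> * hardy_inner g f)
          + of_real (s^2)"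
        unfolding H_def expand' \<alpha> \<alpha>\<beta> \<beta>\<alpha> \<beta> by (simp add: hardy_inner_self f g algebra_simps)
      then have "Re (of_real (\<nu> s)) = Re (of_real ((1 - s)^2) + of_real (s * (1 - s)) * (\<gamma> * hardy_inner f g + cnj \<gamma> * hardy_inner g f)
          + of_real (s^2))"
        by (simp only: hardy_inner_self[OF H] \<nu>_def)
      then show ?thesis by (simp only: plus_complex.sel Re_of_real_mult Re_complex_of_real)
    qed
    \<comment> \<open>A path vector of norm 0 is annihilated by A in both slots. Pairing it with f
      and g forces s = 0, but the path starts at a unit vector.\<close>
    have \<nu>_pos: "0 < \<nu> s" for s
    proof (rule ccontr)
      assume "\<not> ?thesis"
      then have z: "sq_norm (H s) = 0" using sq_norm_nonneg[OF H] by (simp add: \<nu>_def dual_order.antisym)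
      note cm = hardy_space_cmult
      have i1: "hardy_inner (H s) f = of_real (1 - s) * \<gamma> * hardy_inner f f + of_real s * hardy_inner g f"
        unfolding H_def hardy_inner_add_left[OF cm[OF f(1)] cm[OF g(1)] f(1)]
          hardy_inner_cmult_left[OF f(1) f(1)] hardy_inner_cmult_left[OF g(1) f(1)] ..
      have b1: "hardy_inner (\<lambda>z. H s (rot z)) f = of_real (1 - s) * \<gamma> * hardy_inner (\<lambda>z. f (rot z)) f + of_real s * hardy_inner (\<lambda>z. g (rot z)) f"
        unfolding H_def hardy_inner_add_left[OF cm[OF hardy_space_rot(1)[OF f(1)]] cm[OF hardy_space_rot(1)[OF g(1)]] f(1)]
          hardy_inner_cmult_left[OF hardy_space_rot(1)[OF f(1)] f(1)] hardy_inner_cmult_left[OF hardy_space_rot(1)[OF g(1)] f(1)] ..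
      have "A (H s) f = of_real (1 - s) * \<gamma> * A f f + of_real s * A g f"
        unfolding A_def i1 b1 by (rule lin2)
      moreover have "A (H s) f = 0" using form_null[OF H z f(1)] by (simp add: A_def)
      ultimately have sg: "of_real s * A g f = 0" using Aff by simp
      have i2: "hardy_inner g (H s) = cnj (of_real (1 - s) * \<gamma>) * hardy_inner g f + cnj (of_real s) * hardy_inner g g"
        unfolding H_def hardy_inner_add_right[OF g(1) cm[OF f(1)] cm[OF g(1)]]
          hardy_inner_cmult_right[OF g(1) f(1)] hardy_inner_cmult_right[OF g(1) g(1)] ..
      have b2: "hardy_inner (\<lambda>z. g (rot z)) (H s) = cnj (of_real (1 - s) * \<gamma>) * hardy_inner (\<lambda>z. g (rot z)) f
          + cnj (of_real s) * hardy_inner (\<lambda>z. g (rot z)) g"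
        unfolding H_def hardy_inner_add_right[OF hardy_space_rot(1)[OF g(1)] cm[OF f(1)] cm[OF g(1)]]
          hardy_inner_cmult_right[OF hardy_space_rot(1)[OF g(1)] f(1)] hardy_inner_cmult_right[OF hardy_space_rot(1)[OF g(1)] g(1)] ..
      have "A g (H s) = cnj (of_real (1 - s) * \<gamma>) * A g f + cnj (of_real s) * A g g"
        unfolding A_def i2 b2 by (rule lin2)
      moreover have "A g (H s) = 0" using form_null[OF H z g(1)] by (simp add: A_def)
      ultimately have "cnj (of_real (1 - s) * \<gamma>) * A g f + of_real s = 0" using Agg by simp
      then have "s = 0" using sg by auto
      then show False using z \<nu>_eq[of 0] by (simp add: \<nu>_def)
    qed
    \<comment> \<open>The normalised value of A runs continuously from 0 to 1, so it takes the value
      \<mu>.\<close>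
    define F where "F = (\<lambda>s. (s^2 + s * (1 - s) * \<rho>) / \<nu> s)"
    have "continuous_on {0..1} F"
      unfolding F_def \<nu>_eq using \<nu>_pos unfolding \<nu>_eq
      by (intro continuous_intros) (metis less_irrefl)
    moreover have "F 0 = 0" "F 1 = 1" by (simp_all add: F_def \<nu>_eq)
    ultimately obtain s where s: "F s = \<mu>" using IVT'[of F 0 \<mu> 1] \<mu> by auto
    then have "s^2 + s * (1 - s) * \<rho> = \<mu> * \<nu> s" using \<nu>_pos[of s] by (simp add: F_def field_simps)
    then have "A (H s) (H s) = of_real (\<mu> * \<nu> s)" by (simp only: AH)
    then have "hardy_inner (\<lambda>z. H s (rot z)) (H s) - w1 * hardy_inner (H s) (H s) = of_real (\<mu> * \<nu> s) * (w2 - w1)"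
      unfolding A_def nonzero_divide_eq_eq[OF w] .
    moreover have "hardy_inner (H s) (H s) = of_real (\<nu> s)" by (simp only: hardy_inner_self[OF H] \<nu>_def)
    ultimately have "hardy_inner (\<lambda>z. H s (rot z)) (H s) = of_real (\<nu> s) * ((1 - of_real \<mu>) * w1 + of_real \<mu> * w2)"
      by (simp add: algebra_simps)
    then have "hardy_inner (\<lambda>z. H s (rot z)) (H s) / of_real (sq_norm (H s)) = (1 - \<mu>) *\<^sub>R w1 + \<mu> *\<^sub>R w2"
      using \<nu>_pos[of s] by (simp add: \<nu>_def scaleR_conv_of_real)
    then show ?thesis using normalise_in_range_set[OF H, of s] \<nu>_pos[of s] by (simp add: \<nu>_def)
  qed
qed

end

text \<open>Serves to exchange \<open>comp_op \<phi> f\<close> for the rotated function, with which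
  it agrees only inside the disc; circle integrals with 0 < r < 1 see nothing else.\<close>

lemma hardy_inner_cong:
  assumes g: "g \<in> hardy_space" and f: "f \<in> hardy_space" and eq: "\<And>z. cmod z < 1 \<Longrightarrow> g' z = g z"
  shows "hardy_inner g' f = hardy_inner g f"
proof -
  have "circle_inner g' f r = circle_inner g f r" if "r \<in> {0<..<1}" for r
    using that eq by (simp add: circle_inner_def norm_mult)
  then have "\<forall>\<^sub>F r in at_left 1. circle_inner g f r = circle_inner g' f r"
    using eventually_at_left_real[OF zero_less_one] by (auto elim: eventually_mono)
  then have "(circle_inner g' f \<longlongrightarrow> hardy_inner g f) (at_left 1)"
    by (rule Lim_transform_eventually[OF hardy_inner_eq_suminf(1)[OF g f]])
  then have "Lim (at_left 1) (circle_inner g' f) = hardy_inner g f"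
    by (intro tendsto_Lim) auto
  then show ?thesis by (simp add: hardy_inner_def circle_inner_def[abs_def])
qed

section \<open>Identification of the numerical range\<close>

lemma (in order_three_rotation) numerical_range_eq_range_set:
  assumes "\<And>z. cmod z < 1 \<Longrightarrow> \<phi> z = rot z"
  shows "numerical_range hardy_space hardy_inner (comp_op \<phi>) = range_set"
proof -
  have inner: "hardy_inner (comp_op \<phi> f) f = hardy_inner (\<lambda>z. f (rot z)) f" if "f \<in> hardy_space" for f
    by (rule hardy_inner_cong[OF hardy_space_rot(1)[OF that] that]) (simp add: comp_op_def assms)
  have norm: "Re (hardy_inner f f) = sq_norm f" if "f \<in> hardy_space" for f
    by (simp add: hardy_inner_self[OF that])
  show ?thesis
    unfolding numerical_range_def range_set_def
    by (intro Collect_cong ex_cong1) (auto simp: inner norm)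
qed

text \<open>A direction z enters the operator form as e = cnj z, because z \<bullet> p = Re (cnj z
  p); since Re (cnj z^3) = Re (z^3), the curve and the operator lead to the same cubic.\<close>

lemma (in order_three_rotation) range_set_eq_interior:
  "range_set = interior (convex hull {Complex x y | x y :: real. sextic L x y = 0})"
proof -
  let ?Z = "{Complex x y | x y :: real. sextic L x y = 0}"
  \<comment> \<open>Beyond the critical point the cubic is strictly increasing, so the root chosen
    here is the only one.\<close>
  define \<tau> where "\<tau> = (\<lambda>z. SOME t. 0 < t \<and> L < 3 * t^2 \<and> 4 * t^3 - 4 * L * t = Re (z^3))"
  have \<tau>: "0 < \<tau> z \<and> L < 3 * (\<tau> z)^2 \<and> 4 * (\<tau> z)^3 - 4 * L * \<tau> z = Re (z^3)" if "norm z = 1" for z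
  proof -
    have "\<bar>Re (z^3)\<bar> \<le> 1" using abs_Re_le_cmod[of "z^3"] that by (simp add: norm_power)
    then obtain t where "0 < t" "L < 3 * t^2" "4 * t^3 - 4 * L * t = Re (z^3)"
      by (rule top_root_exists[OF L_gt])
    then show ?thesis
      unfolding \<tau>_def using someI_ex[of "\<lambda>t. 0 < t \<and> L < 3 * t^2 \<and> 4 * t^3 - 4 * L * t = Re (z^3)"] by blast
  qed
  have inner: "z \<bullet> p = Re (cnj z * p)" for z p :: complex by (simp add: inner_complex_def)
  have Re_cnj: "Re (cnj z^3) = Re (z^3)" for z by (simp flip: complex_cnj_power)
  have close: "\<exists>w\<in>range_set. s < z \<bullet> w" if z: "norm z = 1" and s: "s < \<tau> z" for z s
  proof -
    note t = \<tau>[OF z]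
    have "cmod (cnj z) = 1" using z by simp
    moreover have "4 * (\<tau> z)^3 - 4 * L * \<tau> z = Re (cnj z^3)" using t by (simp only: Re_cnj)
    ultimately obtain f where f: "f \<in> hardy_space" "s * sq_norm f < Re (cnj z * hardy_inner (\<lambda>z. f (rot z)) f)"
      using form_close[of "cnj z" "\<tau> z" s] t s by blast
    have pos: "0 < sq_norm f"
    proof (rule ccontr)
      assume "\<not> ?thesis"
      then have "sq_norm f = 0" using sq_norm_nonneg[OF f(1)] by simp
      then show False using f form_null(3)[OF f(1) _ f(1)] by simp
    qed
    have "z \<bullet> (hardy_inner (\<lambda>z. f (rot z)) f / of_real (sq_norm f))
        = Re (cnj z * hardy_inner (\<lambda>z. f (rot z)) f) / sq_norm f"
      unfolding inner times_divide_eq_right by (rule Re_divide_of_real)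
    moreover have "s < Re (cnj z * hardy_inner (\<lambda>z. f (rot z)) f) / sq_norm f"
      using f(2) pos by (simp only: pos_less_divide_eq)
    ultimately have "s < z \<bullet> (hardy_inner (\<lambda>z. f (rot z)) f / of_real (sq_norm f))" by (simp only:)
    then show ?thesis using normalise_in_range_set[OF f(1) pos] by blast
  qed
  show ?thesis
  proof (rule interior_convex_hull_eqI[of ?Z \<tau>])
    fix z :: complex assume z: "norm z = 1"
    note t = \<tau>[OF z]
    show "z \<bullet> p \<le> \<tau> z" if "p \<in> ?Z" for p
    proof -
      have "sextic L (Re p) (Im p) = 0" using that by auto
      then show ?thesis using sextic_point_in_halfplane[OF L_gt z, of "\<tau> z" p] t unfolding inner by blast
    qed
    show "\<exists>p\<in>?Z. z \<bullet> p = \<tau> z"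
    proof -
      obtain p where p: "sextic L (Re p) (Im p) = 0" "Re (cnj z * p) = \<tau> z"
        using sextic_support_point[OF L_gt z, of "\<tau> z"] t by blast
      then have "p \<in> ?Z" by (intro CollectI exI[of _ "Re p"] exI[of _ "Im p"]) simp
      then show ?thesis using p(2) unfolding inner by blast
    qed
    show "0 < \<tau> z" using t by blast
    show "z \<bullet> w < \<tau> z" if "w \<in> range_set" for w
    proof -
      obtain f where f: "f \<in> hardy_space" "sq_norm f = 1" "w = hardy_inner (\<lambda>z. f (rot z)) f"
        using \<open>w \<in> range_set\<close> unfolding range_set_def by blast
      have "4 * (\<tau> z)^3 - 4 * L * \<tau> z = Re (cnj z^3)" using t by (simp only: Re_cnj)
      then show ?thesis
        using form_strict[OF f(1), of "cnj z" "\<tau> z"] f z t unfolding inner by simp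
    qed
  next
    show "\<exists>w\<in>range_set. s < z \<bullet> w" if "norm z = 1" "s < \<tau> z" for z s
      by (rule close[OF that])
    show "convex range_set" by (rule convex_range_set)
    have "norm (1 :: complex) = 1" by simp
    from close[OF this, of 0] show "range_set \<noteq> {}" using \<tau>[OF \<open>norm (1 :: complex) = 1\<close>] by auto
  qed
qed

text \<open>Conjugation by \<open>mobius a\<close> moves the fixed point to 0. The Schwarz lemma,
  applied to the conjugated map and to its inverse, gives equality of moduli at one nonzero point,
  hence a rotation; the third iterate yields l^3 = 1 and the first l \<noteq> 1.\<close>

lemma elliptic_order_three:
  assumes "elliptic_automorphism \<phi>" and order: "has_order \<phi> 3" and a: "cmod a < 1" "\<phi> a = a"
  obtains l where "l^3 = 1" "l \<noteq> 1" "\<And>z. cmod z < 1 \<Longrightarrow> \<phi> z = mobius a (l * mobius a z)"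
proof -
  obtain \<psi> where hol: "\<phi> holomorphic_on ball 0 1" "\<psi> holomorphic_on ball 0 1"
    and maps: "\<phi> ` ball 0 1 \<subseteq> ball 0 1" "\<psi> ` ball 0 1 \<subseteq> ball 0 1"
    and inv: "\<forall>z\<in>ball 0 1. \<psi> (\<phi> z) = z \<and> \<phi> (\<psi> z) = z"
    using assms(1) unfolding elliptic_automorphism_def disc_automorphism_def by blast
  have lt: "cmod (\<phi> z) < 1" "cmod (\<psi> z) < 1" if "cmod z < 1" for z using maps that by (auto simp: image_subset_iff)
  note mlt = mobius_range(1)[OF a(1)]
  have minv: "mobius a (mobius a z) = z" if "cmod z < 1" for z using mobius_involution[OF a(1)] that by simp
  have mhol: "mobius a holomorphic_on ball 0 1" using mobius_disc_algebra[OF a(1)] by (simp add: disc_algebra_def)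
  have m0: "mobius a 0 = a" "mobius a a = 0" by (simp_all add: mobius_def)
  have \<psi>a: "\<psi> a = a" using inv a by (metis mem_ball_0)
  define conj where "conj = (\<lambda>h z. mobius a (h (mobius a z)))"
  have conj: "conj h holomorphic_on ball 0 1" "conj h 0 = 0" "\<And>z. cmod z < 1 \<Longrightarrow> cmod (conj h z) < 1"
    if "h holomorphic_on ball 0 1" "h a = a" "h ` ball 0 1 \<subseteq> ball 0 1" for h
  proof -
    have hlt: "cmod (h z) < 1" if "cmod z < 1" for z using \<open>h ` ball 0 1 \<subseteq> ball 0 1\<close> that by (auto simp: image_subset_iff)
    have "(\<lambda>z. h (mobius a z)) holomorphic_on ball 0 1"
      by (rule holomorphic_on_compose_gen[OF mhol that(1), unfolded o_def]) (use mlt in auto)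
    then show "conj h holomorphic_on ball 0 1" unfolding conj_def
      by (rule holomorphic_on_compose_gen[OF _ mhol, unfolded o_def]) (use mlt hlt in auto)
    show "conj h 0 = 0" by (simp add: conj_def m0 that(2))
    show "cmod (conj h z) < 1" if "cmod z < 1" for z
      unfolding conj_def by (intro mlt hlt that)
  qed
  note c\<phi> = conj[OF hol(1) a(2) maps(1)] and c\<psi> = conj[OF hol(2) \<psi>a maps(2)]
  define w where "w = (1/2 :: complex)"
  have w: "cmod w < 1" "w \<noteq> 0" by (simp_all add: w_def)
  have "cmod (conj \<phi> w) \<le> cmod w" by (rule Schwarz_Lemma(1)[OF c\<phi> w(1)])
  moreover have "cmod w \<le> cmod (conj \<phi> w)"
  proof -
    have "conj \<psi> (conj \<phi> w) = w"
      using inv minv lt mlt w(1) by (simp add: conj_def)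
    moreover have "cmod (conj \<psi> (conj \<phi> w)) \<le> cmod (conj \<phi> w)"
      by (intro Schwarz_Lemma(1)[OF c\<psi>] c\<phi>(3) w(1))
    ultimately show ?thesis by simp
  qed
  ultimately have "cmod (conj \<phi> w) = cmod w" by simp
  then obtain l where l: "\<And>z. cmod z < 1 \<Longrightarrow> conj \<phi> z = l * z" "cmod l = 1"
    using Schwarz_Lemma(3)[OF c\<phi> w(1)] w by blast
  have \<phi>: "\<phi> z = mobius a (l * mobius a z)" if "cmod z < 1" for z
  proof -
    have "conj \<phi> (mobius a z) = l * mobius a z" by (rule l(1)[OF mlt[OF that]])
    then have "mobius a (\<phi> z) = l * mobius a z" by (simp add: conj_def minv that)
    then show ?thesis using minv[OF lt(1)[OF that]] by simp
  qed
  have \<phi>m: "\<phi> (mobius a z) = mobius a (l * z)" if "cmod z < 1" for z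
    using \<phi>[OF mlt[OF that]] by (simp add: minv that)
  have lz: "cmod (l * z) < 1" if "cmod z < 1" for z using that l(2) by (simp add: norm_mult)
  have "l^3 = 1"
  proof -
    have "(\<phi> ^^ 3) (mobius a w) = mobius a w" using order mlt[OF w(1)] by (simp add: has_order_def)
    moreover have "(\<phi> ^^ 3) (mobius a w) = mobius a (l * (l * (l * w)))"
      by (simp add: numeral_3_eq_3 \<phi>m lz w(1))
    ultimately have "mobius a (l * (l * (l * w))) = mobius a w" by simp
    then have "l * (l * (l * w)) = w" using minv lz w(1) by metis
    then show ?thesis using w(2) by (simp add: power3_eq_cube mult.assoc)
  qed
  moreover have "l \<noteq> 1"
  proof
    assume "l = 1"
    then have "\<forall>z\<in>ball 0 1. (\<phi> ^^ 1) z = z" using \<phi> minv by simp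
    then show False using order unfolding has_order_def by (metis one_less_numeral_iff semiring_norm(77) zero_less_one)
  qed
  ultimately show ?thesis using \<phi> by (rule that)
qed

theorem mainTheorem2:
  fixes \<phi> :: "complex \<Rightarrow> complex" and a :: complex and \<Delta> L :: real
  assumes "elliptic_automorphism \<phi>"
    and "has_order \<phi> 3"
    and "a \<in> unit_disc - {0}"
    and "\<phi> a = a"
    and "\<Delta> = cmod a / (1 + (cmod a)\<^sup>2)"
    and "L = (3 + 6 * \<Delta>^3 * sqrt (3 - 3 * \<Delta>^2) - 6 * \<Delta>^4 - 6 * \<Delta>^2)
             / (4 * (1 - \<Delta>^2) * (1 - 4 * \<Delta>^2))"
  shows "numerical_range hardy_space hardy_inner (comp_op \<phi>)
           = interior (convex hull {Complex x y | x y :: real. sextic L x y = 0}) \<and>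
         (\<exists>F. homogenization 6 (sextic (of_real L)) F \<and>
              curve_of_degree 6 (proj_zeros F) \<and>
              curve_of_class 3 F \<and>
              (\<forall>x y z :: real. real_focus F x y z \<longleftrightarrow>
                 z \<noteq> 0 \<and> Complex (x / z) (y / z)
                   \<in> {1, exp (2 * of_real pi * \<i> / 3), exp (4 * of_real pi * \<i> / 3)}))"
proof -
  have a: "cmod a < 1" "a \<noteq> 0" using assms(3) by auto
  obtain l where rotation: "l^3 = 1" "l \<noteq> 1" "\<And>z. cmod z < 1 \<Longrightarrow> \<phi> z = mobius a (l * mobius a z)"
    using elliptic_order_three[OF assms(1,2) a(1) assms(4)] by blast
  interpret order_three_rotation a l \<Delta> L
    by unfold_locales (fact a rotation assms)+
  have "numerical_range hardy_space hardy_inner (comp_op \<phi>)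
      = interior (convex hull {Complex x y | x y :: real. sextic L x y = 0})"
    using numerical_range_eq_range_set[of \<phi>] rotation(3) range_set_eq_interior by (simp add: rot_def)
  moreover obtain F where "homogenization 6 (sextic (of_real L)) F" "curve_of_degree 6 (proj_zeros F)"
    "curve_of_class 3 F"
    "\<And>x y z. real_focus F x y z \<longleftrightarrow> z \<noteq> 0 \<and>
      Complex (x / z) (y / z) \<in> {1, exp (2 * of_real pi * \<i> / 3), exp (4 * of_real pi * \<i> / 3)}"
    using curve_properties[OF L_gt] by blast
  ultimately show ?thesis by blast
qed

end
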